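(* Let $m \geq 5$ be an integer, let $\delta \geq 0$ be real, and let $k \geq 5$ be an odd integer. Let $d=\min\{m,k\}$ if $m$ is odd and $d=\min\{m-1,k\}$ if $m$ is even. Let $\alpha^*$ be the smallest positive solution $x$ of the equation $\Pr\left(\mathrm{Bin}(d-1,x) \geq \frac{d-1}{2}\right)=x$. Suppose that at time step $0$ each vertex of the preferential attachment graph $\mathrm{PA}_t(m,\delta)$ is red independently with probability $\alpha<\alpha^*$ and is otherwise blue, where $\alpha$ is a constant. Then for any constant $\varepsilon>0$, with high probability (as $t\to\infty$), under the protocol $\mathcal{MP}^k$ every vertex of $\mathrm{PA}_t(m,\delta)$ is blue at all time steps $\tau \geq \frac{1+\varepsilon}{\log_d\left(\frac{d-1}{2}\right)} \log_d \log_d t$.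
   Context: $\mathrm{Bin}(n,x)$ denotes a binomial random variable with $n$ trials and success probability $x$. A sequence of events $(\mathcal{E}_t)_t$ occurs with high probability if $\Pr(\mathcal{E}_t)\to 1$ as $t\to\infty$; here $t$ is the number of vertices, and the probability is over the random graph, the initial colouring (independent of the graph) and the random choices of the protocol. Preferential attachment graph. Let $[t]=\{1,\ldots,t\}$. For $m\in\mathbb{N}$ and $\delta>-m$ the random multigraph $\mathrm{PA}_t(m,\delta)$ on vertex set $[t]$ with $mt$ edges is defined as follows. Case $m=1$ (with a parameter $\delta>-1$): $\mathrm{PA}_1(1,\delta)$ is a single vertex $v_1^{(1)}$ with one self-loop. Given $\mathrm{PA}_t(1,\delta)$ with vertices $v^{(1)}_1,\ldots,v^{(1)}_t$ of degrees $D_1(t),\ldots,D_t(t)$ (a self-loop contributes $2$ to the degree), $\mathrm{PA}_{t+1}(1,\delta)$ is obtained by adding a vertex $v^{(1)}_{t+1}$ with a single edge, whose other end is $v^{(1)}_{t+1}$ itself with conditional probability $\frac{1+\delta}{t(2+\delta)+(1+\delta)}$ and is $v^{(1)}_i$, $i\in[t]$, with conditional probability $\frac{D_i(t)+\delta}{t(2+\delta)+(1+\delta)}$. Case $m>1$: $\mathrm{PA}_t(m,\delta)$ is obtained from $\mathrm{PA}_{mt}(1,\delta/m)$ by contracting, for each $i=1,\ldots,t$, the vertices $v^{(1)}_{(i-1)m+1},\ldots,v^{(1)}_{(i-1)m+m}$ into a single vertex $i$, retaining all loops and multiple edges (edges between contracted vertices become loops). Protocol $\mathcal{MP}^k$ ($k$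 odd). Each vertex is red or blue at time $0$. Synchronously at each time step $\tau=1,2,\ldots$, each vertex $v$ chooses (independently of everything else) a uniformly random set of $k$ of its neighbours, and the colour of $v$ at time $\tau$ is the majority colour of this set at time $\tau-1$. If $v$ does not have $k$ neighbours, it chooses a random set of largest possible odd cardinality. Neighbours are counted with multiplicity, i.e. the choice is among the edge-ends at $v$, so that the chosen set has size $\min\{k, \text{largest odd number not exceeding the degree of } v\}$. *)

theory Defs
  imports "HOL-Probability.Probability"
begin

text \<open>A multigraph is the list of its edges. Its edge-ends are the pairs \<open>(i, b)\<close>, where
  \<open>i\<close> is a position in that list; hence a loop at \<open>v\<close> contributes two edge-ends at \<open>v\<close>. The
  vertex set is not recorded: it is always \<open>{1..t}\<close> for the \<open>t\<close> at hand.\<close>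

type_synonym multigraph = "(nat \<times> nat) list"
type_synonym edge_end = "nat \<times> bool"

definition endpoint :: "multigraph \<Rightarrow> edge_end \<Rightarrow> nat" where
  "endpoint G e = (if snd e then snd (G ! fst e) else fst (G ! fst e))"

definition opposite :: "multigraph \<Rightarrow> edge_end \<Rightarrow> nat" where
  "opposite G e = endpoint G (fst e, \<not> snd e)"

definition edge_ends :: "multigraph \<Rightarrow> nat \<Rightarrow> edge_end set" where
  "edge_ends G v = {e. fst e < length G \<and> endpoint G e = v}"

definition vertex_degree :: "multigraph \<Rightarrow> nat \<Rightarrow> nat" where
  "vertex_degree G v = card (edge_ends G v)"

definition attach_pmf :: "real \<Rightarrow> nat \<Rightarrow> multigraph \<Rightarrow> nat pmf" where
  "attach_pmf \<delta> t G = embed_pmf (\<lambda>i.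
     if i = t + 1 then (1 + \<delta>) / (real t * (2 + \<delta>) + (1 + \<delta>))
     else if i \<in> {1..t} then (real (vertex_degree G i) + \<delta>) / (real t * (2 + \<delta>) + (1 + \<delta>))
     else 0)"

text \<open>Starting from the empty graph is only a convenience: the first vertex then receives a
  loop with probability \<open>1\<close>, see \<open>pa_one_1\<close> below.\<close>

primrec pa_one :: "real \<Rightarrow> nat \<Rightarrow> multigraph pmf" where
  "pa_one \<delta> 0 = return_pmf []"
| "pa_one \<delta> (Suc t) =
     bind_pmf (pa_one \<delta> t) (\<lambda>G. map_pmf (\<lambda>i. G @ [(t + 1, i)]) (attach_pmf \<delta> t G))"

text \<open>The vertices \<open>(i - 1) * m + 1, \<dots>, (i - 1) * m + m\<close> are merged into \<open>i\<close>.\<close>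

definition contract :: "nat \<Rightarrow> multigraph \<Rightarrow> multigraph" where
  "contract m G = map (map_prod (\<lambda>v. (v - 1) div m + 1) (\<lambda>v. (v - 1) div m + 1)) G"

definition pref_attach :: "nat \<Rightarrow> real \<Rightarrow> nat \<Rightarrow> multigraph pmf" where
  "pref_attach m \<delta> t = map_pmf (contract m) (pa_one (\<delta> / real m) (m * t))"

definition sample_size :: "nat \<Rightarrow> multigraph \<Rightarrow> nat \<Rightarrow> nat" where
  "sample_size k G v = min k (Max {j. odd j \<and> j \<le> vertex_degree G v})"

definition choice_pmf :: "nat \<Rightarrow> multigraph \<Rightarrow> nat \<Rightarrow> edge_end set pmf" where
  "choice_pmf k G v = pmf_of_set {S. S \<subseteq> edge_ends G v \<and> card S = sample_size k G v}"

text \<open>\<open>red G x c \<tau> v\<close>: vertex \<open>v\<close> is red at time \<open>\<tau>\<close> (otherwise it is blue), given the initial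
  colouring \<open>x\<close> (true means red) and, for every time step \<open>\<tau> \<ge> 1\<close> and vertex \<open>v\<close>, the set \<open>c (\<tau>, v)\<close> of
  edge-ends that \<open>v\<close> chooses at that step.\<close>

primrec red :: "multigraph \<Rightarrow> (nat \<Rightarrow> bool) \<Rightarrow> (nat \<times> nat \<Rightarrow> edge_end set) \<Rightarrow> nat \<Rightarrow> nat \<Rightarrow> bool"
  where
  "red G x c 0 v = x v"
| "red G x c (Suc \<tau>) v \<longleftrightarrow>
     2 * card {e \<in> c (Suc \<tau>, v). red G x c \<tau> (opposite G e)} > card (c (Suc \<tau>, v))"

definition initial_measure :: "real \<Rightarrow> nat \<Rightarrow> (nat \<Rightarrow> bool) measure" where
  "initial_measure \<alpha> t = Pi\<^sub>M {1..t} (\<lambda>_. measure_pmf (bernoulli_pmf \<alpha>))"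

definition choices_measure ::
  "nat \<Rightarrow> nat \<Rightarrow> multigraph \<Rightarrow> (nat \<times> nat \<Rightarrow> edge_end set) measure" where
  "choices_measure k t G = Pi\<^sub>M ({1..} \<times> {1..t}) (\<lambda>(\<tau>, v). measure_pmf (choice_pmf k G v))"

text \<open>The joint law of the graph, the initial colouring and all choices: given the graph \<open>G\<close>, the
  last two are independent, and the law of the initial colouring does not depend on \<open>G\<close>.\<close>

definition protocol_space ::
  "nat \<Rightarrow> nat \<Rightarrow> real \<Rightarrow> real \<Rightarrow> nat \<Rightarrow>
     (multigraph \<times> (nat \<Rightarrow> bool) \<times> (nat \<times> nat \<Rightarrow> edge_end set)) measure" where
  "protocol_space k m \<delta> \<alpha> t =
     measure_pmf (pref_attach m \<delta> t) \<bind>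
       (\<lambda>G. return (count_space UNIV) G \<Otimes>\<^sub>M (initial_measure \<alpha> t \<Otimes>\<^sub>M choices_measure k t G))"

text \<open>As \<open>x\<close> is a success probability, solutions are sought in \<open>{0<..1}\<close>; this does not affect
  the smallest one, because \<open>x = 1\<close> is a solution.\<close>

definition alpha_star :: "nat \<Rightarrow> real" where
  "alpha_star d = (LEAST x. 0 < x \<and> x \<le> 1 \<and>
     measure_pmf.prob (binomial_pmf (d - 1) x) {j. real j \<ge> (real d - 1) / 2} = x)"

lemma finite_edge_ends: "finite (edge_ends G v)"
proof (rule finite_subset)
  show "edge_ends G v \<subseteq> {..<length G} \<times> UNIV" by (auto simp: edge_ends_def)
qed auto

lemma vertex_degree_append:
  "vertex_degree (G @ [(a, b)]) v = vertex_degree G v + (if a = v then 1 else 0) + (if b = v then 1 else 0)"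
proof -
  let ?A = "if a = v then {(length G, False)} else {}"
  let ?B = "if b = v then {(length G, True)} else {}"
  have "edge_ends (G @ [(a, b)]) v = edge_ends G v \<union> (?A \<union> ?B)"
    by (auto simp: edge_ends_def endpoint_def nth_append less_Suc_eq split: if_splits)
  moreover have "edge_ends G v \<inter> (?A \<union> ?B) = {}" "?A \<inter> ?B = {}"
    by (auto simp: edge_ends_def)
  ultimately show ?thesis
    by (auto simp: vertex_degree_def card_Un_disjoint finite_edge_ends)
qed

lemma pmf_attach_pmf:
  assumes "\<delta> > -1" "t = 0 \<or> (\<forall>i\<in>{1..t}. vertex_degree G i \<ge> 1)" "(\<Sum>i=1..t. vertex_degree G i) = 2 * t"
  shows "pmf (attach_pmf \<delta> t G) i =
     (if i = t + 1 then (1 + \<delta>) / (real t * (2 + \<delta>) + (1 + \<delta>))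
      else if i \<in> {1..t} then (real (vertex_degree G i) + \<delta>) / (real t * (2 + \<delta>) + (1 + \<delta>))
      else 0)"
proof -
  define D where "D = real t * (2 + \<delta>) + (1 + \<delta>)"
  have "real t * (2 + \<delta>) \<ge> 0" using assms(1) by simp
  then have D: "D > 0" using assms(1) unfolding D_def by linarith
  define f where "f i = (if i = t + 1 then (1 + \<delta>) / D
      else if i \<in> {1..t} then (real (vertex_degree G i) + \<delta>) / D else 0)" for i
  have nn: "0 \<le> f i" for i
  proof -
    have "real (vertex_degree G i) + \<delta> \<ge> 0" if "i \<in> {1..t}"
    proof -
      have "real (vertex_degree G i) \<ge> 1" using assms(2) that by auto
      then show ?thesis using assms(1) by linarith
    qed
    then show ?thesis using assms(1) D by (simp add: f_def)
  qed
  have "(\<integral>\<^sup>+i. ennreal (f i) \<partial>count_space UNIV) = (\<integral>\<^sup>+i. ennreal (f i) \<partial>count_space {1..t+1})"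
    by (subst (2) nn_integral_count_space_indicator)
       (auto intro!: nn_integral_cong simp: f_def indicator_def)
  also have "\<dots> = ennreal (\<Sum>i=1..t+1. f i)"
    by (simp add: nn_integral_count_space_finite nn sum_ennreal del: sum.cl_ivl_Suc)
  also have "(\<Sum>i=1..t+1. f i) = (\<Sum>i=1..t. (real (vertex_degree G i) + \<delta>) / D) + (1 + \<delta>) / D"
    by (simp add: f_def)
  also have "(\<Sum>i=1..t. (real (vertex_degree G i) + \<delta>) / D)
      = (real (\<Sum>i=1..t. vertex_degree G i) + real t * \<delta>) / D"
    by (simp add: sum_divide_distrib[symmetric] sum.distrib)
  also have "\<dots> + (1 + \<delta>) / D = 1"
    unfolding assms(3) add_divide_distrib[symmetric] using D
    by (simp add: D_def algebra_simps)
  finally show ?thesis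
    unfolding attach_pmf_def D_def[symmetric]
    by (subst pmf_embed_pmf) (use nn in \<open>auto simp: f_def\<close>)
qed

lemma pa_one_invariant:
  assumes "\<delta> > -1" "G \<in> set_pmf (pa_one \<delta> t)"
  shows "length G = t" "\<forall>i\<in>{1..t}. vertex_degree G i \<ge> 1" "(\<Sum>i=1..t. vertex_degree G i) = 2 * t"
    "\<forall>i. i \<notin> {1..t} \<longrightarrow> vertex_degree G i = 0"
  using assms(2)
proof (induction t arbitrary: G)
  case 0
  { case 1 then show ?case by simp }
  { case 2 then show ?case by simp }
  { case 3 then show ?case by simp }
  { case 4 then show ?case by (simp add: vertex_degree_def edge_ends_def) }
next
  case (Suc t)
  have *: "length G = Suc t \<and> (\<forall>i\<in>{1..Suc t}. vertex_degree G i \<ge> 1) \<and>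
      (\<Sum>i=1..Suc t. vertex_degree G i) = 2 * Suc t \<and> (\<forall>i. i \<notin> {1..Suc t} \<longrightarrow> vertex_degree G i = 0)"
    if "G \<in> set_pmf (pa_one \<delta> (Suc t))" for G
  proof -
    from that obtain H i where H: "H \<in> set_pmf (pa_one \<delta> t)"
      and i: "i \<in> set_pmf (attach_pmf \<delta> t H)" and G: "G = H @ [(t + 1, i)]"
      by auto
    note IH = Suc.IH[OF H]
    have i_in: "i \<in> {1..Suc t}"
      using i pmf_attach_pmf[of \<delta> t H i] assms(1) IH
      by (auto simp: set_pmf_iff split: if_splits)
    have "(\<Sum>j=1..Suc t. vertex_degree G j) = (\<Sum>j=1..Suc t. vertex_degree H j)
        + (\<Sum>j=1..Suc t. if j = t + 1 then 1 else 0) + (\<Sum>j=1..Suc t. if j = i then 1 else 0)"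
      unfolding G vertex_degree_append sum.distrib by (simp add: eq_commute[of _ "Suc t"] eq_commute[of i])
    also have "(\<Sum>j=1..Suc t. vertex_degree H j) = 2 * t"
      using IH by simp
    finally have "(\<Sum>j=1..Suc t. vertex_degree G j) = 2 * Suc t"
      using i_in by (simp add: sum.delta del: sum.cl_ivl_Suc)
    then show ?thesis
      using IH i_in unfolding G vertex_degree_append by (auto simp: le_Suc_eq)
  qed
  { case 1 then show ?case using * by blast }
  { case 2 then show ?case using * by blast }
  { case 3 then show ?case using * by blast }
  { case 4 then show ?case using * by blast }
qed

lemma pa_one_1:
  assumes "\<delta> > -1"
  shows "pa_one \<delta> 1 = return_pmf [(1, 1)]"
proof -
  have "attach_pmf \<delta> 0 [] = return_pmf 1"
    using assms by (intro pmf_eqI) (auto simp: pmf_attach_pmf indicator_def)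
  then show ?thesis by (simp add: bind_return_pmf)
qed

lemma set_choice_pmf:
  assumes "vertex_degree G v \<ge> 1" "odd k"
  shows "set_pmf (choice_pmf k G v) = {S. S \<subseteq> edge_ends G v \<and> card S = sample_size k G v}"
    and "odd (sample_size k G v)"
proof -
  let ?J = "{j. odd j \<and> j \<le> vertex_degree G v}"
  have "finite ?J" by (rule finite_subset[of _ "{..vertex_degree G v}"]) auto
  moreover have "1 \<in> ?J" using assms(1) by simp
  ultimately have J: "Max ?J \<in> ?J" by (intro Max_in) blast+
  then show "odd (sample_size k G v)"
    using assms(2) by (auto simp: sample_size_def min_def)
  from J have "sample_size k G v \<le> card (edge_ends G v)"
    by (auto simp: sample_size_def vertex_degree_def)
  then obtain S where "S \<subseteq> edge_ends G v" "card S = sample_size k G v"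
    by (meson obtain_subset_with_card_n)
  moreover have "finite {S. S \<subseteq> edge_ends G v \<and> card S = sample_size k G v}"
    by (rule finite_subset[of _ "Pow (edge_ends G v)"]) (auto simp: finite_edge_ends)
  ultimately show "set_pmf (choice_pmf k G v) = {S. S \<subseteq> edge_ends G v \<and> card S = sample_size k G v}"
    unfolding choice_pmf_def by (intro set_pmf_of_set) auto
qed

text \<open>The sigma-algebra underlying \<open>protocol_space\<close>; the event that all vertices are blue from some
  time on belongs to it (\<open>event_measurable\<close> below).\<close>

definition protocol_algebra ::
  "nat \<Rightarrow> (multigraph \<times> (nat \<Rightarrow> bool) \<times> (nat \<times> nat \<Rightarrow> edge_end set)) measure" where
  "protocol_algebra t = count_space UNIV \<Otimes>\<^sub>M
     (Pi\<^sub>M {1..t} (\<lambda>_. count_space UNIV) \<Otimes>\<^sub>M Pi\<^sub>M ({1..} \<times> {1..t}) (\<lambda>_. count_space UNIV))"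

lemma kernel_measurable:
  "(\<lambda>G. return (count_space UNIV) G \<Otimes>\<^sub>M (initial_measure \<alpha> t \<Otimes>\<^sub>M choices_measure k t G))
     \<in> measurable (measure_pmf p) (prob_algebra (protocol_algebra t))"
proof -
  have "prob_space (initial_measure \<alpha> t)" "prob_space (choices_measure k t G)" for G
    unfolding initial_measure_def choices_measure_def
    by (auto intro!: prob_space_PiM prob_space_measure_pmf)
  then have "prob_space (return (count_space UNIV) G \<Otimes>\<^sub>M (initial_measure \<alpha> t \<Otimes>\<^sub>M choices_measure k t G))"
    for G by (intro prob_space_pair prob_space_return) auto
  moreover have "sets (return (count_space UNIV) G \<Otimes>\<^sub>M (initial_measure \<alpha> t \<Otimes>\<^sub>M choices_measure k t G))
      = sets (protocol_algebra t)" for G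
    unfolding protocol_algebra_def initial_measure_def choices_measure_def
    by (intro sets_pair_measure_cong sets_PiM_cong) auto
  ultimately show ?thesis
    by (auto simp: space_prob_algebra)
qed

lemma prob_space_protocol_space: "prob_space (protocol_space k m \<delta> \<alpha> t)"
  and sets_protocol_space: "sets (protocol_space k m \<delta> \<alpha> t) = sets (protocol_algebra t)"
proof -
  have *: "measure_pmf p \<in> space (prob_algebra (measure_pmf p))" for p :: "multigraph pmf"
    by (simp add: space_prob_algebra prob_space_measure_pmf)
  show "prob_space (protocol_space k m \<delta> \<alpha> t)"
    unfolding protocol_space_def by (rule prob_space_bind'[OF * kernel_measurable])
  show "sets (protocol_space k m \<delta> \<alpha> t) = sets (protocol_algebra t)"
    unfolding protocol_space_def by (rule sets_bind'[OF * kernel_measurable])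
qed

lemma space_PiM_outside: "f \<in> space (Pi\<^sub>M I M) \<Longrightarrow> i \<notin> I \<Longrightarrow> f i = undefined"
  unfolding space_PiM by (rule PiE_arb)

lemma red_outside:
  assumes "x \<in> space (Pi\<^sub>M {1..t} (\<lambda>_. count_space UNIV))"
    "c \<in> space (Pi\<^sub>M ({1..} \<times> {1..t}) (\<lambda>_. count_space UNIV))" "u \<notin> {1..t}" "v \<notin> {1..t}"
  shows "red G x c \<tau> u = red G x c \<tau> v"
proof -
  have "x u = undefined" "x v = undefined" "c (s, u) = undefined" "c (s, v) = undefined" for s
    using space_PiM_outside[OF assms(1), of u] space_PiM_outside[OF assms(1), of v]
      space_PiM_outside[OF assms(2), of "(s, u)"] space_PiM_outside[OF assms(2), of "(s, v)"] assms(3,4)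
    by auto
  then show ?thesis by (cases \<tau>) simp_all
qed

lemma red_measurable:
  "Measurable.pred (Pi\<^sub>M {1..t} (\<lambda>_. count_space UNIV) \<Otimes>\<^sub>M Pi\<^sub>M ({1..} \<times> {1..t}) (\<lambda>_. count_space UNIV))
     (\<lambda>\<omega>. red G (fst \<omega>) (snd \<omega>) \<tau> v)" (is "Measurable.pred (?X \<Otimes>\<^sub>M ?C) _")
proof (induction \<tau> arbitrary: v)
  case 0
  have "(\<lambda>x. x v) \<in> measurable ?X (count_space UNIV)"
  proof (cases "v \<in> {1..t}")
    case False
    then have "(\<lambda>x. x v) \<in> measurable ?X (count_space UNIV) \<longleftrightarrow>
        (\<lambda>x. undefined :: bool) \<in> measurable ?X (count_space UNIV)"
      by (intro measurable_cong space_PiM_outside)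
    then show ?thesis by simp
  qed measurable
  then show ?case by simp
next
  case (Suc \<tau>)
  define F where "F = Pow {1..t} \<union> (\<lambda>A. A \<union> - {1..t}) ` Pow {1..t}"
  have "finite F" by (simp add: F_def)
  have c: "(\<lambda>c. c (Suc \<tau>, v)) \<in> measurable ?C (count_space UNIV)"
  proof (cases "v \<in> {1..t}")
    case False
    then have "(\<lambda>c. c (Suc \<tau>, v)) \<in> measurable ?C (count_space UNIV) \<longleftrightarrow>
        (\<lambda>c. undefined :: edge_end set) \<in> measurable ?C (count_space UNIV)"
      by (intro measurable_cong) (erule space_PiM_outside, simp)
    then show ?thesis by simp
  next
    case True
    then show ?thesis by (intro measurable_component_singleton) auto
  qed
  define Q where "Q A = {S. 2 * card {e \<in> S. opposite G e \<in> A} > card S}" for A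
  have "Measurable.pred (?X \<Otimes>\<^sub>M ?C) (\<lambda>\<omega>. snd \<omega> (Suc \<tau>, v) \<in> Q A)" for A
    by (rule measurable_compose[OF measurable_compose[OF measurable_snd c]]) simp
  with Suc have "Measurable.pred (?X \<Otimes>\<^sub>M ?C) (\<lambda>\<omega>. \<exists>A\<in>F.
      (\<forall>u. red G (fst \<omega>) (snd \<omega>) \<tau> u = (u \<in> A)) \<and> snd \<omega> (Suc \<tau>, v) \<in> Q A)"
    using \<open>finite F\<close> by measurable
  also have "?this \<longleftrightarrow> ?case"
  proof (intro measurable_cong)
    fix \<omega> assume w: "\<omega> \<in> space (?X \<Otimes>\<^sub>M ?C)"
    define R where "R = {u. red G (fst \<omega>) (snd \<omega>) \<tau> u}"
    have "R \<in> F"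
    proof (cases "R \<subseteq> {1..t}")
      case False
      then have "- {1..t} \<subseteq> R"
        using w red_outside[of "fst \<omega>" t "snd \<omega>" _ _ G \<tau>]
        by (force simp: R_def space_pair_measure)
      then have "R = (R \<inter> {1..t}) \<union> - {1..t}" by auto
      then show ?thesis unfolding F_def by blast
    qed (simp add: F_def)
    have "(\<forall>u. red G (fst \<omega>) (snd \<omega>) \<tau> u = (u \<in> A)) \<longleftrightarrow> A = R" for A
      by (auto simp: R_def)
    with \<open>R \<in> F\<close> show "(\<exists>A\<in>F. (\<forall>u. red G (fst \<omega>) (snd \<omega>) \<tau> u = (u \<in> A)) \<and>
        snd \<omega> (Suc \<tau>, v) \<in> Q A) = red G (fst \<omega>) (snd \<omega>) (Suc \<tau>) v"
      by (auto simp: Q_def R_def)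
  qed
  finally show ?case .
qed

lemma event_measurable:
  "{\<omega> \<in> space (protocol_space k m \<delta> \<alpha> t).
      case \<omega> of (G, x, c) \<Rightarrow> \<forall>\<tau>. real \<tau> \<ge> T \<longrightarrow> (\<forall>v\<in>{1..t}. \<not> red G x c \<tau> v)}
     \<in> sets (protocol_space k m \<delta> \<alpha> t)"
proof -
  let ?N = "Pi\<^sub>M {1..t} (\<lambda>_. count_space UNIV) \<Otimes>\<^sub>M Pi\<^sub>M ({1..} \<times> {1..t}) (\<lambda>_. count_space UNIV)
    :: ((nat \<Rightarrow> bool) \<times> (nat \<times> nat \<Rightarrow> edge_end set)) measure"
  have "Measurable.pred ?N (\<lambda>\<omega>. \<forall>\<tau>. real \<tau> \<ge> T \<longrightarrow> (\<forall>v\<in>{1..t}. \<not> red G (fst \<omega>) (snd \<omega>) \<tau> v))" for G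
    using red_measurable[where t = t and G = G] by measurable
  then have "Measurable.pred (count_space UNIV \<Otimes>\<^sub>M ?N) (\<lambda>\<omega>.
      \<forall>\<tau>. real \<tau> \<ge> T \<longrightarrow> (\<forall>v\<in>{1..t}. \<not> red (fst \<omega>) (fst (snd \<omega>)) (snd (snd \<omega>)) \<tau> v))"
    by (intro measurable_compose_countable[where g = fst and f = "\<lambda>G \<omega>. \<forall>\<tau>. real \<tau> \<ge> T \<longrightarrow>
        (\<forall>v\<in>{1..t}. \<not> red G (fst (snd \<omega>)) (snd (snd \<omega>)) \<tau> v)"] measurable_compose[OF measurable_snd]
        measurable_fst)
  then show ?thesis
    unfolding sets_protocol_space sets_eq_imp_space_eq[OF sets_protocol_space]
      protocol_algebra_def pred_def case_prod_unfold .
qed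

lemma alpha_star_least:
  assumes "odd d" "d \<ge> 5"
  defines "S \<equiv> {x. 0 < x \<and> x \<le> 1 \<and>
     measure_pmf.prob (binomial_pmf (d - 1) x) {j. real j \<ge> (real d - 1) / 2} = x}"
  shows "alpha_star d \<in> S" "\<And>x. x \<in> S \<Longrightarrow> alpha_star d \<le> x"
proof -
  define n h where "n = d - 1" and "h = (d - 1) div 2"
  have h: "h \<ge> 2" "n = 2 * h" using assms(1,2) by (auto simp: n_def h_def elim!: oddE)
  have set_eq: "{j. real j \<ge> (real d - 1) / 2} = {h..}"
    using h assms(2) unfolding n_def by (auto simp: field_simps of_nat_diff)
  define f where "f x = (\<Sum>j=h..n. real (n choose j) * x ^ j * (1 - x) ^ (n - j))" for x :: real
  have prob: "measure_pmf.prob (binomial_pmf (d - 1) x) {j. real j \<ge> (real d - 1) / 2} = f x"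
    if "0 \<le> x" "x \<le> 1" for x
  proof -
    have "measure_pmf.prob (binomial_pmf n x) {h..}
        = measure_pmf.prob (binomial_pmf n x) ({h..} \<inter> set_pmf (binomial_pmf n x))"
      by (rule measure_Int_set_pmf[symmetric])
    also have "\<dots> = measure_pmf.prob (binomial_pmf n x) ({h..n} \<inter> set_pmf (binomial_pmf n x))"
      using that by (intro arg_cong2[where f = measure]) (auto simp: set_pmf_binomial_eq)
    also have "\<dots> = measure_pmf.prob (binomial_pmf n x) {h..n}"
      by (rule measure_Int_set_pmf)
    also have "\<dots> = f x"
      using that by (simp add: measure_measure_pmf_finite f_def)
    finally show ?thesis unfolding set_eq n_def .
  qed
  define C where "C = (\<Sum>j=h..n. real (n choose j)) + 1"
  have C: "C \<ge> 1" by (simp add: C_def sum_nonneg)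
  have small: "f x < x" if "0 < x" "x < 1 / C" for x
  proof -
    have "x \<le> 1" using that C by (smt (verit) divide_le_eq_1_pos)
    have "f x \<le> (\<Sum>j=h..n. real (n choose j) * x ^ 2)"
      unfolding f_def
    proof (intro sum_mono)
      fix j assume "j \<in> {h..n}"
      then have "x ^ j \<le> x ^ 2" using h that \<open>x \<le> 1\<close> by (intro power_decreasing) auto
      moreover have "(1 - x) ^ (n - j) \<le> 1" using that \<open>x \<le> 1\<close> by (intro power_le_one) auto
      ultimately have "x ^ j * (1 - x) ^ (n - j) \<le> x ^ 2 * 1"
        using that \<open>x \<le> 1\<close> by (intro mult_mono) auto
      then show "real (n choose j) * x ^ j * (1 - x) ^ (n - j) \<le> real (n choose j) * x ^ 2"
        by (simp add: mult_left_mono mult.assoc)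
    qed
    also have "\<dots> \<le> C * x ^ 2"
      by (simp add: C_def sum_distrib_right[symmetric] distrib_right)
    also have "\<dots> = (C * x) * x" by (simp add: power2_eq_square)
    also have "\<dots> < 1 * x" using that C by (intro mult_strict_right_mono) (auto simp: field_simps)
    finally show ?thesis by simp
  qed
  have S: "S = {x \<in> {1 / C..1}. f x = x}"
  proof (intro set_eqI iffI)
    fix x assume "x \<in> S"
    then have x: "0 < x" "x \<le> 1" "f x = x" using prob[of x] by (auto simp: S_def)
    with small[of x] have "\<not> x < 1 / C" by linarith
    with x show "x \<in> {x \<in> {1 / C..1}. f x = x}" by simp
  next
    fix x assume x: "x \<in> {x \<in> {1 / C..1}. f x = x}"
    then have "1 / C \<le> x" "x \<le> 1" by auto
    moreover have "0 < 1 / C" using C by simp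
    ultimately have "0 < x" "x \<le> 1" by linarith+
    with x show "x \<in> S" using prob[of x] by (simp add: S_def)
  qed
  have "compact {x \<in> {1 / C..1}. f x - x = 0}"
  proof -
    have "closed ({1 / C..1} \<inter> (\<lambda>x. f x - x) -` {0})"
      unfolding f_def by (intro continuous_closed_preimage continuous_intros)
    then have "closed {x \<in> {1 / C..1}. f x - x = 0}" by (simp add: vimage_def Int_def)
    moreover have "bounded {x \<in> {1 / C..1}. f x - x = 0}"
      by (rule bounded_subset[OF bounded_closed_interval]) auto
    ultimately show ?thesis by (simp add: compact_eq_bounded_closed)
  qed
  then have "compact S" unfolding S by simp
  moreover have "1 \<in> S"
  proof -
    have "f 1 = (\<Sum>j=h..n. if j = n then 1 else 0)"
      unfolding f_def by (intro sum.cong) auto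
    then show ?thesis using h C by (simp add: S)
  qed
  ultimately obtain a where a: "a \<in> S" "\<And>x. x \<in> S \<Longrightarrow> a \<le> x"
    using compact_attains_inf[of S] by blast
  have "alpha_star d = a"
    unfolding alpha_star_def by (rule Least_equality) (use a in \<open>auto simp: S_def\<close>)
  with a show "alpha_star d \<in> S" "\<And>x. x \<in> S \<Longrightarrow> alpha_star d \<le> x" by simp_all
qed

end

theory Submission
  imports Defs "HOL-Real_Asymp.Real_Asymp"
begin

text \<open>Put \<open>d = 2 h + 1\<close> and let \<open>y\<close> be the orbit of \<open>\<alpha>\<close> under \<open>x \<mapsto> Pr (Bin (2 h, x) \<ge> h)\<close>. For
  \<open>\<alpha> < \<alpha>\<^sup>*\<close> it tends to \<open>0\<close>, and then doubly exponentially with base \<open>h = (d - 1) / 2\<close>, so that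
  \<open>y\<close> is \<open>o (1 / t)\<close> after \<open>(1 + \<epsilon>) log log t / log h\<close> steps.

  Follow the choices backwards in time from a vertex \<open>v\<close> along non-backtracking walks, regarding
  every edge-end that leads back to where the exploration came from as red. As long as
  the explored neighbourhood is a tree, the votes received by a vertex are independent and the
  probability of being red after \<open>\<tau>\<close> steps is at most \<open>y \<tau>\<close>; one of the at least \<open>2 h + 1\<close> votes is lost to the
  return edge, which is why \<open>2 h\<close> and \<open>h\<close> appear in the recursion. A neighbour of \<open>v\<close> whose exploration is not a tree yields a
  small set of edges in which every vertex except possibly \<open>v\<close> has degree at least \<open>2\<close>; three such neighbours yield a
  small set of edges of minimum degree \<open>2\<close> in which \<open>v\<close> has degree at least \<open>3\<close>.

  The probability that given edges are all present in the \<open>m = 1\<close> graph is, up to a factor that depends only on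
  their number, at most the product of \<open>(a b) powr (- 1 / 2)\<close> over these edges \<open>a b\<close>. A first moment
  computation therefore excludes such edge sets of size \<open>O (log log t)\<close> around every vertex \<open>v > K\<close>, where
  \<open>K = exp ((log log t) ^ 3)\<close>. So a vertex \<open>v > K\<close> has at most two bad neighbours, which are not enough for a red
  majority, and all these vertices are blue at two consecutive times. The vertices up to \<open>K\<close> have degree at
  least \<open>K ^ 3\<close> but only \<open>O (K)\<close> edge-ends between themselves, hence they sample
  vertices beyond \<open>K\<close> only and become blue one step later. A blue graph stays blue.\<close>

section \<open>Binomial tails and the mean-field recursion\<close>

text \<open>The parameters are forced from two sides. A pattern has \<open>O(log log t)\<close>
  edges, and summing its weights over all positions costs a power of \<open>log t\<close> per edge,
  in total \<open>exp (O((log log t)^2))\<close>. In an edge set of minimum degree 2 each vertex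
  \<open>w\<close> has weight at most \<open>1 / w\<close>, whose sum is logarithmic; cycles are
  therefore not excluded. Degree 3 at \<open>v > K\<close> supplies a further factor
  \<open>K powr (-1/2)\<close>, and the cube in the exponent of \<open>K\<close> makes it win.
  Conversely \<open>K\<close> is \<open>t powr o(1)\<close>, so a failure probability that is a mere
  power of \<open>K / t\<close> suffices for the degrees up to \<open>K\<close>.

  Dependence is the obstacle on the protocol side: the colours of two neighbours influence each
  other through their common edge. Deeming that edge red errs upwards, by monotonicity of the
  majority, and makes branches with disjoint supports independent. Two blue times are needed beyond
  \<open>K\<close> because a vertex up to \<open>K\<close> looks one step back while the others must
  be blue at the final time itself. The factor \<open>1 + \<epsilon>\<close> puts
  \<open>(ln t) powr (1 + \<epsilon>)\<close> into the exponent, which absorbs all constants and the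
  union over \<open>t\<close> vertices.\<close>

primrec btail :: "nat \<Rightarrow> nat \<Rightarrow> real \<Rightarrow> real" where
  "btail 0 h x = (if h = 0 then 1 else 0)"
| "btail (Suc n) h x = x * btail n (h - 1) x + (1 - x) * btail n h x"

text \<open>\<open>btail n h x\<close> is the tail Pr(Bin(n, x) \<ge> h), built by conditioning on
  one trial and thus a polynomial for every real \<open>x\<close>. Truncated \<open>h - 1\<close>
  makes both branches tails at threshold 0 when \<open>h = 0\<close>.\<close>

lemma btail_0 [simp]: "btail n 0 x = 1"
  by (induction n) auto

lemma btail_nonneg: "0 \<le> x \<Longrightarrow> x \<le> 1 \<Longrightarrow> 0 \<le> btail n h x"
  by (induction n arbitrary: h) auto

lemma btail_le_1: "0 \<le> x \<Longrightarrow> x \<le> 1 \<Longrightarrow> btail n h x \<le> 1"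
proof (induction n arbitrary: h)
  case (Suc n)
  have "x * btail n (h - 1) x + (1 - x) * btail n h x \<le> x * 1 + (1 - x) * 1"
    using Suc by (intro add_mono mult_left_mono) auto
  then show ?case by simp
qed auto

lemma btail_eq_0: "n < h \<Longrightarrow> btail n h x = 0"
  by (induction n arbitrary: h) auto

lemma btail_Suc_le: "0 \<le> x \<Longrightarrow> x \<le> 1 \<Longrightarrow> btail n (Suc h) x \<le> btail n h x"
proof (induction n arbitrary: h)
  case (Suc n)
  have "btail n h x \<le> btail n (h - 1) x" using Suc.IH[of "h - 1"] Suc.prems by (cases h) auto
  then show ?case using Suc by (auto intro!: add_mono mult_left_mono)
qed auto

lemma btail_antimono: "0 \<le> x \<Longrightarrow> x \<le> 1 \<Longrightarrow> h \<le> h' \<Longrightarrow> btail n h' x \<le> btail n h x"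
  by (rule lift_Suc_antimono_le[where f = "\<lambda>h. btail n h x"]) (auto intro: btail_Suc_le)

text \<open>The left side is affine in \<open>p\<close>, and its slope, a difference of adjacent
  tails, is nonnegative. It covers one vote whose red probability \<open>p\<close> is only bounded
  by \<open>x\<close>.\<close>

lemma btail_mix_mono:
  assumes "0 \<le> p" "p \<le> x" "x \<le> 1"
  shows "p * btail n (h - 1) x + (1 - p) * btail n h x \<le> btail (Suc n) h x"
proof -
  have "0 \<le> (x - p) * (btail n (h - 1) x - btail n h x)"
    using assms btail_antimono[of x "h - 1" h n] by (intro mult_nonneg_nonneg) auto
  then show ?thesis by (simp add: algebra_simps)
qed

text \<open>Making one of the \<open>n + 1\<close> trials a certain success can only help. This
  handles a sample that avoids the return edge: it is no worse than one with a free red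
  vote.\<close>

lemma btail_Suc_Suc_le:
  assumes "0 \<le> x" "x \<le> 1"
  shows "btail (Suc n) (Suc h) x \<le> btail n h x"
proof -
  have "btail (Suc n) (Suc h) x \<le> x * btail n h x + (1 - x) * btail n h x"
    using assms btail_Suc_le[of x n h] by (auto intro!: add_mono mult_left_mono)
  then show ?thesis by (simp add: algebra_simps)
qed

text \<open>A union bound over the sets of \<open>h\<close> successful trials, their number
  estimated by \<open>2 ^ n\<close>. The power \<open>h\<close> is the source of the doubly
  exponential decay.\<close>

lemma btail_le_power: "0 \<le> x \<Longrightarrow> x \<le> 1 \<Longrightarrow> btail n h x \<le> 2 ^ n * x ^ h"
proof (induction n arbitrary: h)
  case (Suc n)
  show ?case
  proof (cases h)
    case (Suc h')
    have "x * btail n h' x + (1 - x) * btail n h x \<le> x * (2 ^ n * x ^ h') + 1 * (2 ^ n * x ^ h)"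
      using Suc.IH[of h'] Suc.IH[of h] Suc.prems
      by (intro add_mono mult_left_mono mult_mono) (auto intro: btail_nonneg)
    then show ?thesis using Suc by (simp add: algebra_simps)
  qed (use Suc.prems in \<open>simp add: one_le_power[of "2::real" "Suc n", simplified]\<close>)
qed auto

lemma btail_diff: "btail n h x - btail n (Suc h) x = real (n choose h) * x ^ h * (1 - x) ^ (n - h)"
proof (induction n arbitrary: h)
  case (Suc n)
  show ?case
  proof (cases h)
    case 0
    have "btail n (Suc 0) x = 1 - (1 - x) ^ n" using Suc.IH[of 0] by simp
    then have "btail (Suc n) 0 x - btail (Suc n) (Suc 0) x = 1 - (x + (1 - x) * (1 - (1 - x) ^ n))" by simp
    then show ?thesis using 0 by (simp add: algebra_simps)
  next
    case (Suc h')
    have "btail (Suc n) h x - btail (Suc n) (Suc h) x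
      = x * (btail n h' x - btail n (Suc h') x) + (1 - x) * (btail n h x - btail n (Suc h) x)"
      using Suc by (simp add: algebra_simps)
    also have "\<dots> = x * (real (n choose h') * x ^ h' * (1 - x) ^ (n - h')) +
        (1 - x) * (real (n choose h) * x ^ h * (1 - x) ^ (n - h))"
      using Suc.IH by simp
    also have "(1 - x) * (real (n choose h) * x ^ h * (1 - x) ^ (n - h)) =
        real (n choose h) * x ^ h * (1 - x) ^ (n - h')"
    proof (cases "h \<le> n")
      case True
      then have "n - h' = Suc (n - h)" using Suc by simp
      then show ?thesis by simp
    next
      case False
      then show ?thesis by (simp add: binomial_eq_0)
    qed
    finally show ?thesis using Suc by (simp add: algebra_simps)
  qed
qed auto

text \<open>Exchanging success and failure: at least \<open>h\<close> failures means not at least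
  \<open>n + 1 - h\<close> successes.\<close>

lemma btail_reflect: "h \<le> Suc n \<Longrightarrow> btail n h (1 - x) = 1 - btail n (Suc n - h) x"
proof (induction n arbitrary: h)
  case 0
  then show ?case by (auto simp: le_Suc_eq)
next
  case (Suc n)
  consider "h = 0" | "h = Suc (Suc n)" | "1 \<le> h" "h \<le> Suc n" using Suc.prems by linarith
  then show ?case
  proof cases
    case 3
    then have eq: "Suc n - (h - 1) = Suc (Suc n) - h" "Suc (Suc n) - h - 1 = Suc n - h" by auto
    have "btail n (h - 1) (1 - x) = 1 - btail n (Suc (Suc n) - h) x"
      using Suc.IH[of "h - 1"] 3 by (simp add: eq(1)[simplified])
    moreover have "btail n h (1 - x) = 1 - btail n (Suc n - h) x" using Suc.IH[of h] 3 by simp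
    ultimately have "btail (Suc n) h (1 - x) = (1 - x) * (1 - btail n (Suc (Suc n) - h) x)
        + x * (1 - btail n (Suc n - h) x)" by simp
    then show ?thesis unfolding btail.simps eq by (simp add: algebra_simps)
  qed (auto simp: btail_eq_0)
qed

text \<open>For a fair coin, reflection turns the tail at \<open>h\<close> into one minus the tail
  at \<open>h + 1\<close>, and the latter is no larger than the tail at \<open>h\<close>. Hence
  \<open>alpha_star d\<close> cannot exceed 1/2.\<close>

lemma btail_half: "btail (2 * h) h (1 / 2) \<ge> 1 / 2"
proof -
  have "btail (2 * h) h (1 / 2) = 1 - btail (2 * h) (Suc h) (1 / 2)"
    using btail_reflect[of h "2 * h" "1 / 2"] by simp
  moreover have "btail (2 * h) (Suc h) (1 / 2) \<le> btail (2 * h) h (1 / 2)"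
    by (rule btail_Suc_le) auto
  ultimately show ?thesis by linarith
qed

text \<open>Add two trials and raise the threshold by one. The outcome changes only if
  \<open>h - 1\<close> successes are followed by two successes (gained) or \<open>h\<close>
  successes by two failures (lost). The second mass is the larger because the central binomial
  coefficient is and \<open>x \<le> 1 - x\<close>. Hence samples larger than \<open>2 h + 1\<close>
  are no worse.\<close>

lemma btail_majority_Suc_le:
  assumes "0 \<le> x" "x \<le> 1 / 2"
  shows "btail (2 * Suc h) (Suc h) x \<le> btail (2 * h) h x"
proof (cases h)
  case 0
  then show ?thesis using btail_le_1[of x 2 1] assms by simp
next
  case (Suc g)
  let ?n = "2 * h"
  have "btail (2 * Suc h) (Suc h) x =
     x^2 * btail ?n g x + 2 * x * (1 - x) * btail ?n h x + (1 - x)^2 * btail ?n (Suc h) x"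
    using Suc by (simp add: power2_eq_square algebra_simps)
  also have "\<dots> = btail ?n h x + x^2 * (btail ?n g x - btail ?n h x)
      - (1 - x)^2 * (btail ?n h x - btail ?n (Suc h) x)"
    by (simp add: power2_eq_square algebra_simps)
  also have "x^2 * (btail ?n g x - btail ?n h x) = real (?n choose g) * x ^ (g + 2) * (1 - x) ^ (g + 2)"
    unfolding Suc btail_diff by (simp add: power_add power2_eq_square algebra_simps)
  also have "(1 - x)^2 * (btail ?n h x - btail ?n (Suc h) x)
     = real (?n choose h) * x ^ (g + 1) * (1 - x) ^ (g + 3)"
    unfolding btail_diff by (simp add: Suc power_add power2_eq_square eval_nat_numeral algebra_simps)
  also have "real (?n choose g) * x ^ (g + 2) * (1 - x) ^ (g + 2)
      \<le> real (?n choose h) * x ^ (g + 1) * (1 - x) ^ (g + 3)"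
  proof -
    have "?n choose g \<le> ?n choose h"
      by (rule binomial_mono) (use Suc in auto)
    moreover have "x ^ (g + 2) * (1 - x) ^ (g + 2) \<le> x ^ (g + 1) * (1 - x) ^ (g + 3)"
    proof -
      have "(x ^ (g + 1) * (1 - x) ^ (g + 2)) * x \<le> (x ^ (g + 1) * (1 - x) ^ (g + 2)) * (1 - x)"
        using assms by (intro mult_left_mono) auto
      then show ?thesis by (simp add: algebra_simps eval_nat_numeral)
    qed
    ultimately show ?thesis using assms unfolding mult.assoc
      by (intro mult_mono[OF _ _ _ mult_nonneg_nonneg]) auto
  qed
  finally show ?thesis by simp
qed

lemma btail_majority_antimono:
  assumes "0 \<le> x" "x \<le> 1 / 2" "h \<le> h'"
  shows "btail (2 * h') h' x \<le> btail (2 * h) h x"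
  by (rule lift_Suc_antimono_le[where f = "\<lambda>h. btail (2 * h) h x"])
    (use assms btail_majority_Suc_le in \<open>auto simp del: btail.simps\<close>)

lemma continuous_on_btail: "continuous_on S (btail n h)"
proof (induction n arbitrary: h)
  case (Suc n)
  have "btail (Suc n) h = (\<lambda>x. x * btail n (h - 1) x + (1 - x) * btail n h x)" by auto
  then show ?case using Suc by (auto intro!: continuous_intros)
next
  case 0
  have "btail 0 h = (\<lambda>x. if h = 0 then 1 else 0)" by auto
  then show ?case by simp
qed

lemma binomial_tail_eq_btail:
  assumes "0 \<le> x" "x \<le> 1"
  shows "measure_pmf.prob (binomial_pmf n x) {h..} = btail n h x"
proof (induction "Suc n - h" arbitrary: h)
  case 0
  have "measure_pmf.prob (binomial_pmf n x) {h..} = measure_pmf.prob (binomial_pmf n x) {}"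
    by (rule measure_pmf.finite_measure_eq_AE)
      (use assms 0 in \<open>auto simp: AE_measure_pmf_iff set_pmf_binomial_eq split: if_splits\<close>)
  then show ?case using 0 by (simp add: btail_eq_0)
next
  case (Suc k)
  have "measure_pmf.prob (binomial_pmf n x) ({h} \<union> {Suc h..}) =
      pmf (binomial_pmf n x) h + measure_pmf.prob (binomial_pmf n x) {Suc h..}"
    by (subst measure_pmf.finite_measure_Union) (auto simp: measure_pmf_single)
  moreover have "{h} \<union> {Suc h..} = {h..}" by auto
  ultimately show ?case using Suc.hyps(1)[of "Suc h"] Suc.hyps(2) btail_diff[of n h x] assms by simp
qed

text \<open>The tail is below the diagonal near 0, being at most \<open>4 ^ h * x ^ 2\<close> there.
  Were it not below at some \<open>x < alpha_star d\<close>, the intermediate value theorem would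
  give a smaller positive fixed point. At 1/2 it is not below, by \<open>btail_half\<close>.\<close>

lemma alpha_star_props:
  assumes "odd d" "d \<ge> 5"
  defines "h \<equiv> (d - 1) div 2"
  shows "alpha_star d \<le> 1 / 2" and "\<And>x. 0 < x \<Longrightarrow> x < alpha_star d \<Longrightarrow> btail (2 * h) h x < x"
proof -
  have h: "h \<ge> 2" "d - 1 = 2 * h" using assms by (auto elim!: oddE)
  have set_eq: "{j. real j \<ge> (real d - 1) / 2} = {h..}"
  proof -
    have "(real d - 1) / 2 = real h" using h assms(2) by (simp add: of_nat_diff[symmetric])
    then show ?thesis by auto
  qed
  have prob: "measure_pmf.prob (binomial_pmf (d - 1) x) {j. real j \<ge> (real d - 1) / 2} = btail (2 * h) h x"
    if "0 < x" "x \<le> 1" for x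
    unfolding set_eq h(2) using that by (intro binomial_tail_eq_btail) auto
  note least = alpha_star_least[OF assms(1,2)]
  have le1: "alpha_star d \<le> 1" using least(1) by simp
  show less: "btail (2 * h) h x < x" if x: "0 < x" "x < alpha_star d" for x
  proof (rule ccontr)
    assume nless: "\<not> btail (2 * h) h x < x"
    \<comment> \<open>This makes \<open>4 ^ h * z\<close> at most 1/2, so the tail at
      \<open>z\<close> is below \<open>z\<close>.\<close>
    define z where "z = min x (1 / (2 * 4 ^ h))"
    have z: "0 < z" "z \<le> x" "z \<le> 1 / (2 * 4 ^ h)" using x by (auto simp: z_def)
    have z1: "z \<le> 1" using z x le1 by simp
    have "btail (2 * h) h z \<le> 4 ^ h * z ^ h"
      using btail_le_power[of z "2 * h" h] z z1 by (simp add: power_mult)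
    also have "\<dots> \<le> 4 ^ h * z ^ 2"
      using z z1 h by (intro mult_left_mono power_decreasing) auto
    also have "\<dots> = (4 ^ h * z) * z" by (simp add: power2_eq_square)
    also have "\<dots> < 1 * z"
    proof (rule mult_strict_right_mono)
      have "4 ^ h * z \<le> 4 ^ h * (1 / (2 * 4 ^ h))" using z by (intro mult_left_mono) auto
      then show "4 ^ h * z < 1" by simp
    qed (use z in auto)
    finally have "btail (2 * h) h z - z \<le> 0" by simp
    moreover have "0 \<le> btail (2 * h) h x - x" using nless by simp
    moreover have "continuous_on {z..x} (\<lambda>x. btail (2 * h) h x - x)"
      by (intro continuous_on_diff continuous_on_btail continuous_on_id)
    ultimately obtain w where w: "z \<le> w" "w \<le> x" "btail (2 * h) h w - w = 0"
      using IVT'[of "\<lambda>x. btail (2 * h) h x - x" z 0 x] z by auto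
    then have "alpha_star d \<le> w" using least(2)[of w] prob[of w] z x le1 by simp
    with w x show False by simp
  qed
  show "alpha_star d \<le> 1 / 2"
  proof (rule ccontr)
    assume "\<not> alpha_star d \<le> 1 / 2"
    then show False using less[of "1 / 2"] btail_half[of h] by simp
  qed
qed

section \<open>The orbit of \<alpha> and its doubly exponential decay\<close>

definition mean_field :: "nat \<Rightarrow> real \<Rightarrow> nat \<Rightarrow> real" where
  "mean_field h \<alpha> \<tau> = (btail (2 * h) h ^^ \<tau>) \<alpha>"

lemma mean_field_0 [simp]: "mean_field h \<alpha> 0 = \<alpha>"
  and mean_field_Suc: "mean_field h \<alpha> (Suc \<tau>) = btail (2 * h) h (mean_field h \<alpha> \<tau>)"
  by (simp_all add: mean_field_def)

context
  fixes d h :: nat and \<alpha> :: real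
  assumes d: "odd d" "d \<ge> 5" and h_def: "h = (d - 1) div 2"
    and \<alpha>: "0 \<le> \<alpha>" "\<alpha> < alpha_star d"
begin

lemma two_le_h: "2 \<le> h" using d unfolding h_def by (auto elim!: oddE)

lemma mean_field_step_le:
  assumes "0 \<le> x" "x < alpha_star d" shows "btail (2 * h) h x \<le> x"
proof (cases "x = 0")
  case True
  then show ?thesis using btail_le_power[of 0 "2 * h" h] two_le_h by (simp add: power_0_left)
next
  case False
  then show ?thesis using alpha_star_props(2)[OF d, of x] assms unfolding h_def by simp
qed

lemma mean_field_bounds: "0 \<le> mean_field h \<alpha> \<tau> \<and> mean_field h \<alpha> \<tau> \<le> \<alpha>"
proof (induction \<tau>)
  case (Suc \<tau>)
  have "\<alpha> \<le> 1/2" using \<alpha> alpha_star_props(1)[OF d] by simp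
  then show ?case using Suc mean_field_step_le[of "mean_field h \<alpha> \<tau>"] \<alpha>
    by (auto simp: mean_field_Suc intro: btail_nonneg)
qed (use \<alpha> in auto)

lemma mean_field_le_half: "mean_field h \<alpha> \<tau> \<le> 1 / 2"
  using mean_field_bounds[of \<tau>] \<alpha> alpha_star_props(1)[OF d] by simp

lemma decseq_mean_field: "decseq (mean_field h \<alpha>)"
proof (rule decseq_SucI)
  fix n show "mean_field h \<alpha> (Suc n) \<le> mean_field h \<alpha> n"
    unfolding mean_field_Suc using mean_field_bounds[of n] \<alpha> by (intro mean_field_step_le) auto
qed

text \<open>The orbit decreases, and by continuity its limit is a fixed point in
  \<open>[0, \<alpha>]\<close>; below \<open>alpha_star d\<close> only 0 is one.\<close>

lemma mean_field_tendsto_0: "mean_field h \<alpha> \<longlonglongrightarrow> 0"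
proof -
  have "convergent (mean_field h \<alpha>)"
    by (rule decseq_convergent[OF decseq_mean_field, where B = 0])
      (use mean_field_bounds in \<open>auto simp: convergent_def\<close>)
  then obtain l where l: "mean_field h \<alpha> \<longlonglongrightarrow> l" by (auto simp: convergent_def)
  have "0 \<le> l" "l \<le> \<alpha>"
    using mean_field_bounds by (auto intro: LIMSEQ_le_const[OF l] LIMSEQ_le_const2[OF l])
  have "isCont (btail (2 * h) h) l"
    using continuous_on_btail[of UNIV] by (simp add: continuous_on_eq_continuous_at)
  then have "(\<lambda>n. btail (2 * h) h (mean_field h \<alpha> n)) \<longlonglongrightarrow> btail (2 * h) h l"
    using l by (rule isCont_tendsto_compose)
  then have "(\<lambda>n. mean_field h \<alpha> (Suc n)) \<longlonglongrightarrow> btail (2 * h) h l" by (simp add: mean_field_Suc)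
  with LIMSEQ_Suc[OF l] have "btail (2 * h) h l = l" using LIMSEQ_unique by blast
  then have "l = 0" using alpha_star_props(2)[OF d, of l] \<open>0 \<le> l\<close> \<open>l \<le> \<alpha>\<close> \<alpha> unfolding h_def by force
  with l show ?thesis by simp
qed

text \<open>With \<open>C = 4 ^ h\<close>, consecutive values satisfy
  \<open>C * y' \<le> (C * y) ^ h\<close>, because \<open>C ^ 2 \<le> C ^ h\<close>. Once
  \<open>C * y\<close> is below \<open>exp (-1)\<close>, each step multiplies the exponent by
  \<open>h\<close>.\<close>

lemma mean_field_doubly_exponential: "\<exists>\<tau>0. \<forall>j. mean_field h \<alpha> (\<tau>0 + j) \<le> exp (- real (h ^ j))"
proof -
  define C :: real where "C = 4 ^ h"
  have C: "C \<ge> 1" by (simp add: C_def)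
  have "eventually (\<lambda>n. mean_field h \<alpha> n < exp (-1) / C) sequentially"
    using order_tendstoD(2)[OF mean_field_tendsto_0, of "exp (-1) / C"] C by simp
  then obtain \<tau>0 where \<tau>0: "mean_field h \<alpha> \<tau>0 < exp (-1) / C" by (auto simp: eventually_sequentially)
  have "C * mean_field h \<alpha> (\<tau>0 + j) \<le> exp (- real (h ^ j))" for j
  proof (induction j)
    case 0
    then show ?case using \<tau>0 C by (simp add: field_simps)
  next
    case (Suc j)
    let ?y = "mean_field h \<alpha> (\<tau>0 + j)"
    have y: "0 \<le> ?y" "?y \<le> 1" using mean_field_bounds[of "\<tau>0 + j"] mean_field_le_half[of "\<tau>0 + j"] by auto
    have "C * mean_field h \<alpha> (\<tau>0 + Suc j) \<le> C * (C * ?y ^ h)"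
      using btail_le_power[OF y, of "2 * h" h] C
      by (intro mult_left_mono) (auto simp: mean_field_Suc C_def power_mult)
    also have "\<dots> = C ^ 2 * ?y ^ h" by (simp add: power2_eq_square)
    also have "\<dots> \<le> C ^ h * ?y ^ h"
      using C two_le_h y by (intro mult_right_mono power_increasing) auto
    also have "\<dots> = (C * ?y) ^ h" by (simp add: power_mult_distrib)
    also have "\<dots> \<le> exp (- real (h ^ j)) ^ h" using Suc C y by (intro power_mono) auto
    also have "\<dots> = exp (- real (h ^ Suc j))" by (simp flip: exp_of_nat_mult)
    finally show ?case .
  qed
  moreover have "mean_field h \<alpha> n \<le> C * mean_field h \<alpha> n" for n
    using mult_right_mono[OF C, of "mean_field h \<alpha> n"] mean_field_bounds[of n] by simp
  ultimately show ?thesis by (meson order_trans)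
qed

end

section \<open>Product measures and disjoint coordinates\<close>

definition depends_on :: "(('a \<Rightarrow> 'b) \<Rightarrow> bool) \<Rightarrow> 'a set \<Rightarrow> bool" where
  "depends_on Q K \<longleftrightarrow> (\<forall>\<omega> \<omega>'. (\<forall>i\<in>K. \<omega> i = \<omega>' i) \<longrightarrow> Q \<omega> = Q \<omega>')"

lemma depends_onD: "depends_on Q K \<Longrightarrow> (\<And>i. i \<in> K \<Longrightarrow> \<omega> i = \<omega>' i) \<Longrightarrow> Q \<omega> = Q \<omega>'"
  unfolding depends_on_def by blast

lemma Pi_pmf_outside: "finite J \<Longrightarrow> f \<in> set_pmf (Pi_pmf J d p) \<Longrightarrow> x \<notin> J \<Longrightarrow> f x = d"
  using set_Pi_pmf_subset by fastforce

text \<open>Outside \<open>K\<close> the coordinates may be overwritten by the default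
  \<open>d\<close> without changing \<open>Q\<close>, and this overwriting maps the one product law
  to the other.\<close>

lemma prob_Pi_pmf_depends_on:
  assumes "finite J" "depends_on Q K"
  shows "measure_pmf.prob (Pi_pmf J d p) {\<omega>. Q \<omega>} = measure_pmf.prob (Pi_pmf (J \<inter> K) d p) {\<omega>. Q \<omega>}"
proof -
  have "measure_pmf.prob (Pi_pmf (J \<inter> K) d p) {\<omega>. Q \<omega>} =
      measure_pmf.prob (Pi_pmf J d p) {\<omega>. Q (\<lambda>x. if x \<in> J \<inter> K then \<omega> x else d)}"
    by (subst Pi_pmf_subset[of J]) (use assms in \<open>auto simp: vimage_def\<close>)
  also have "\<dots> = measure_pmf.prob (Pi_pmf J d p) {\<omega>. Q \<omega>}"
  proof (rule measure_pmf.finite_measure_eq_AE)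
    have "Q (\<lambda>x. if x \<in> J \<inter> K then \<omega> x else d) = Q \<omega>" if "\<omega> \<in> set_pmf (Pi_pmf J d p)" for \<omega>
      by (rule depends_onD[OF assms(2)]) (use Pi_pmf_outside[OF assms(1) that] in auto)
    then show "AE x in Pi_pmf J d p. (x \<in> {\<omega>. Q (\<lambda>x. if x \<in> J \<inter> K then \<omega> x else d)}) = (x \<in> {\<omega>. Q \<omega>})"
      by (simp add: AE_measure_pmf_iff)
  qed auto
  finally show ?thesis by simp
qed

lemma measure_pair_pmf_Times:
  "measure_pmf.prob (pair_pmf p q) (A \<times> B) = measure_pmf.prob p A * measure_pmf.prob q B"
proof -
  have "measure_pmf.prob (pair_pmf p q) (A \<times> B) =
      measure_pmf.prob (pair_pmf p q) ((A \<inter> set_pmf p) \<times> (B \<inter> set_pmf q))"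
    by (subst measure_Int_set_pmf[symmetric]) (auto intro!: arg_cong2[where f = measure])
  also have "\<dots> = measure_pmf.prob p (A \<inter> set_pmf p) * measure_pmf.prob q (B \<inter> set_pmf q)"
    by (rule measure_pmf_prob_product) (auto intro: countable_subset[OF Int_lower2])
  finally show ?thesis by (simp add: measure_Int_set_pmf)
qed

lemma prob_Pi_pmf_indep:
  assumes "finite J" "depends_on Q K" "depends_on R L" "K \<inter> L = {}"
  shows "measure_pmf.prob (Pi_pmf J d p) {\<omega>. Q \<omega> \<and> R \<omega>} =
     measure_pmf.prob (Pi_pmf J d p) {\<omega>. Q \<omega>} * measure_pmf.prob (Pi_pmf J d p) {\<omega>. R \<omega>}"
proof -
  let ?mrg = "\<lambda>(f, g) x. if x \<in> J \<inter> K then f x else g x"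
  let ?P = "Pi_pmf (J \<inter> K) d p" and ?R = "Pi_pmf (J - K) d p"
  have "Pi_pmf J d p = map_pmf ?mrg (pair_pmf ?P ?R)"
    using Pi_pmf_union[of "J \<inter> K" "J - K" d p] assms(1) by (simp add: Int_Diff_Un Int_Diff_disjoint)
  then have "measure_pmf.prob (Pi_pmf J d p) {\<omega>. Q \<omega> \<and> R \<omega>} =
      measure_pmf.prob (pair_pmf ?P ?R) {z. Q (?mrg z) \<and> R (?mrg z)}"
    by (simp add: vimage_def)
  also have "\<dots> = measure_pmf.prob (pair_pmf ?P ?R) ({\<omega>. Q \<omega>} \<times> {\<omega>. R \<omega>})"
  proof (rule measure_pmf.finite_measure_eq_AE)
    have "Q (?mrg (f, g)) = Q f" "R (?mrg (f, g)) = R g" if "f \<in> set_pmf ?P" "g \<in> set_pmf ?R" for f g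
      by (rule depends_onD[OF assms(2)] depends_onD[OF assms(3)];
          use Pi_pmf_outside[OF _ that(1)] Pi_pmf_outside[OF _ that(2)] assms(1,4) in auto)+
    then show "AE x in pair_pmf ?P ?R. (x \<in> {z. Q (?mrg z) \<and> R (?mrg z)}) = (x \<in> {\<omega>. Q \<omega>} \<times> {\<omega>. R \<omega>})"
      by (auto simp: AE_measure_pmf_iff)
  qed auto
  also have "\<dots> = measure_pmf.prob ?P {\<omega>. Q \<omega>} * measure_pmf.prob ?R {\<omega>. R \<omega>}"
    by (rule measure_pair_pmf_Times)
  also have "measure_pmf.prob ?P {\<omega>. Q \<omega>} = measure_pmf.prob (Pi_pmf J d p) {\<omega>. Q \<omega>}"
    using prob_Pi_pmf_depends_on[OF assms(1,2)] by simp
  also have "measure_pmf.prob ?R {\<omega>. R \<omega>} = measure_pmf.prob (Pi_pmf J d p) {\<omega>. R \<omega>}"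
  proof -
    have "J \<inter> (L - K) = J \<inter> L" "(J - K) \<inter> L = J \<inter> L" using assms(4) by auto
    then show ?thesis
      using prob_Pi_pmf_depends_on[OF assms(1,3)] prob_Pi_pmf_depends_on[OF _ assms(3), of "J - K"] assms(1)
      by simp
  qed
  finally show ?thesis .
qed

lemma depends_on_card:
  fixes E :: "'i \<Rightarrow> ('a \<Rightarrow> 'b) \<Rightarrow> bool"
  assumes "\<And>f. f \<in> F \<Longrightarrow> depends_on (E f) (K f)"
  shows "depends_on (\<lambda>\<omega>. P (card {f\<in>F. E f \<omega>})) (\<Union>f\<in>F. K f)"
  unfolding depends_on_def
proof (intro allI impI)
  fix \<omega> \<omega>' :: "'a \<Rightarrow> 'b" assume "\<forall>i\<in>\<Union>f\<in>F. K f. \<omega> i = \<omega>' i"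
  then have "E f \<omega> = E f \<omega>'" if "f \<in> F" for f using that by (intro depends_onD[OF assms]) auto
  then have "{f\<in>F. E f \<omega>} = {f\<in>F. E f \<omega>'}" by auto
  then show "P (card {f\<in>F. E f \<omega>}) = P (card {f\<in>F. E f \<omega>'})" by simp
qed

text \<open>Reveal the events one by one. Disjoint supports make the next event independent of the
  count of the others, so the recursion of \<open>btail\<close> holds with a success probability
  \<open>q \<le> y\<close>, which \<open>btail_mix_mono\<close> replaces by
  \<open>y\<close>.\<close>

lemma prob_card_ge_le_btail:
  assumes "finite J" "finite F" "0 \<le> y" "y \<le> 1"
    and "\<And>f. f \<in> F \<Longrightarrow> depends_on (E f) (K f)" "disjoint_family_on K F"
    and "\<And>f. f \<in> F \<Longrightarrow> measure_pmf.prob (Pi_pmf J d p) {\<omega>. E f \<omega>} \<le> y"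
  shows "measure_pmf.prob (Pi_pmf J d p) {\<omega>. h \<le> card {f\<in>F. E f \<omega>}} \<le> btail (card F) h y"
  using assms(2,5-)
proof (induction F arbitrary: h)
  case (insert f F)
  let ?M = "Pi_pmf J d p"
  let ?c = "\<lambda>\<omega>. card {f\<in>F. E f \<omega>}"
  have ceq: "card {g\<in>insert f F. E g \<omega>} = ?c \<omega> + (if E f \<omega> then 1 else 0)" for \<omega>
  proof -
    have "{g\<in>insert f F. E g \<omega>} = (if E f \<omega> then insert f {f\<in>F. E f \<omega>} else {f\<in>F. E f \<omega>})" by auto
    then show ?thesis using insert by simp
  qed
  have dep_F: "depends_on (\<lambda>\<omega>. l \<le> ?c \<omega>) (\<Union>f\<in>F. K f)" for l
    by (rule depends_on_card) (use insert.prems in auto)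
  have dep_f: "depends_on (E f) (K f)" "depends_on (\<lambda>\<omega>. \<not> E f \<omega>) (K f)"
    using insert.prems(1)[of f] by (auto simp: depends_on_def)
  have disj: "K f \<inter> (\<Union>f\<in>F. K f) = {}"
    using insert.prems(2) insert.hyps(2) by (auto simp: disjoint_family_on_def)
  have IH: "measure_pmf.prob ?M {\<omega>. l \<le> ?c \<omega>} \<le> btail (card F) l y" for l
    using insert.prems by (intro insert.IH) (auto simp: disjoint_family_on_def)
  define q where "q = measure_pmf.prob ?M {\<omega>. E f \<omega>}"
  have q: "0 \<le> q" "q \<le> y" using insert.prems(3)[of f] by (auto simp: q_def)
  have nq: "measure_pmf.prob ?M {\<omega>. \<not> E f \<omega>} = 1 - q"
    using measure_pmf.prob_compl[of "{\<omega>. E f \<omega>}" ?M] by (simp add: q_def Compl_eq_Diff_UNIV[symmetric] Collect_neg_eq)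
  have "measure_pmf.prob ?M {\<omega>. h \<le> card {g\<in>insert f F. E g \<omega>}} =
      measure_pmf.prob ?M ({\<omega>. E f \<omega> \<and> h - 1 \<le> ?c \<omega>} \<union> {\<omega>. \<not> E f \<omega> \<and> h \<le> ?c \<omega>})"
    unfolding ceq by (intro arg_cong2[where f = measure]) auto
  also have "\<dots> = measure_pmf.prob ?M {\<omega>. E f \<omega> \<and> h - 1 \<le> ?c \<omega>} + measure_pmf.prob ?M {\<omega>. \<not> E f \<omega> \<and> h \<le> ?c \<omega>}"
    by (rule measure_pmf.finite_measure_Union) auto
  also have "\<dots> = q * measure_pmf.prob ?M {\<omega>. h - 1 \<le> ?c \<omega>} + (1 - q) * measure_pmf.prob ?M {\<omega>. h \<le> ?c \<omega>}"
    unfolding prob_Pi_pmf_indep[OF assms(1) dep_f(1) dep_F disj] prob_Pi_pmf_indep[OF assms(1) dep_f(2) dep_F disj]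
      nq q_def[symmetric] ..
  also have "\<dots> \<le> q * btail (card F) (h - 1) y + (1 - q) * btail (card F) h y"
    using q assms(4) IH by (intro add_mono mult_left_mono) auto
  also have "\<dots> \<le> btail (Suc (card F)) h y" using q assms(4) by (intro btail_mix_mono) auto
  finally show ?case using insert.hyps by simp
qed auto

text \<open>Conditioning on coordinate \<open>j\<close>: the event \<open>Q s\<close> does not look
  at \<open>j\<close>, so its probability is unaffected. It allows a sample to be frozen before the
  votes of its members are examined.\<close>

lemma prob_Pi_pmf_condition_le:
  assumes "finite J" "j \<in> J" "\<And>s. depends_on (Q s) (- {j})"
    and "\<And>s. s \<in> set_pmf (p j) \<Longrightarrow> measure_pmf.prob (Pi_pmf J d p) {\<omega>. Q s \<omega>} \<le> b"
  shows "measure_pmf.prob (Pi_pmf J d p) {\<omega>. Q (\<omega> j) \<omega>} \<le> b"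
proof -
  have b: "0 \<le> b" using assms(4) set_pmf_not_empty[of "p j"] measure_nonneg order_trans by blast
  let ?J = "J - {j}"
  have J: "J = insert j ?J" using assms(2) by auto
  have eq: "measure_pmf.prob (Pi_pmf ?J d p) {f. Q s (f(j := s))} = measure_pmf.prob (Pi_pmf J d p) {\<omega>. Q s \<omega>}" for s
  proof -
    have "Q s (f(j := s)) = Q s f" for f by (rule depends_onD[OF assms(3)]) auto
    moreover have "J \<inter> - {j} = ?J" "?J \<inter> - {j} = ?J" by auto
    ultimately show ?thesis
      using prob_Pi_pmf_depends_on[OF assms(1) assms(3)] by simp
  qed
  have "emeasure (measure_pmf (Pi_pmf J d p)) {\<omega>. Q (\<omega> j) \<omega>} =
      (\<integral>\<^sup>+s. emeasure (measure_pmf (map_pmf (\<lambda>f. f(j := s)) (Pi_pmf ?J d p))) {\<omega>. Q (\<omega> j) \<omega>} \<partial>p j)"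
    by (subst J, subst Pi_pmf_insert') (use assms(1) in \<open>auto simp: emeasure_bind_pmf map_pmf_def[symmetric]\<close>)
  also have "\<dots> = (\<integral>\<^sup>+s. ennreal (measure_pmf.prob (Pi_pmf J d p) {\<omega>. Q s \<omega>}) \<partial>p j)"
    by (intro nn_integral_cong) (simp add: eq[symmetric] measure_pmf.emeasure_eq_measure vimage_def)
  also have "\<dots> \<le> (\<integral>\<^sup>+s. ennreal b \<partial>p j)"
    by (intro nn_integral_mono_AE) (use assms(4) in \<open>auto simp: AE_measure_pmf_iff intro: ennreal_leI\<close>)
  also have "\<dots> = ennreal b" by simp
  finally show ?thesis using b by (simp add: measure_pmf.emeasure_eq_measure)
qed

section \<open>Non-backtracking exploration\<close>

definition rev_end :: "edge_end \<Rightarrow> edge_end" where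
  "rev_end e = (fst e, \<not> snd e)"

lemma rev_end_simps [simp]: "fst (rev_end e) = fst e" "rev_end (rev_end e) = e" "rev_end e \<noteq> e"
  by (auto simp: rev_end_def prod_eq_iff)

lemma opposite_conv_rev_end: "opposite G e = endpoint G (rev_end e)"
  by (simp add: opposite_def rev_end_def)

lemma opposite_rev_end [simp]: "opposite G (rev_end e) = endpoint G e"
  by (simp add: opposite_conv_rev_end)

lemma mem_edge_ends [simp]: "e \<in> edge_ends G v \<longleftrightarrow> fst e < length G \<and> endpoint G e = v"
  by (simp add: edge_ends_def)

text \<open>The colour at time \<open>\<tau>\<close> of the vertex opposite to \<open>e\<close>, with the end at which \<open>e\<close> arrives deemed red. Only
  the colours and choices at the coordinates in \<open>nb_support\<close> matter.\<close>

primrec nb_red :: "multigraph \<Rightarrow> (nat \<times> nat \<Rightarrow> edge_end set) \<Rightarrow> nat \<Rightarrow> edge_end \<Rightarrow> bool" where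
  "nb_red G \<omega> 0 e \<longleftrightarrow> \<omega> (0, opposite G e) \<noteq> {}"
| "nb_red G \<omega> (Suc \<tau>) e \<longleftrightarrow> card (\<omega> (Suc \<tau>, opposite G e)) <
     2 * card {f \<in> \<omega> (Suc \<tau>, opposite G e). f = rev_end e \<or> f \<in> edge_ends G (opposite G e) \<and> nb_red G \<omega> \<tau> f}"

primrec nb_support :: "multigraph \<Rightarrow> nat \<Rightarrow> edge_end \<Rightarrow> (nat \<times> nat) set" where
  "nb_support G 0 e = {(0, opposite G e)}"
| "nb_support G (Suc \<tau>) e = insert (Suc \<tau>, opposite G e)
     (\<Union>f\<in>edge_ends G (opposite G e) - {rev_end e}. nb_support G \<tau> f)"

text \<open>The supports consist of pairs (time, vertex). A vertex met at two different times is no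
  obstacle, since its choices at different times are independent; only collisions at equal time
  count.\<close>

primrec treelike :: "multigraph \<Rightarrow> nat \<Rightarrow> edge_end \<Rightarrow> bool" where
  "treelike G 0 e \<longleftrightarrow> True"
| "treelike G (Suc \<tau>) e \<longleftrightarrow> (\<forall>f\<in>edge_ends G (opposite G e) - {rev_end e}. treelike G \<tau> f) \<and>
     disjoint_family_on (nb_support G \<tau>) (edge_ends G (opposite G e) - {rev_end e})"

lemma nb_support_time: "i \<in> nb_support G \<tau> e \<Longrightarrow> fst i \<le> \<tau>"
  by (induction \<tau> arbitrary: e) fastforce+

lemma depends_on_nb_red: "depends_on (\<lambda>\<omega>. nb_red G \<omega> \<tau> e) (nb_support G \<tau> e)"
proof (induction \<tau> arbitrary: e)
  case (Suc \<tau>)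
  show ?case unfolding depends_on_def
  proof (intro allI impI)
    fix \<omega> \<omega>' :: "nat \<times> nat \<Rightarrow> edge_end set" assume eq: "\<forall>i\<in>nb_support G (Suc \<tau>) e. \<omega> i = \<omega>' i"
    have "nb_red G \<omega> \<tau> f = nb_red G \<omega>' \<tau> f" if "f \<in> edge_ends G (opposite G e)" "f \<noteq> rev_end e" for f
      by (rule depends_onD[OF Suc]) (use eq that in auto)
    then have "(f = rev_end e \<or> f \<in> edge_ends G (opposite G e) \<and> nb_red G \<omega> \<tau> f) =
      (f = rev_end e \<or> f \<in> edge_ends G (opposite G e) \<and> nb_red G \<omega>' \<tau> f)" for f
      by blast
    then show "nb_red G \<omega> (Suc \<tau>) e = nb_red G \<omega>' (Suc \<tau>) e"
      using eq by (simp del: mem_edge_ends)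
  qed
qed (auto simp: depends_on_def)

lemma depends_on_nb_red_before: "depends_on (\<lambda>\<omega>. P (nb_red G \<omega> \<tau>)) (- {(Suc \<tau>, u)})"
  unfolding depends_on_def
proof (intro allI impI)
  fix \<omega> \<omega>' :: "nat \<times> nat \<Rightarrow> edge_end set" assume eq: "\<forall>i\<in>- {(Suc \<tau>, u)}. \<omega> i = \<omega>' i"
  have "nb_red G \<omega> \<tau> e = nb_red G \<omega>' \<tau> e" for e
  proof (rule depends_onD[OF depends_on_nb_red])
    fix i assume "i \<in> nb_support G \<tau> e"
    then have "i \<noteq> (Suc \<tau>, u)" using nb_support_time[of i G \<tau> e] by auto
    then show "\<omega> i = \<omega>' i" using eq by auto
  qed
  then have "nb_red G \<omega> \<tau> = nb_red G \<omega>' \<tau>" by (rule ext)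
  then show "P (nb_red G \<omega> \<tau>) = P (nb_red G \<omega>' \<tau>)" by simp
qed

lemma red_imp_nb_red:
  assumes "\<And>\<tau> v. \<omega> (Suc \<tau>, v) \<subseteq> edge_ends G v"
  shows "red G (\<lambda>v. \<omega> (0, v) \<noteq> {}) \<omega> \<tau> (opposite G e) \<Longrightarrow> nb_red G \<omega> \<tau> e"
proof (induction \<tau> arbitrary: e)
  case (Suc \<tau>)
  let ?S = "\<omega> (Suc \<tau>, opposite G e)"
  have "card {f \<in> ?S. red G (\<lambda>v. \<omega> (0, v) \<noteq> {}) \<omega> \<tau> (opposite G f)} \<le>
      card {f \<in> ?S. f = rev_end e \<or> f \<in> edge_ends G (opposite G e) \<and> nb_red G \<omega> \<tau> f}"
    using assms[of \<tau> "opposite G e"] Suc.IH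
    by (intro card_mono) (auto intro: finite_subset[OF _ finite_edge_ends])
  then show ?case using Suc.prems by simp
qed simp

section \<open>The joint law of colours and choices up to a finite time\<close>

definition colour_code :: "bool \<Rightarrow> edge_end set" where
  "colour_code b = (if b then {(0, True)} else {})"

text \<open>A history \<open>\<omega>\<close> stores the initial colour of \<open>v\<close> at \<open>(0, v)\<close>, as an empty (blue) or nonempty (red) set, and its
  choice at time \<open>\<tau> \<ge> 1\<close> at \<open>(\<tau>, v)\<close>, so that all randomness lives in one product of pmfs.\<close>

definition step_law :: "nat \<Rightarrow> multigraph \<Rightarrow> real \<Rightarrow> nat \<times> nat \<Rightarrow> edge_end set pmf" where
  "step_law k G \<alpha> j = (if fst j = 0 then map_pmf colour_code (bernoulli_pmf \<alpha>) else choice_pmf k G (snd j))"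

definition history_pmf :: "nat \<Rightarrow> multigraph \<Rightarrow> real \<Rightarrow> nat \<Rightarrow> nat set \<Rightarrow> (nat \<times> nat \<Rightarrow> edge_end set) pmf" where
  "history_pmf k G \<alpha> T V = Pi_pmf ({..T} \<times> V) {} (step_law k G \<alpha>)"

text \<open>All that the analysis of a fixed graph uses. The orbit is kept at most 1/2 because only
  there \<open>btail_majority_antimono\<close> compares sample sizes.\<close>

locale sampled_graph =
  fixes G :: multigraph and V :: "nat set" and k h :: nat and \<alpha> :: real
  assumes finite_V: "finite V"
    and endpoint_in_V: "\<And>e. fst e < length G \<Longrightarrow> endpoint G e \<in> V"
    and sample: "\<And>v S. v \<in> V \<Longrightarrow> S \<in> set_pmf (choice_pmf k G v) \<Longrightarrow>
      S \<subseteq> edge_ends G v \<and> odd (card S) \<and> 2 * h + 1 \<le> card S \<and> card S \<le> k"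
    and \<alpha>: "0 \<le> \<alpha>" "\<alpha> \<le> 1"
    and mean_field: "\<And>\<tau>. 0 \<le> mean_field h \<alpha> \<tau> \<and> mean_field h \<alpha> \<tau> \<le> 1 / 2"
begin

lemma opposite_in_V: "fst e < length G \<Longrightarrow> opposite G e \<in> V"
  unfolding opposite_conv_rev_end by (rule endpoint_in_V) simp

lemma history_sample:
  assumes "\<omega> \<in> set_pmf (history_pmf k G \<alpha> T V)"
  shows "\<omega> (Suc \<tau>, v) \<subseteq> edge_ends G v"
proof (cases "(Suc \<tau>, v) \<in> {..T} \<times> V")
  case True
  then have "\<omega> (Suc \<tau>, v) \<in> set_pmf (choice_pmf k G v)"
    using assms finite_V by (auto simp: history_pmf_def set_Pi_pmf PiE_dflt_def step_law_def split: if_splits)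
  then show ?thesis using sample[of v] True by blast
next
  case False
  then show ?thesis
    using Pi_pmf_outside[OF _ assms[unfolded history_pmf_def]] finite_V by force
qed

text \<open>Freeze the sample, of size \<open>2 l + 1\<close> with \<open>l \<ge> h\<close>. With
  the return edge in it, \<open>l\<close> of the other \<open>2 l\<close> votes give a majority;
  without it, \<open>l + 1\<close> of \<open>2 l + 1\<close> are needed, which is no likelier. The
  votes are independent with red probability at most the previous orbit value, and passing from
  \<open>l\<close> to \<open>h\<close> enlarges the tail.\<close>

lemma prob_nb_red_le:
  assumes "treelike G \<tau> e" "fst e < length G" "\<tau> \<le> T"
  shows "measure_pmf.prob (history_pmf k G \<alpha> T V) {\<omega>. nb_red G \<omega> \<tau> e} \<le> mean_field h \<alpha> \<tau>"
  using assms
proof (induction \<tau> arbitrary: e)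
  case 0
  have "map_pmf (\<lambda>\<omega>. \<omega> (0, opposite G e)) (history_pmf k G \<alpha> T V) = map_pmf colour_code (bernoulli_pmf \<alpha>)"
    unfolding history_pmf_def using finite_V opposite_in_V[OF 0(2)]
    by (subst Pi_pmf_component) (auto simp: step_law_def)
  then have "measure_pmf.prob (map_pmf (\<lambda>\<omega>. \<omega> (0, opposite G e)) (history_pmf k G \<alpha> T V)) (- {{}}) =
     measure_pmf.prob (map_pmf colour_code (bernoulli_pmf \<alpha>)) (- {{}})" by simp
  moreover have "colour_code -` (- {{}}) = {True}" by (auto simp: colour_code_def split: if_splits)
  ultimately show ?case using \<alpha> by (simp add: vimage_def measure_pmf_single)
next
  case (Suc \<tau>)
  define u r y where "u = opposite G e" and "r = rev_end e" and "y = mean_field h \<alpha> \<tau>"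
  define C where "C = edge_ends G u - {r}"
  let ?J = "{..T} \<times> V"
  let ?prob = "measure_pmf.prob (Pi_pmf ?J {} (step_law k G \<alpha>))" and ?j = "(Suc \<tau>, u)"
  let ?R = "\<lambda>S N. card S < 2 * card {f \<in> S. f = r \<or> f \<in> edge_ends G u \<and> N f}"
  let ?Q = "\<lambda>S \<omega>. ?R S (nb_red G \<omega> \<tau>)"
  have J: "finite ?J" using finite_V by simp
  have u: "u \<in> V" using opposite_in_V[OF Suc.prems(2)] by (simp add: u_def)
  have y: "0 \<le> y" "y \<le> 1 / 2" using mean_field[of \<tau>] by (simp_all add: y_def)
  have child: "treelike G \<tau> f" "fst f < length G" if "f \<in> C" for f
    using Suc.prems(1) that by (auto simp: C_def u_def r_def)
  have "?prob {\<omega>. ?Q (\<omega> ?j) \<omega>} \<le> mean_field h \<alpha> (Suc \<tau>)"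
  proof (rule prob_Pi_pmf_condition_le[where Q = ?Q and j = ?j, OF J])
    show "?j \<in> ?J" using u Suc.prems(3) by auto
    show "depends_on (?Q S) (- {?j})" for S
      by (rule depends_on_nb_red_before[where P = "?R S"])
    fix S assume "S \<in> set_pmf (step_law k G \<alpha> ?j)"
    then have S: "S \<subseteq> edge_ends G u" "odd (card S)" "2 * h + 1 \<le> card S"
      using sample[OF u, of S] by (auto simp: step_law_def)
    have "finite S" using S(1) finite_edge_ends finite_subset by blast
    define F l where "F = S - {r}" and "l = (card S - 1) div 2"
    have l: "card S = Suc (2 * l)" "h \<le> l" using S by (auto simp: l_def elim!: oddE)
    have F: "finite F" "F \<subseteq> C" using \<open>finite S\<close> S(1) by (auto simp: F_def C_def)
    have tail: "?prob {\<omega>. n \<le> card {f\<in>F. nb_red G \<omega> \<tau> f}} \<le> btail (card F) n y" for n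
    proof (rule prob_card_ge_le_btail[OF J F(1) y(1)])
      show "y \<le> 1" using y by simp
      show "depends_on (\<lambda>\<omega>. nb_red G \<omega> \<tau> f) (nb_support G \<tau> f)" for f by (rule depends_on_nb_red)
      show "disjoint_family_on (nb_support G \<tau>) F"
        using Suc.prems(1) F(2) by (auto simp: C_def u_def r_def intro: disjoint_family_on_mono)
      show "?prob {\<omega>. nb_red G \<omega> \<tau> f} \<le> y" if "f \<in> F" for f
        using Suc.IH[of f] child[of f] that F(2) Suc.prems(3) by (auto simp: y_def history_pmf_def)
    qed
    have bound: "?prob {\<omega>. ?Q S \<omega>} \<le> btail (2 * l) l y"
    proof (cases "r \<in> S")
      case True
      then have cF: "card F = 2 * l" using \<open>finite S\<close> l by (simp add: F_def)
      have "{f \<in> S. f = r \<or> f \<in> edge_ends G u \<and> nb_red G \<omega> \<tau> f} = insert r {f\<in>F. nb_red G \<omega> \<tau> f}" for \<omega>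
        using True S(1) by (auto simp: F_def)
      moreover have "r \<notin> F" by (simp add: F_def)
      ultimately have "?Q S \<omega> \<longleftrightarrow> l \<le> card {f\<in>F. nb_red G \<omega> \<tau> f}" for \<omega>
        using F(1) l by auto
      then show ?thesis using tail[of l] cF by simp
    next
      case False
      then have cF: "card F = Suc (2 * l)" using l by (simp add: F_def)
      have "{f \<in> S. f = r \<or> f \<in> edge_ends G u \<and> nb_red G \<omega> \<tau> f} = {f\<in>F. nb_red G \<omega> \<tau> f}" for \<omega>
        using False S(1) by (auto simp: F_def)
      then have "?Q S \<omega> \<longleftrightarrow> Suc l \<le> card {f\<in>F. nb_red G \<omega> \<tau> f}" for \<omega>
        using l by auto
      then show ?thesis using tail[of "Suc l"] cF btail_Suc_Suc_le[of y "2 * l" l] y by simp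
    qed
    also have "\<dots> \<le> btail (2 * h) h y" by (rule btail_majority_antimono) (use y l in auto)
    finally show "?prob {\<omega>. ?Q S \<omega>} \<le> mean_field h \<alpha> (Suc \<tau>)"
      by (simp add: mean_field_Suc y_def)
  qed
  then show ?case by (simp add: history_pmf_def u_def r_def)
qed

text \<open>A red vertex needs at least \<open>h + 1 \<ge> 3\<close> red votes, so two uncontrolled neighbours
  cannot make it red by themselves.\<close>

lemma prob_red_le:
  assumes "v \<in> V" "card {e \<in> edge_ends G v. \<not> treelike G \<tau> e} \<le> 2" "Suc \<tau> \<le> T" "2 \<le> h"
  shows "measure_pmf.prob (history_pmf k G \<alpha> T V) {\<omega>. red G (\<lambda>v. \<omega> (0, v) \<noteq> {}) \<omega> (Suc \<tau>) v}
    \<le> real k * mean_field h \<alpha> \<tau>"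
proof -
  define B where "B = {e \<in> edge_ends G v. \<not> treelike G \<tau> e}"
  let ?M = "history_pmf k G \<alpha> T V"
  let ?J = "{..T} \<times> V"
  let ?prob = "measure_pmf.prob (Pi_pmf ?J {} (step_law k G \<alpha>))" and ?j = "(Suc \<tau>, v)"
  let ?R = "\<lambda>S N. \<exists>f\<in>S - B. N f"
  let ?Q = "\<lambda>S \<omega>. ?R S (nb_red G \<omega> \<tau>)"
  have y: "0 \<le> mean_field h \<alpha> \<tau>" using mean_field[of \<tau>] by simp
  have J: "finite ?J" using finite_V by simp
  have "measure_pmf.prob ?M {\<omega>. red G (\<lambda>v. \<omega> (0, v) \<noteq> {}) \<omega> (Suc \<tau>) v} \<le> measure_pmf.prob ?M {\<omega>. ?Q (\<omega> ?j) \<omega>}"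
  proof (rule measure_pmf.finite_measure_mono_AE)
    have "?Q (\<omega> ?j) \<omega>" if w: "\<omega> \<in> set_pmf ?M" and red: "red G (\<lambda>v. \<omega> (0, v) \<noteq> {}) \<omega> (Suc \<tau>) v" for \<omega>
    proof (rule ccontr)
      assume none: "\<not> ?Q (\<omega> ?j) \<omega>"
      have "\<omega> ?j \<in> set_pmf (choice_pmf k G v)"
        using w J assms(1,3) by (auto simp: history_pmf_def set_Pi_pmf PiE_dflt_def step_law_def split: if_splits)
      then have "2 * h + 1 \<le> card (\<omega> ?j)" using sample[OF assms(1)] by blast
      have nb: "red G (\<lambda>v. \<omega> (0, v) \<noteq> {}) \<omega> \<tau> (opposite G f) \<Longrightarrow> nb_red G \<omega> \<tau> f" for f
        by (rule red_imp_nb_red) (use history_sample[OF w] in auto)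
      \<comment> \<open>If no controlled end in the sample is red, all red votes lie in
        \<open>B\<close>. There are at most 2 of them, too few for a majority of at least 5.\<close>
      have "{f \<in> \<omega> ?j. red G (\<lambda>v. \<omega> (0, v) \<noteq> {}) \<omega> \<tau> (opposite G f)} \<subseteq> B"
        using none nb by blast
      then have "card {f \<in> \<omega> ?j. red G (\<lambda>v. \<omega> (0, v) \<noteq> {}) \<omega> \<tau> (opposite G f)} \<le> card B"
        by (intro card_mono) (auto simp: B_def finite_edge_ends simp del: mem_edge_ends)
      then show False using red \<open>2 * h + 1 \<le> card (\<omega> ?j)\<close> assms(2,4) by (simp add: B_def)
    qed
    then show "AE \<omega> in ?M. \<omega> \<in> {\<omega>. red G (\<lambda>v. \<omega> (0, v) \<noteq> {}) \<omega> (Suc \<tau>) v} \<longrightarrow> \<omega> \<in> {\<omega>. ?Q (\<omega> ?j) \<omega>}"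
      by (simp add: AE_measure_pmf_iff)
  qed auto
  also have "\<dots> \<le> real k * mean_field h \<alpha> \<tau>"
    unfolding history_pmf_def
  proof (rule prob_Pi_pmf_condition_le[where Q = ?Q and j = ?j, OF J])
    show "?j \<in> ?J" using assms by auto
    show "depends_on (?Q S) (- {?j})" for S
      by (rule depends_on_nb_red_before[where P = "?R S"])
    fix S assume "S \<in> set_pmf (step_law k G \<alpha> ?j)"
    then have S: "S \<subseteq> edge_ends G v" "card S \<le> k"
      using sample[OF assms(1), of S] by (auto simp: step_law_def)
    have "finite S" using S(1) finite_edge_ends finite_subset by blast
    have "{\<omega>. ?Q S \<omega>} = (\<Union>f\<in>S - B. {\<omega>. nb_red G \<omega> \<tau> f})" by auto
    then have "?prob {\<omega>. ?Q S \<omega>} \<le>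
      (\<Sum>f\<in>S - B. ?prob {\<omega>. nb_red G \<omega> \<tau> f})"
      using \<open>finite S\<close> by (auto intro!: measure_pmf.finite_measure_subadditive_finite)
    also have "\<dots> \<le> (\<Sum>f\<in>S - B. mean_field h \<alpha> \<tau>)"
      using S(1) prob_nb_red_le[of \<tau> _ T] assms(3)
      by (intro sum_mono) (auto simp: B_def history_pmf_def)
    also have "\<dots> \<le> real k * mean_field h \<alpha> \<tau>"
      using S(2) card_mono[of S "S - B"] \<open>finite S\<close> y by (auto intro!: mult_right_mono)
    finally show "?prob {\<omega>. ?Q S \<omega>} \<le> real k * mean_field h \<alpha> \<tau>" .
  qed
  finally show ?thesis .
qed

end

section \<open>Cycles in the explored neighbourhood\<close>

text \<open>For \<open>g\<close> lying on \<open>H\<close>: its vertex has degree at least 2 in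
  \<open>H\<close>. Positions in the edge list, not pairs of vertices, make multiple edges and loops
  count correctly; the two ends of a loop are partners.\<close>

definition partnered :: "multigraph \<Rightarrow> nat set \<Rightarrow> edge_end \<Rightarrow> bool" where
  "partnered G H g \<longleftrightarrow> (\<exists>g'. g' \<noteq> g \<and> fst g' \<in> H \<and> endpoint G g' = endpoint G g)"

lemma partneredI: "g' \<noteq> g \<Longrightarrow> fst g' \<in> H \<Longrightarrow> endpoint G g' = endpoint G g \<Longrightarrow> partnered G H g"
  unfolding partnered_def by blast

lemma partnered_mono: "partnered G H g \<Longrightarrow> H \<subseteq> H' \<Longrightarrow> partnered G H' g"
  unfolding partnered_def by blast

definition nb_walk :: "multigraph \<Rightarrow> nat \<Rightarrow> (nat \<Rightarrow> edge_end) \<Rightarrow> bool" where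
  "nb_walk G n w \<longleftrightarrow> (\<forall>i\<le>n. fst (w i) < length G) \<and>
     (\<forall>i<n. endpoint G (w (Suc i)) = opposite G (w i) \<and> w (Suc i) \<noteq> rev_end (w i))"

text \<open>A pair at time \<open>s\<close> is reached after exactly \<open>\<tau> - s\<close>
  steps. Two branches sharing a pair therefore reach its vertex by walks of the same length.\<close>

lemma nb_support_walk:
  "i \<in> nb_support G \<tau> e \<Longrightarrow> fst e < length G \<Longrightarrow>
     \<exists>w. nb_walk G (\<tau> - fst i) w \<and> w 0 = e \<and> opposite G (w (\<tau> - fst i)) = snd i"
proof (induction \<tau> arbitrary: e)
  case 0
  then show ?case by (intro exI[of _ "\<lambda>_. e"]) (auto simp: nb_walk_def)
next
  case (Suc \<tau>)
  show ?case
  proof (cases "i = (Suc \<tau>, opposite G e)")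
    case True
    then show ?thesis using Suc.prems by (intro exI[of _ "\<lambda>_. e"]) (auto simp: nb_walk_def)
  next
    case False
    then obtain f where f: "fst f < length G" "endpoint G f = opposite G e" "f \<noteq> rev_end e"
        "i \<in> nb_support G \<tau> f"
      using Suc.prems(1)
      unfolding nb_support.simps insert_iff UN_iff Bex_def Diff_iff mem_edge_ends singleton_iff by blast
    then obtain w where w: "nb_walk G (\<tau> - fst i) w" "w 0 = f" "opposite G (w (\<tau> - fst i)) = snd i"
      using Suc.IH[of f] by blast
    have "Suc \<tau> - fst i = Suc (\<tau> - fst i)" using nb_support_time[OF f(4)] by simp
    then show ?thesis using w f(1-3) Suc.prems(2)
      by (intro exI[of _ "case_nat e w"]) (auto simp: nb_walk_def split: nat.split)
  qed
qed

lemma edge_end_cases: "fst g = fst e \<Longrightarrow> g = e \<or> g = rev_end e"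
  by (auto simp: rev_end_def prod_eq_iff)

text \<open>Common final ends are cut off until the last ends differ. Then \<open>H\<close> consists
  of all edges of both walks: an inner end is partnered with the adjacent end on its walk, distinct
  from it by the absence of backtracking, and the two arrival ends partner each other. Each walk has
  at most \<open>n + 1\<close> edges.\<close>

lemma nb_walks_meet:
  assumes "nb_walk G n w" "nb_walk G n w'" "w 0 \<noteq> w' 0" "opposite G (w n) = opposite G (w' n)"
  shows "\<exists>H\<subseteq>{..<length G}. card H \<le> 2 * Suc n \<and> fst (w 0) \<in> H \<and> fst (w' 0) \<in> H \<and>
     (\<forall>g. fst g \<in> H \<longrightarrow> g \<noteq> w 0 \<longrightarrow> g \<noteq> w' 0 \<longrightarrow> partnered G H g)"
  using assms
proof (induction n)
  case 0
  let ?H = "{fst (w 0), fst (w' 0)}"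
  have "rev_end (w 0) \<noteq> rev_end (w' 0)" using 0(3) by (metis rev_end_simps(2))
  then have "partnered G ?H (rev_end (w 0))" "partnered G ?H (rev_end (w' 0))"
    using 0(4) partneredI[of "rev_end (w' 0)" "rev_end (w 0)" ?H G]
      partneredI[of "rev_end (w 0)" "rev_end (w' 0)" ?H G]
    by (simp_all flip: opposite_conv_rev_end)
  then have "\<forall>g. fst g \<in> ?H \<longrightarrow> g \<noteq> w 0 \<longrightarrow> g \<noteq> w' 0 \<longrightarrow> partnered G ?H g"
    using edge_end_cases by (metis insertE singletonD)
  moreover have "card ?H \<le> 2" by (simp add: card_insert_if)
  ultimately show ?case using 0(1,2) by (intro exI[of _ ?H]) (auto simp: nb_walk_def)
next
  case (Suc n)
  show ?case
  proof (cases "w (Suc n) = w' (Suc n)")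
    case True
    have "nb_walk G n w" "nb_walk G n w'" using Suc.prems(1,2) by (auto simp: nb_walk_def)
    moreover have "opposite G (w n) = opposite G (w' n)"
      using Suc.prems(1,2) True by (metis lessI nb_walk_def)
    ultimately obtain H where "H \<subseteq> {..<length G}" "card H \<le> 2 * Suc n" "fst (w 0) \<in> H" "fst (w' 0) \<in> H"
     "\<forall>g. fst g \<in> H \<longrightarrow> g \<noteq> w 0 \<longrightarrow> g \<noteq> w' 0 \<longrightarrow> partnered G H g" using Suc.IH Suc.prems(3) by blast
    then show ?thesis by (intro exI[of _ H]) auto
  next
    case False
    let ?n = "Suc n"
    define H where "H = (fst \<circ> w) ` {..?n} \<union> (fst \<circ> w') ` {..?n}"
    have inner: "partnered G H g"
      if "nb_walk G ?n u" "(fst \<circ> u) ` {..?n} \<subseteq> H" "i \<le> ?n" "g = u i \<and> i \<noteq> 0 \<or> g = rev_end (u i) \<and> i \<noteq> ?n"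
      for u g i
      using that(4)
    proof (elim disjE conjE)
      assume g: "g = u i" "i \<noteq> 0"
      then obtain j where j: "i = Suc j" by (cases i) auto
      have "fst (u j) \<in> H" using that(2,3) j by force
      moreover have "u (Suc j) \<noteq> rev_end (u j)" "endpoint G (u (Suc j)) = opposite G (u j)"
        using that(1,3) j by (auto simp: nb_walk_def)
      ultimately show ?thesis unfolding g(1) j
        by (intro partneredI[of "rev_end (u j)"]) (simp_all flip: opposite_conv_rev_end)
    next
      assume g: "g = rev_end (u i)" "i \<noteq> ?n"
      then have "fst (u (Suc i)) \<in> H" using that(2,3) by force
      then show ?thesis using that(1,3) g
        by (intro partneredI[of "u (Suc i)"]) (auto simp: nb_walk_def simp flip: opposite_conv_rev_end)
    qed
    have last: "partnered G H (rev_end (w ?n))" "partnered G H (rev_end (w' ?n))"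
    proof -
      have "rev_end (w ?n) \<noteq> rev_end (w' ?n)" using False by (metis rev_end_simps(2))
      moreover have "fst (w ?n) \<in> H" "fst (w' ?n) \<in> H" by (auto simp: H_def)
      ultimately show "partnered G H (rev_end (w ?n))" "partnered G H (rev_end (w' ?n))"
        using Suc.prems(4)
        by (auto intro!: partneredI[of "rev_end (w' ?n)" "rev_end (w ?n)"]
          partneredI[of "rev_end (w ?n)" "rev_end (w' ?n)"] simp flip: opposite_conv_rev_end)
    qed
    have "partnered G H g" if g: "fst g \<in> H" "g \<noteq> w 0" "g \<noteq> w' 0" for g
    proof -
      from g(1) obtain i u where i: "i \<le> ?n" "fst g = fst (u i)" and u: "u = w \<or> u = w'" by (auto simp: H_def)
      have u': "nb_walk G ?n u" "(fst \<circ> u) ` {..?n} \<subseteq> H" using u Suc.prems(1,2) by (auto simp: H_def)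
      have "g = u i \<or> g = rev_end (u i)" using i(2) by (rule edge_end_cases)
      moreover have "i \<noteq> 0" if "g = u i" using that g(2,3) u by (metis (full_types))
      ultimately show ?thesis using inner[OF u' i(1), of g] last u by blast
    qed
    moreover have "card H \<le> 2 * Suc ?n"
    proof -
      have "card H \<le> card ((fst \<circ> w) ` {..?n}) + card ((fst \<circ> w') ` {..?n})" unfolding H_def by (rule card_Un_le)
      also have "\<dots> \<le> Suc ?n + Suc ?n" by (intro add_mono order_trans[OF card_image_le]) auto
      finally show ?thesis by simp
    qed
    moreover have "H \<subseteq> {..<length G}" using Suc.prems(1,2) by (auto simp: H_def nb_walk_def)
    moreover have "fst (w 0) \<in> H" "fst (w' 0) \<in> H" by (auto simp: H_def)
    ultimately show ?thesis by (intro exI[of _ H]) auto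
  qed
qed

text \<open>Either a child fails, and its witness is extended by the edge of \<open>e\<close>, or
  two children collide, and the edges of two meeting walks are added to that of \<open>e\<close>.
  Only \<open>e\<close> itself may stay without partner. The second case has at most
  \<open>2 * Suc \<tau> + 1\<close> edges, which \<open>3 * Suc \<tau>\<close> covers.\<close>

lemma not_treelike_witness:
  "\<not> treelike G \<tau> e \<Longrightarrow> fst e < length G \<Longrightarrow>
     \<exists>H\<subseteq>{..<length G}. card H \<le> 3 * \<tau> \<and> fst e \<in> H \<and> (\<forall>g. fst g \<in> H \<longrightarrow> g \<noteq> e \<longrightarrow> partnered G H g)"
proof (induction \<tau> arbitrary: e)
  case (Suc \<tau>)
  have rev: "partnered G (insert (fst e) H) (rev_end e)"
    if "fst f \<in> H" "endpoint G f = opposite G e" "f \<noteq> rev_end e" for H f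
    using that by (intro partneredI[of f]) (auto simp flip: opposite_conv_rev_end)
  have fwd: "partnered G (insert (fst e) H) f"
    if "endpoint G f = opposite G e" "f \<noteq> rev_end e" for H f
    using that by (intro partneredI[of "rev_end e"]) (auto simp flip: opposite_conv_rev_end)
  consider (child) f where "fst f < length G" "endpoint G f = opposite G e" "f \<noteq> rev_end e" "\<not> treelike G \<tau> f"
    | (meet) f f' i where "fst f < length G" "endpoint G f = opposite G e" "f \<noteq> rev_end e"
       "fst f' < length G" "endpoint G f' = opposite G e" "f' \<noteq> rev_end e" "f \<noteq> f'"
       "i \<in> nb_support G \<tau> f" "i \<in> nb_support G \<tau> f'"
    using Suc.prems(1)
    unfolding treelike.simps de_Morgan_conj disjoint_family_on_def Ball_def Diff_iff mem_edge_ends singleton_iff disjoint_iff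
    by blast
  then show ?case
  proof cases
    case child
    then obtain H where H: "H \<subseteq> {..<length G}" "card H \<le> 3 * \<tau>" "fst f \<in> H"
        "\<forall>g. fst g \<in> H \<longrightarrow> g \<noteq> f \<longrightarrow> partnered G H g" using Suc.IH[of f] by blast
    have "partnered G (insert (fst e) H) g" if g: "fst g \<in> insert (fst e) H" "g \<noteq> e" for g
    proof (cases "g = f \<or> g = rev_end e")
      case True
      then show ?thesis using rev[of f H] fwd[of f H] child H(3) by blast
    next
      case False
      then have "fst g \<in> H" using g edge_end_cases[of g e] by auto
      then show ?thesis using H(4) False by (blast intro: partnered_mono)
    qed
    moreover have "card (insert (fst e) H) \<le> 3 * Suc \<tau>" using card_insert_le_m1 H(2) by (simp add: card_insert_if finite_subset[OF H(1)])
    ultimately show ?thesis using H(1) Suc.prems(2) by (intro exI[of _ "insert (fst e) H"]) auto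
  next
    case meet
    let ?n = "\<tau> - fst i"
    obtain w w' where w: "nb_walk G ?n w" "w 0 = f" "nb_walk G ?n w'" "w' 0 = f'" "opposite G (w ?n) = opposite G (w' ?n)"
      using nb_support_walk[OF meet(8,1)] nb_support_walk[OF meet(9,4)] by metis
    then obtain H where H: "H \<subseteq> {..<length G}" "card H \<le> 2 * Suc ?n" "fst f \<in> H" "fst f' \<in> H"
     "\<forall>g. fst g \<in> H \<longrightarrow> g \<noteq> f \<longrightarrow> g \<noteq> f' \<longrightarrow> partnered G H g"
      using nb_walks_meet[OF w(1,3) _ w(5)] meet(7) by blast
    have "partnered G (insert (fst e) H) g" if g: "fst g \<in> insert (fst e) H" "g \<noteq> e" for g
    proof (cases "g = f \<or> g = f' \<or> g = rev_end e")
      case True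
      then show ?thesis using rev[of f H] fwd[of f H] fwd[of f' H] meet H(3) by blast
    next
      case False
      then have "fst g \<in> H" using g edge_end_cases[of g e] by auto
      then show ?thesis using H(5) False by (blast intro: partnered_mono)
    qed
    moreover have "card (insert (fst e) H) \<le> 3 * Suc \<tau>"
    proof -
      have "card H \<le> 2 * Suc \<tau>" using H(2) by (rule order_trans) simp
      then show ?thesis by (simp add: card_insert_if finite_subset[OF H(1)])
    qed
    ultimately show ?thesis using H(1) Suc.prems(2) by (intro exI[of _ "insert (fst e) H"]) auto
  qed
qed simp

text \<open>Cycles remain permitted, since the first moment bound has no gain for them; it has one
  for a third edge-end at a vertex beyond \<open>K\<close>.\<close>

definition sparse_beyond :: "nat \<Rightarrow> nat \<Rightarrow> multigraph \<Rightarrow> bool" where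
  "sparse_beyond K L G \<longleftrightarrow> (\<forall>H\<subseteq>{..<length G}. card H \<le> L \<longrightarrow> (\<forall>g. fst g \<in> H \<longrightarrow> partnered G H g) \<longrightarrow>
     (\<forall>v>K. card {g \<in> edge_ends G v. fst g \<in> H} \<le> 2))"

text \<open>Three bad ends at \<open>v\<close> have witnesses of at most \<open>3 * \<tau>\<close>
  edges each. In their union the ends at \<open>v\<close> partner one another, so nothing is
  unpartnered and \<open>v\<close> has degree at least 3.\<close>

lemma card_not_treelike_le:
  assumes "sparse_beyond K L G" "9 * \<tau> \<le> L" "K < v"
  shows "card {e \<in> edge_ends G v. \<not> treelike G \<tau> e} \<le> 2"
proof (rule ccontr)
  let ?B = "{e \<in> edge_ends G v. \<not> treelike G \<tau> e}"
  assume "\<not> card ?B \<le> 2"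
  then have "3 \<le> card ?B" by simp
  then obtain E where E: "E \<subseteq> ?B" "card E = 3" by (meson obtain_subset_with_card_n)
  have fin: "finite E" using E(2) by (intro card_ge_0_finite) simp
  have "\<forall>e\<in>E. \<exists>H\<subseteq>{..<length G}. card H \<le> 3 * \<tau> \<and> fst e \<in> H \<and> (\<forall>g. fst g \<in> H \<longrightarrow> g \<noteq> e \<longrightarrow> partnered G H g)"
    using E(1) by (intro ballI not_treelike_witness) auto
  then obtain Hf where Hf: "\<And>e. e \<in> E \<Longrightarrow> Hf e \<subseteq> {..<length G}" "\<And>e. e \<in> E \<Longrightarrow> card (Hf e) \<le> 3 * \<tau>"
     "\<And>e. e \<in> E \<Longrightarrow> fst e \<in> Hf e" "\<And>e g. e \<in> E \<Longrightarrow> fst g \<in> Hf e \<Longrightarrow> g \<noteq> e \<Longrightarrow> partnered G (Hf e) g"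
    by metis
  define H where "H = (\<Union>e\<in>E. Hf e)"
  have "card H \<le> (\<Sum>e\<in>E. card (Hf e))" unfolding H_def by (rule card_UN_le[OF fin])
  also have "\<dots> \<le> (\<Sum>e\<in>E. 3 * \<tau>)" by (intro sum_mono Hf(2))
  also have "\<dots> \<le> L" using assms(2) E(2) by simp
  finally have "card H \<le> L" .
  moreover have "H \<subseteq> {..<length G}" using Hf(1) by (auto simp: H_def)
  moreover have "partnered G H g" if "fst g \<in> H" for g
  proof (cases "g \<in> E")
    case True
    have "card (E - {g}) = 2" using True E(2) by simp
    then obtain e where e: "e \<in> E" "e \<noteq> g"
      by (metis Diff_iff all_not_in_conv card.empty singletonI zero_neq_numeral)
    then show ?thesis using True E(1) Hf(3)[of e] by (intro partneredI[of e]) (auto simp: H_def)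
  next
    case False
    from that obtain e where e: "e \<in> E" "fst g \<in> Hf e" unfolding H_def UN_iff by blast
    then have "partnered G (Hf e) g" using Hf(4) False by blast
    then show ?thesis using e(1) by (auto simp: H_def elim!: partnered_mono)
  qed
  ultimately have "card {g \<in> edge_ends G v. fst g \<in> H} \<le> 2"
    using assms(1,3) unfolding sparse_beyond_def by blast
  moreover have "card E \<le> card {g \<in> edge_ends G v. fst g \<in> H}"
    using E(1) Hf(3) by (intro card_mono) (auto simp: H_def intro: finite_subset[OF _ finite_edge_ends[of G v]])
  ultimately show False using E(2) by simp
qed

section \<open>One step of the vertices of large degree\<close>

lemma card_subsets_containing:
  assumes "finite A" "a \<in> A"
  shows "card {S. S \<subseteq> A \<and> card S = Suc s \<and> a \<in> S} = (card A - 1) choose s"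
proof -
  have "{S. S \<subseteq> A \<and> card S = Suc s \<and> a \<in> S} = insert a ` {S. S \<subseteq> A - {a} \<and> card S = s}"
  proof (intro equalityI subsetI)
    fix S assume S: "S \<in> {S. S \<subseteq> A \<and> card S = Suc s \<and> a \<in> S}"
    then have "S = insert a (S - {a})" by auto
    moreover have "S - {a} \<in> {S. S \<subseteq> A - {a} \<and> card S = s}" using S by auto
    ultimately show "S \<in> insert a ` {S. S \<subseteq> A - {a} \<and> card S = s}" by blast
  next
    fix S assume "S \<in> insert a ` {S. S \<subseteq> A - {a} \<and> card S = s}"
    then obtain S' where S': "S = insert a S'" "S' \<subseteq> A - {a}" "card S' = s" by auto
    then have "finite S'" "a \<notin> S'" using assms(1) finite_subset by auto
    then show "S \<in> {S. S \<subseteq> A \<and> card S = Suc s \<and> a \<in> S}" using S' assms(2) by auto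
  qed
  moreover have "inj_on (insert a) {S. S \<subseteq> A - {a} \<and> card S = s}"
    by (intro inj_onI) (metis Diff_insert_absorb insert_absorb mem_Collect_eq subset_Diff_insert)
  ultimately show ?thesis using assms by (simp add: card_image n_subsets)
qed

lemma prob_uniform_subset_hits_le:
  assumes "finite A" "0 < s" "s \<le> card A"
  shows "measure_pmf.prob (pmf_of_set {S. S \<subseteq> A \<and> card S = s}) {S. S \<inter> C \<noteq> {}} \<le> real (card (A \<inter> C)) * real s / real (card A)"
proof -
  let ?X = "{S. S \<subseteq> A \<and> card S = s}"
  have fin: "finite ?X" by (rule finite_subset[of _ "Pow A"]) (use assms in auto)
  obtain S where "S \<subseteq> A" "card S = s" using assms by (meson obtain_subset_with_card_n)
  then have ne: "?X \<noteq> {}" by auto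
  obtain r where r: "s = Suc r" using assms by (cases s) auto
  have one: "measure_pmf.prob (pmf_of_set ?X) {S. a \<in> S} = real s / real (card A)" if "a \<in> A" for a
  proof -
    have "?X \<inter> {S. a \<in> S} = {S. S \<subseteq> A \<and> card S = Suc r \<and> a \<in> S}" using r by auto
    then have "measure_pmf.prob (pmf_of_set ?X) {S. a \<in> S} = real ((card A - 1) choose r) / real (card A choose s)"
      using fin ne card_subsets_containing[OF assms(1) that, of r] n_subsets[OF assms(1), of s]
      by (simp add: measure_pmf_of_set)
    moreover have "s * (card A choose s) = card A * ((card A - 1) choose r)"
      using binomial_absorption[of r "card A"] r by simp
    then have "real s * real (card A choose s) = real (card A) * real ((card A - 1) choose r)"
      by (metis of_nat_mult)
    moreover have pos: "card A choose s > 0" "card A > 0" using assms by auto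
    ultimately have "real ((card A - 1) choose r) = real s * real (card A choose s) / real (card A)"
      by (simp add: eq_divide_eq mult.commute)
    with \<open>measure_pmf.prob _ _ = _\<close> pos show ?thesis by simp
  qed
  have "measure_pmf.prob (pmf_of_set ?X) {S. S \<inter> C \<noteq> {}} \<le> measure_pmf.prob (pmf_of_set ?X) (\<Union>a\<in>A \<inter> C. {S. a \<in> S})"
    by (rule measure_pmf.finite_measure_mono_AE) (use fin ne in \<open>auto simp: AE_measure_pmf_iff\<close>)
  also have "\<dots> \<le> (\<Sum>a\<in>A \<inter> C. measure_pmf.prob (pmf_of_set ?X) {S. a \<in> S})"
    using assms by (intro measure_pmf.finite_measure_subadditive_finite) auto
  also have "\<dots> = real (card (A \<inter> C)) * (real s / real (card A))"
    using one by simp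
  finally show ?thesis by simp
qed

context sampled_graph
begin

lemma prob_core_sample_le:
  assumes "v \<in> V" "0 < D" "D \<le> vertex_degree G v" "card {e \<in> edge_ends G v. opposite G e \<le> K} \<le> c"
  shows "measure_pmf.prob (choice_pmf k G v) {S. S \<inter> {e. opposite G e \<le> K} \<noteq> {}} \<le> real c * real k / real D"
proof -
  let ?C = "{e. opposite G e \<le> K}"
  let ?X = "{S. S \<subseteq> edge_ends G v \<and> card S = sample_size k G v}"
  let ?J = "{j. odd j \<and> j \<le> vertex_degree G v}"
  have "finite ?J" by (rule finite_subset[of _ "{..vertex_degree G v}"]) auto
  moreover have "1 \<in> ?J" using assms by simp
  ultimately have J: "Max ?J \<in> ?J" by (intro Max_in) blast+
  then have s: "sample_size k G v \<le> k" "sample_size k G v \<le> card (edge_ends G v)"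
    by (auto simp: sample_size_def vertex_degree_def)
  obtain S where S: "S \<in> set_pmf (choice_pmf k G v)" using set_pmf_not_empty[of "choice_pmf k G v"] by blast
  obtain S' where "S' \<subseteq> edge_ends G v" "card S' = sample_size k G v"
    using s(2) by (meson obtain_subset_with_card_n)
  then have "?X \<noteq> {}" by auto
  moreover have "finite ?X" by (rule finite_subset[of _ "Pow (edge_ends G v)"]) (auto simp: finite_edge_ends simp del: mem_edge_ends)
  ultimately have "card S = sample_size k G v" using S by (simp add: choice_pmf_def)
  then have s0: "0 < sample_size k G v" using sample[OF assms(1) S] by simp
  have "edge_ends G v \<inter> ?C = {e \<in> edge_ends G v. opposite G e \<le> K}" by auto
  then have "measure_pmf.prob (choice_pmf k G v) {S. S \<inter> ?C \<noteq> {}}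
     \<le> real (card {e \<in> edge_ends G v. opposite G e \<le> K}) * real (sample_size k G v) / real (vertex_degree G v)"
    unfolding choice_pmf_def
    using prob_uniform_subset_hits_le[OF finite_edge_ends s0 s(2), where C = "?C"]
    by (simp add: vertex_degree_def)
  also have "\<dots> \<le> real c * real k / real D"
    using assms s by (intro frac_le mult_mono) auto
  finally show ?thesis .
qed

text \<open>A red vertex at time \<open>\<tau> + 2\<close> either lies beyond \<open>K\<close>
  (\<open>?E2\<close>) or has sampled an end whose other vertex was red at
  \<open>\<tau> + 1\<close>; that vertex is beyond \<open>K\<close> (\<open>?E1\<close>) or not
  (\<open>?E3\<close>). The exploration for \<open>?E2\<close> has depth \<open>\<tau> + 1\<close>,
  which accounts for \<open>9 * Suc \<tau>\<close>.\<close>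

lemma prob_some_red_le:
  assumes "sparse_beyond K L G" "9 * Suc \<tau> \<le> L" "2 \<le> h"
    and core: "\<And>v. v \<in> V \<Longrightarrow> v \<le> K \<Longrightarrow> D \<le> vertex_degree G v \<and> card {e \<in> edge_ends G v. opposite G e \<le> K} \<le> c"
    and "0 < D" "0 \<notin> V"
  shows "measure_pmf.prob (history_pmf k G \<alpha> (Suc (Suc \<tau>)) V)
      {\<omega>. \<exists>v\<in>V. red G (\<lambda>v. \<omega> (0, v) \<noteq> {}) \<omega> (Suc (Suc \<tau>)) v}
    \<le> real (card V) * (real k * mean_field h \<alpha> \<tau> + real k * mean_field h \<alpha> (Suc \<tau>)) + real K * (real c * real k / real D)"
proof -
  let ?T = "Suc (Suc \<tau>)"
  let ?M = "history_pmf k G \<alpha> ?T V"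
  let ?red = "\<lambda>\<omega> \<tau> v. red G (\<lambda>v. \<omega> (0, v) \<noteq> {}) \<omega> \<tau> v"
  let ?C = "{e. opposite G e \<le> K}"
  let ?E1 = "\<Union>v\<in>{v\<in>V. K < v}. {\<omega>. ?red \<omega> (Suc \<tau>) v}"
  let ?E2 = "\<Union>v\<in>{v\<in>V. K < v}. {\<omega>. ?red \<omega> ?T v}"
  let ?E3 = "\<Union>v\<in>{v\<in>V. v \<le> K}. {\<omega>. \<omega> (?T, v) \<inter> ?C \<noteq> {}}"
  have y: "0 \<le> mean_field h \<alpha> \<tau>" for \<tau> using mean_field[of \<tau>] by simp
  have red: "measure_pmf.prob ?M {\<omega>. ?red \<omega> (Suc \<sigma>) v} \<le> real k * mean_field h \<alpha> \<sigma>"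
    if "v \<in> V" "K < v" "\<sigma> \<le> Suc \<tau>" for v \<sigma>
    using that assms card_not_treelike_le[OF assms(1) _ that(2), of \<sigma>] by (intro prob_red_le) auto
  have sum_red: "measure_pmf.prob ?M (\<Union>v\<in>{v\<in>V. K < v}. {\<omega>. ?red \<omega> (Suc \<sigma>) v}) \<le> real (card V) * (real k * mean_field h \<alpha> \<sigma>)"
    if "\<sigma> \<le> Suc \<tau>" for \<sigma>
  proof -
    have "measure_pmf.prob ?M (\<Union>v\<in>{v\<in>V. K < v}. {\<omega>. ?red \<omega> (Suc \<sigma>) v}) \<le>
        (\<Sum>v\<in>{v\<in>V. K < v}. measure_pmf.prob ?M {\<omega>. ?red \<omega> (Suc \<sigma>) v})"
      using finite_V by (intro measure_pmf.finite_measure_subadditive_finite) auto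
    also have "\<dots> \<le> (\<Sum>v\<in>{v\<in>V. K < v}. real k * mean_field h \<alpha> \<sigma>)"
      using red that by (intro sum_mono) auto
    also have "\<dots> \<le> real (card V) * (real k * mean_field h \<alpha> \<sigma>)"
      using finite_V y[of \<sigma>] by (auto intro!: mult_right_mono card_mono)
    finally show ?thesis .
  qed
  have E3: "measure_pmf.prob ?M ?E3 \<le> real K * (real c * real k / real D)"
  proof -
    have "measure_pmf.prob ?M {\<omega>. \<omega> (?T, v) \<inter> ?C \<noteq> {}} \<le> real c * real k / real D" if "v \<in> V" "v \<le> K" for v
    proof -
      have eq: "map_pmf (\<lambda>\<omega>. \<omega> (?T, v)) ?M = choice_pmf k G v"
        unfolding history_pmf_def using finite_V that by (subst Pi_pmf_component) (auto simp: step_law_def)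
      have "measure_pmf.prob ?M {\<omega>. \<omega> (?T, v) \<inter> ?C \<noteq> {}} = measure_pmf.prob (choice_pmf k G v) {S. S \<inter> ?C \<noteq> {}}"
        unfolding eq[symmetric] measure_map_pmf by (simp add: vimage_def)
      then show ?thesis using prob_core_sample_le[OF that(1) assms(5)] core[OF that] by simp
    qed
    then have "(\<Sum>v\<in>{v\<in>V. v \<le> K}. measure_pmf.prob ?M {\<omega>. \<omega> (?T, v) \<inter> ?C \<noteq> {}}) \<le> (\<Sum>v\<in>{v\<in>V. v \<le> K}. real c * real k / real D)"
      by (intro sum_mono) auto
    also have "\<dots> \<le> real K * (real c * real k / real D)"
    proof -
      have "card {v\<in>V. v \<le> K} \<le> card {1..K}"
      proof (intro card_mono subsetI)
        fix v assume "v \<in> {v\<in>V. v \<le> K}"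
        moreover from this have "v \<noteq> 0" using assms(6) by (intro notI) simp
        ultimately show "v \<in> {1..K}" by simp
      qed simp
      then have "real (card {v\<in>V. v \<le> K}) \<le> real K" by simp
      then show ?thesis unfolding sum_constant by (intro mult_right_mono) auto
    qed
    finally show ?thesis using finite_V
      by (intro order_trans[OF measure_pmf.finite_measure_subadditive_finite]) auto
  qed
  have "measure_pmf.prob ?M {\<omega>. \<exists>v\<in>V. ?red \<omega> ?T v} \<le> measure_pmf.prob ?M (?E1 \<union> ?E2 \<union> ?E3)"
  proof (rule measure_pmf.finite_measure_mono_AE)
    have "\<omega> \<in> ?E1 \<union> ?E2 \<union> ?E3" if w: "\<omega> \<in> set_pmf ?M" "v \<in> V" "?red \<omega> ?T v" for \<omega> v
    proof (cases "K < v")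
      case False
      have "{e \<in> \<omega> (?T, v). ?red \<omega> (Suc \<tau>) (opposite G e)} \<noteq> {}"
      proof
        assume empty: "{e \<in> \<omega> (?T, v). ?red \<omega> (Suc \<tau>) (opposite G e)} = {}"
        have "card (\<omega> (?T, v)) < 2 * card {e \<in> \<omega> (?T, v). ?red \<omega> (Suc \<tau>) (opposite G e)}"
          using w(3) by (subst (asm) red.simps(2))
        then show False unfolding empty by simp
      qed
      then obtain e where e: "e \<in> \<omega> (?T, v)" "?red \<omega> (Suc \<tau>) (opposite G e)" by blast
      have "fst e < length G" using history_sample[OF w(1)] e(1) by fastforce
      then have "opposite G e \<in> V" by (rule opposite_in_V)
      with False e w(2) show ?thesis by (cases "opposite G e \<le> K") auto
    qed (use w in auto)
    then show "AE \<omega> in ?M. \<omega> \<in> {\<omega>. \<exists>v\<in>V. ?red \<omega> ?T v} \<longrightarrow> \<omega> \<in> ?E1 \<union> ?E2 \<union> ?E3"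
      by (auto simp: AE_measure_pmf_iff simp del: red.simps)
  qed auto
  also have "\<dots> \<le> measure_pmf.prob ?M (?E1 \<union> ?E2) + measure_pmf.prob ?M ?E3"
    by (rule measure_Un_le) auto
  also have "\<dots> \<le> measure_pmf.prob ?M ?E1 + measure_pmf.prob ?M ?E2 + measure_pmf.prob ?M ?E3"
    by (intro add_right_mono measure_Un_le) auto
  also have "\<dots> \<le> real (card V) * (real k * mean_field h \<alpha> \<tau>) + real (card V) * (real k * mean_field h \<alpha> (Suc \<tau>))
      + real K * (real c * real k / real D)"
    using sum_red[of \<tau>] sum_red[of "Suc \<tau>"] E3 by (intro add_mono) auto
  finally show ?thesis by (simp add: distrib_left)
qed

end

section \<open>From the protocol to finitely many choices\<close>

text \<open>Functions in the space of the product measure are \<open>undefined\<close> outside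
  \<open>I\<close>, those of \<open>Pi_pmf\<close> equal \<open>d\<close> there; restriction
  mediates, and the two laws agree on boxes.\<close>

lemma PiM_measure_pmf_eq_distr:
  assumes "finite I"
  shows "Pi\<^sub>M I (\<lambda>i. measure_pmf (p i)) =
    distr (measure_pmf (Pi_pmf I d p)) (Pi\<^sub>M I (\<lambda>_. count_space UNIV)) (\<lambda>f. restrict f I)"
proof -
  let ?D = "distr (measure_pmf (Pi_pmf I d p)) (Pi\<^sub>M I (\<lambda>_. count_space UNIV)) (\<lambda>f. restrict f I)"
  interpret product_prob_space "\<lambda>i. measure_pmf (p i)" I by unfold_locales
  have meas: "(\<lambda>f. restrict f I) \<in> measurable (measure_pmf (Pi_pmf I d p)) (Pi\<^sub>M I (\<lambda>_. count_space UNIV))"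
    by (rule measurable_PiM_single') (auto simp: space_PiM)
  show ?thesis
  proof (rule PiM_eqI[OF assms, symmetric])
    show "sets ?D =
        sets (Pi\<^sub>M I (\<lambda>i. measure_pmf (p i)))"
      by (simp, intro sets_PiM_cong) auto
    fix A assume "\<And>i. i \<in> I \<Longrightarrow> A i \<in> sets (measure_pmf (p i))"
    have "emeasure ?D (Pi\<^sub>E I A)
       = emeasure (measure_pmf (Pi_pmf I d p)) ((\<lambda>f. restrict f I) -` Pi\<^sub>E I A)"
      by (subst emeasure_distr[OF meas]) (auto intro!: sets_PiM_I_finite assms)
    also have "(\<lambda>f. restrict f I) -` Pi\<^sub>E I A = Pi I A" by (auto simp: PiE_def Pi_iff)
    also have "emeasure (measure_pmf (Pi_pmf I d p)) (Pi I A) = ennreal (\<Prod>i\<in>I. measure_pmf.prob (p i) (A i))"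
      by (simp add: measure_pmf.emeasure_eq_measure measure_Pi_pmf_Pi assms)
    also have "\<dots> = (\<Prod>i\<in>I. emeasure (measure_pmf (p i)) (A i))"
      by (simp add: prod_ennreal measure_pmf.emeasure_eq_measure)
    finally show "emeasure ?D (Pi\<^sub>E I A)
       = (\<Prod>i\<in>I. emeasure (measure_pmf (p i)) (A i))" .
  qed
qed

lemma red_cong_choices:
  "(\<And>\<sigma> u. 1 \<le> \<sigma> \<Longrightarrow> \<sigma> \<le> \<tau> \<Longrightarrow> c (\<sigma>, u) = c' (\<sigma>, u)) \<Longrightarrow> red G x c \<tau> v = red G x c' \<tau> v"
  by (induction \<tau> arbitrary: v) auto

lemma red_cong:
  assumes "\<And>e. fst e < length G \<Longrightarrow> endpoint G e \<in> V" "\<And>u. u \<in> V \<Longrightarrow> x u = x' u"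
    and "\<And>\<sigma> u. 1 \<le> \<sigma> \<Longrightarrow> \<sigma> \<le> \<tau> \<Longrightarrow> u \<in> V \<Longrightarrow> c (\<sigma>, u) = c' (\<sigma>, u) \<and> c (\<sigma>, u) \<subseteq> edge_ends G u"
    and "v \<in> V"
  shows "red G x c \<tau> v = red G x' c' \<tau> v"
  using assms(3,4)
proof (induction \<tau> arbitrary: v)
  case (Suc \<tau>)
  have "red G x c \<tau> (opposite G e) = red G x' c' \<tau> (opposite G e)" if "e \<in> c (Suc \<tau>, v)" for e
  proof (rule Suc.IH)
    have "fst e < length G" using Suc.prems(1)[of "Suc \<tau>" v] Suc.prems(2) that by auto
    then show "opposite G e \<in> V" unfolding opposite_conv_rev_end by (intro assms(1)) simp
    show "c (\<sigma>, u) = c' (\<sigma>, u) \<and> c (\<sigma>, u) \<subseteq> edge_ends G u" if "1 \<le> \<sigma>" "\<sigma> \<le> \<tau>" "u \<in> V" for \<sigma> u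
      using that by (intro Suc.prems(1)) simp_all
  qed
  then have "{e \<in> c (Suc \<tau>, v). red G x c \<tau> (opposite G e)} = {e \<in> c (Suc \<tau>, v). red G x' c' \<tau> (opposite G e)}"
    by auto
  then show ?case using Suc.prems(1)[of "Suc \<tau>" v] Suc.prems(2) by simp
qed (use assms(2) in auto)

lemma all_blue_absorbing:
  assumes "\<And>e. fst e < length G \<Longrightarrow> endpoint G e \<in> V"
    and "\<And>\<tau> u. u \<in> V \<Longrightarrow> c (Suc \<tau>, u) \<subseteq> edge_ends G u"
    and "\<forall>v\<in>V. \<not> red G x c T v" "T \<le> \<tau>" "v \<in> V"
  shows "\<not> red G x c \<tau> v"
  using assms(4,5)
proof (induction \<tau> arbitrary: v rule: dec_induct)
  case (step n)
  have "\<not> red G x c n (opposite G e)" if "e \<in> c (Suc n, v)" for e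
  proof -
    have "fst e < length G" using assms(2)[OF step.prems, of n] that by auto
    then have "opposite G e \<in> V" unfolding opposite_conv_rev_end by (intro assms(1)) simp
    then show ?thesis by (rule step.IH)
  qed
  then have "{e \<in> c (Suc n, v). red G x c n (opposite G e)} = {}" by blast
  then show ?case by (simp only: red.simps card.empty)
qed (use assms(3) in auto)

definition colours_pmf :: "real \<Rightarrow> nat set \<Rightarrow> (nat \<Rightarrow> bool) pmf" where
  "colours_pmf \<alpha> V = Pi_pmf V False (\<lambda>_. bernoulli_pmf \<alpha>)"

definition samples_pmf :: "nat \<Rightarrow> multigraph \<Rightarrow> nat \<Rightarrow> nat set \<Rightarrow> (nat \<times> nat \<Rightarrow> edge_end set) pmf" where
  "samples_pmf k G T V = Pi_pmf ({1..T} \<times> V) {} (\<lambda>j. choice_pmf k G (snd j))"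

lemma history_pmf_eq:
  assumes "finite V" "0 \<notin> V"
  shows "history_pmf k G \<alpha> T V = map_pmf (\<lambda>(x, f) j. if fst j = 0 then colour_code (x (snd j)) else f j)
    (pair_pmf (colours_pmf \<alpha> V) (samples_pmf k G T V))"
proof -
  let ?Z = "{0 :: nat} \<times> V" and ?J = "{1..T} \<times> V"
  \<comment> \<open>Coordinates off time 0 go to vertex 0, which is outside \<open>V\<close>: there
    \<open>colours_pmf\<close> has its default \<open>False\<close>, as the transport along a
    bijection of index sets demands.\<close>
  let ?h = "\<lambda>j :: nat \<times> nat. if fst j = 0 then snd j else 0"
  have split: "{..T} \<times> V = ?Z \<union> ?J" by (auto simp: Suc_le_eq)
  have "history_pmf k G \<alpha> T V = map_pmf (\<lambda>(g, f) j. if j \<in> ?Z then g j else f j)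
     (pair_pmf (Pi_pmf ?Z {} (step_law k G \<alpha>)) (Pi_pmf ?J {} (step_law k G \<alpha>)))"
    unfolding history_pmf_def split by (rule Pi_pmf_union) (use assms in auto)
  also have "Pi_pmf ?J {} (step_law k G \<alpha>) = samples_pmf k G T V"
    unfolding samples_pmf_def by (intro Pi_pmf_cong) (auto simp: step_law_def)
  also have "Pi_pmf ?Z {} (step_law k G \<alpha>) = Pi_pmf ?Z {} (\<lambda>_. map_pmf colour_code (bernoulli_pmf \<alpha>))"
    by (intro Pi_pmf_cong) (auto simp: step_law_def)
  also have "\<dots> = map_pmf (\<lambda>g. colour_code \<circ> g) (Pi_pmf ?Z False (\<lambda>_. bernoulli_pmf \<alpha>))"
    using assms by (intro Pi_pmf_map) (auto simp: colour_code_def)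
  also have "Pi_pmf ?Z False (\<lambda>_. bernoulli_pmf \<alpha>) = map_pmf (\<lambda>g. g \<circ> ?h) (colours_pmf \<alpha> V)"
    unfolding colours_pmf_def
  proof (rule Pi_pmf_bij_betw)
    show "bij_betw ?h ?Z V" by (rule bij_betw_byWitness[where f' = "Pair 0"]) auto
  qed (use assms in auto)
  also have "map_pmf (\<lambda>(g, f) j. if j \<in> ?Z then g j else f j)
      (pair_pmf (map_pmf (\<lambda>g. colour_code \<circ> g) (map_pmf (\<lambda>g. g \<circ> ?h) (colours_pmf \<alpha> V))) (samples_pmf k G T V)) =
      map_pmf (\<lambda>(x, f) j. if j \<in> ?Z then colour_code (x (?h j)) else f j)
        (pair_pmf (colours_pmf \<alpha> V) (samples_pmf k G T V))"
    unfolding pmf.map_comp pair_map_pmf1 by (rule map_pmf_cong[OF refl]) (auto simp: fun_eq_iff)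
  also have "\<dots> = map_pmf (\<lambda>(x, f) j. if fst j = 0 then colour_code (x (snd j)) else f j)
        (pair_pmf (colours_pmf \<alpha> V) (samples_pmf k G T V))"
  proof (rule map_pmf_cong[OF refl])
    fix z assume z: "z \<in> set_pmf (pair_pmf (colours_pmf \<alpha> V) (samples_pmf k G T V))"
    have "fst z u = False" if "u \<notin> V" for u
      using z that Pi_pmf_outside[of V "fst z"] assms by (auto simp: colours_pmf_def)
    moreover have "snd z (0, u) = {}" for u
      using z Pi_pmf_outside[of ?J "snd z" _ _ "(0, u)"] assms by (auto simp: samples_pmf_def)
    ultimately show "(case z of (x, f) \<Rightarrow> \<lambda>j. if j \<in> ?Z then colour_code (x (?h j)) else f j) =
       (case z of (x, f) \<Rightarrow> \<lambda>j. if fst j = 0 then colour_code (x (snd j)) else f j)"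
      by (cases z) (auto simp: fun_eq_iff colour_code_def)
  qed
  finally show ?thesis .
qed

context sampled_graph
begin

lemma prob_history_eq:
  assumes "0 \<notin> V"
  shows "measure_pmf.prob (history_pmf k G \<alpha> T V) {\<omega>. \<exists>v\<in>V. red G (\<lambda>v. \<omega> (0, v) \<noteq> {}) \<omega> T v} =
    measure_pmf.prob (pair_pmf (colours_pmf \<alpha> V) (samples_pmf k G T V)) {z. \<exists>v\<in>V. red G (fst z) (snd z) T v}"
proof -
  let ?m = "\<lambda>(x, f) j. if fst j = 0 then colour_code (x (snd j)) else f j"
  have "red G (\<lambda>v. ?m z (0, v) \<noteq> {}) (?m z) T v = red G (fst z) (snd z) T v" for z :: "(nat \<Rightarrow> bool) \<times> (nat \<times> nat \<Rightarrow> edge_end set)" and v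
  proof -
    have "(\<lambda>v. ?m z (0, v) \<noteq> {}) = fst z" by (cases z) (auto simp: colour_code_def)
    moreover have "red G (fst z) (?m z) T v = red G (fst z) (snd z) T v"
      by (rule red_cong_choices) (auto simp: case_prod_unfold)
    ultimately show ?thesis by simp
  qed
  then show ?thesis
    unfolding history_pmf_eq[OF finite_V assms] measure_map_pmf vimage_Collect_eq by simp
qed

text \<open>Redness at time \<open>T\<close> uses only the first \<open>T\<close> steps, so the
  infinite product over all times can be projected to a finite one, which is a restricted
  \<open>Pi_pmf\<close>.\<close>

lemma choices_red_eq:
  assumes V: "V = {1..t}" and x: "x \<in> space (Pi\<^sub>M {1..t} (\<lambda>_. count_space UNIV))"
  shows "emeasure (choices_measure k t G) {c \<in> space (choices_measure k t G). \<exists>v\<in>V. red G x c T v} =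
     emeasure (measure_pmf (samples_pmf k G T V)) {f. \<exists>v\<in>V. red G x f T v}"
proof -
  let ?I = "{1..} \<times> {1..t} :: (nat \<times> nat) set" and ?J = "{1..T} \<times> {1..t}"
  let ?CS = "\<lambda>J. Pi\<^sub>M J (\<lambda>_. count_space UNIV) :: (nat \<times> nat \<Rightarrow> edge_end set) measure"
  define p where "p j = choice_pmf k G (snd j)" for j :: "nat \<times> nat"
  let ?PM = "\<lambda>J. Pi\<^sub>M J (\<lambda>j. measure_pmf (p j))" and ?SP = "measure_pmf (samples_pmf k G T V)"
  \<comment> \<open>Extends a finite history to all times by empty samples, yet stays
    \<open>undefined\<close> off the index set, so that the result is a point of the infinite
    product.\<close>
  let ?ext = "\<lambda>f. \<lambda>j\<in>?I. if j \<in> ?J then f j else {}"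
  interpret product_prob_space "\<lambda>j. measure_pmf (p j)" ?I by unfold_locales
  have ch: "choices_measure k t G = ?PM ?I"
    unfolding choices_measure_def p_def by (simp add: case_prod_unfold)
  have sets_ch: "sets (?PM J) = sets (?CS J)" for J
    by (intro sets_PiM_cong) auto
  have space_ch: "space (?PM J) = space (?CS J)" for J
    by (simp add: space_PiM)
  define Q where "Q c \<longleftrightarrow> (\<exists>v\<in>V. red G x c T v)" for c
  have meas_Q: "Measurable.pred (?CS ?I) Q"
  proof -
    have "Measurable.pred (?CS ?I) (\<lambda>c. red G x c T v)" for v
      using measurable_compose[OF measurable_Pair1'[OF x] red_measurable[where t = t and G = G and \<tau> = T and v = v]]
      by simp
    then show ?thesis unfolding Q_def V by measurable
  qed
  have meas_ext: "?ext \<in> measurable (?CS ?J) (?CS ?I)"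
  proof (rule measurable_restrict)
    show "(\<lambda>f. if j \<in> ?J then f j else {}) \<in> measurable (?CS ?J) (count_space UNIV)" for j
      by (cases "j \<in> ?J") (auto intro: measurable_component_singleton)
  qed
  have meas_Qe: "Measurable.pred (?CS ?J) (\<lambda>f. Q (?ext f))"
    by (rule measurable_compose[OF meas_ext meas_Q])
  have restr: "Q c \<longleftrightarrow> Q (?ext (restrict c ?J))" if "c \<in> space (?CS ?I)" for c
  proof -
    have "red G x c T v = red G x (?ext (restrict c ?J)) T v" for v
    proof (rule red_cong_choices)
      fix \<sigma> u assume "1 \<le> \<sigma>" "\<sigma> \<le> T"
      then show "c (\<sigma>, u) = ?ext (restrict c ?J) (\<sigma>, u)"
        using space_PiM_outside[OF that, of "(\<sigma>, u)"] by auto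
    qed
    then show ?thesis by (simp add: Q_def)
  qed
  have eq: "{c \<in> space (?CS ?I). Q c} = (\<lambda>c. restrict c ?J) -` {f \<in> space (?CS ?J). Q (?ext f)} \<inter> space (?PM ?I)"
  proof (intro set_eqI)
    fix c
    have "restrict c ?J \<in> space (?CS ?J)" by (simp add: space_PiM)
    then show "c \<in> {c \<in> space (?CS ?I). Q c} \<longleftrightarrow>
        c \<in> (\<lambda>c. restrict c ?J) -` {f \<in> space (?CS ?J). Q (?ext f)} \<inter> space (?PM ?I)"
      using restr[of c] unfolding space_ch by blast
  qed
  have m: "(\<lambda>c. restrict c ?J) \<in> measurable (?PM ?I) (?PM ?J)"
    by (rule measurable_restrict_subset) auto
  have s: "{f \<in> space (?CS ?J). Q (?ext f)} \<in> sets (?PM ?J)"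
    using meas_Qe unfolding sets_ch pred_def .
  have "emeasure (choices_measure k t G) {c \<in> space (choices_measure k t G). Q c} =
      emeasure (distr (?PM ?I) (?PM ?J) (\<lambda>c. restrict c ?J))
        {f \<in> space (?CS ?J). Q (?ext f)}"
    unfolding ch space_ch[of ?I] eq emeasure_distr[OF m s] ..
  also have "distr (?PM ?I) (?PM ?J) (\<lambda>c. restrict c ?J)
      = ?PM ?J"
    by (rule distr_PiM_restrict_finite) auto
  also have "\<dots> = distr (?SP) (?CS ?J) (\<lambda>f. restrict f ?J)"
    unfolding samples_pmf_def p_def[symmetric] V by (rule PiM_measure_pmf_eq_distr) auto
  also have "emeasure \<dots> {f \<in> space (?CS ?J). Q (?ext f)} =
      emeasure (?SP) {f. Q (?ext (restrict f ?J))}"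
  proof -
    have "(\<lambda>f. restrict f ?J) \<in> measurable (?SP) (?CS ?J)"
      by (rule measurable_restrict) simp
    moreover have "(\<lambda>f. restrict f ?J) -` {f \<in> space (?CS ?J). Q (?ext f)} \<inter> space (?SP)
        = {f. Q (?ext (restrict f ?J))}" by (simp add: space_PiM vimage_def del: One_nat_def)
    ultimately show ?thesis using meas_Qe by (subst emeasure_distr) (auto simp: pred_def)
  qed
  also have "\<dots> = emeasure (?SP) {f. Q f}"
  proof (rule emeasure_eq_AE)
    have "Q (?ext (restrict f ?J)) = Q f" if f: "f \<in> set_pmf (samples_pmf k G T V)" for f
    proof -
      have "red G x f T v = red G x (?ext (restrict f ?J)) T v" if "v \<in> V" for v
      proof (rule red_cong[OF endpoint_in_V])
        fix \<sigma> u assume u: "1 \<le> \<sigma>" "\<sigma> \<le> T" "u \<in> V"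
        then have "f (\<sigma>, u) \<in> set_pmf (choice_pmf k G u)"
          using f finite_V by (auto simp: samples_pmf_def set_Pi_pmf PiE_dflt_def)
        then show "f (\<sigma>, u) = ?ext (restrict f ?J) (\<sigma>, u) \<and> f (\<sigma>, u) \<subseteq> edge_ends G u"
          using sample[OF u(3)] u V by auto
      qed (use that in auto)
      then show ?thesis by (auto simp: Q_def)
    qed
    then show "AE f in samples_pmf k G T V. (f \<in> {f. Q (?ext (restrict f ?J))}) = (f \<in> {f. Q f})"
      by (simp add: AE_measure_pmf_iff)
  qed auto
  finally show ?thesis unfolding Q_def .
qed

end

section \<open>Integrating the bound for fixed graphs over the random graph\<close>

lemma nn_integral_le_split:
  assumes "\<And>x. x \<in> set_pmf p \<Longrightarrow> f x \<le> 1" "\<And>x. x \<in> set_pmf p \<Longrightarrow> x \<notin> B \<Longrightarrow> f x \<le> ennreal b" "0 \<le> b"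
  shows "(\<integral>\<^sup>+x. f x \<partial>measure_pmf p) \<le> ennreal (measure_pmf.prob p B + b)"
proof -
  have "(\<integral>\<^sup>+x. f x \<partial>measure_pmf p) \<le> (\<integral>\<^sup>+x. indicator B x + ennreal b \<partial>measure_pmf p)"
    using assms by (intro nn_integral_mono_AE) (auto simp: AE_measure_pmf_iff indicator_def add_increasing2)
  also have "\<dots> = emeasure (measure_pmf p) B + ennreal b"
    by (subst nn_integral_add) auto
  finally show ?thesis using assms(3) by (simp add: measure_pmf.emeasure_eq_measure)
qed

definition late_red :: "real \<Rightarrow> nat \<Rightarrow> (multigraph \<times> (nat \<Rightarrow> bool) \<times> (nat \<times> nat \<Rightarrow> edge_end set)) set" where
  "late_red R t = {\<omega> \<in> space (protocol_algebra t).
      case \<omega> of (G, x, c) \<Rightarrow> \<not> (\<forall>\<tau>. real \<tau> \<ge> R \<longrightarrow> (\<forall>v\<in>{1..t}. \<not> red G x c \<tau> v))}"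

lemma late_red_sets: "late_red R t \<in> sets (protocol_algebra t)"
proof -
  let ?A = "{\<omega> \<in> space (protocol_algebra t). case \<omega> of (G, x, c) \<Rightarrow> \<forall>\<tau>. real \<tau> \<ge> R \<longrightarrow> (\<forall>v\<in>{1..t}. \<not> red G x c \<tau> v)}"
  note sp = sets_eq_imp_space_eq[OF sets_protocol_space]
  have "?A \<in> sets (protocol_algebra t)"
    using event_measurable[of _ _ _ _ t R] unfolding sp sets_protocol_space .
  then have "space (protocol_algebra t) - ?A \<in> sets (protocol_algebra t)"
    by (rule sets.compl_sets)
  also have "space (protocol_algebra t) - ?A = late_red R t"
    unfolding late_red_def by auto
  finally show ?thesis .
qed

context sampled_graph
begin

text \<open>A blue graph stays blue, so red at some time \<open>\<ge> R\<close> forces red at time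
  \<open>T \<le> R\<close>. That event involves finitely many coordinates, and Fubini replaces the
  colour measure and the choice measure by their pmfs in turn.\<close>

lemma emeasure_kernel_late_red_le:
  assumes V: "V = {1..t}" and R: "real T \<le> R"
  shows "emeasure (return (count_space UNIV) G \<Otimes>\<^sub>M (initial_measure \<alpha> t \<Otimes>\<^sub>M choices_measure k t G)) (late_red R t)
    \<le> ennreal (measure_pmf.prob (history_pmf k G \<alpha> T V) {\<omega>. \<exists>v\<in>V. red G (\<lambda>v. \<omega> (0, v) \<noteq> {}) \<omega> T v})"
proof -
  let ?X = "Pi\<^sub>M {1..t} (\<lambda>_. count_space UNIV) :: (nat \<Rightarrow> bool) measure"
  let ?C = "Pi\<^sub>M ({1..} \<times> {1..t}) (\<lambda>_. count_space UNIV) :: (nat \<times> nat \<Rightarrow> edge_end set) measure"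
  let ?I = "initial_measure \<alpha> t" and ?Ch = "choices_measure k t G"
  have sets_I: "sets ?I = sets ?X" and sets_Ch: "sets ?Ch = sets ?C"
    unfolding initial_measure_def choices_measure_def by (intro sets_PiM_cong; auto)+
  note space_I = sets_eq_imp_space_eq[OF sets_I] and space_Ch = sets_eq_imp_space_eq[OF sets_Ch]
  interpret I: prob_space ?I unfolding initial_measure_def by (intro prob_space_PiM prob_space_measure_pmf)
  interpret Ch: prob_space ?Ch unfolding choices_measure_def
    by (intro prob_space_PiM) (auto simp: prob_space_measure_pmf split: prod.split)
  interpret N: pair_prob_space ?I ?Ch ..
  let ?N = "?I \<Otimes>\<^sub>M ?Ch"
  have sets_N: "sets ?N = sets (?X \<Otimes>\<^sub>M ?C)" by (intro sets_pair_measure_cong sets_I sets_Ch)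
  have sets_PN: "sets (M \<Otimes>\<^sub>M ?N) = sets (protocol_algebra t)" if "sets M = UNIV" for M :: "multigraph measure"
    unfolding protocol_algebra_def using that by (intro sets_pair_measure_cong sets_N) simp
  let ?B = "Pair G -` late_red R t"
  let ?Y = "{\<omega> \<in> space ?N. \<exists>v\<in>V. red G (fst \<omega>) (snd \<omega>) T v}"
  have B: "?B \<in> sets ?N"
  proof -
    have "late_red R t \<in> sets (count_space UNIV \<Otimes>\<^sub>M ?N)"
      using late_red_sets[of R t] by (subst sets_PN) simp_all
    then show ?thesis by (rule sets_Pair1)
  qed
  have Y: "?Y \<in> sets ?N"
  proof -
    have "Measurable.pred (?X \<Otimes>\<^sub>M ?C) (\<lambda>\<omega>. \<exists>v\<in>V. red G (fst \<omega>) (snd \<omega>) T v)"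
      using red_measurable[where t = t and G = G and \<tau> = T] unfolding V by measurable
    then show ?thesis unfolding pred_def sets_N sets_eq_imp_space_eq[OF sets_N] .
  qed
  have sect: "Pair x -` ?Y = {c \<in> space ?Ch. \<exists>v\<in>V. red G x c T v}" if "x \<in> space ?X" for x
    using that by (auto simp: space_pair_measure space_I)
  \<comment> \<open>Samples consist of edge-ends at their vertex only almost surely; times are
    countable and vertices finite, so the exceptional sets together are null.\<close>
  have valid: "AE c in ?Ch. \<forall>\<tau>. \<forall>u\<in>V. c (Suc \<tau>, u) \<subseteq> edge_ends G u"
  proof -
    have "AE c in ?Ch. c (Suc \<tau>, u) \<subseteq> edge_ends G u" if "u \<in> V" for \<tau> u
      unfolding choices_measure_def
    proof (rule AE_PiM_component[where i = "(Suc \<tau>, u)" and P = "\<lambda>S. S \<subseteq> edge_ends G u"])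
      show "AE S in (case (Suc \<tau>, u) of (\<tau>, v) \<Rightarrow> measure_pmf (choice_pmf k G v)). S \<subseteq> edge_ends G u"
        using sample[OF that] by (auto simp: AE_measure_pmf_iff)
    qed (use that V in \<open>auto simp: prob_space_measure_pmf split: prod.split\<close>)
    then have "AE c in ?Ch. \<forall>u\<in>V. c (Suc \<tau>, u) \<subseteq> edge_ends G u" for \<tau>
      using finite_V by (intro AE_finite_allI) auto
    then show ?thesis by (simp add: AE_all_countable)
  qed
  have "emeasure (return (count_space UNIV) G \<Otimes>\<^sub>M ?N) (late_red R t) =
      (\<integral>\<^sup>+H. emeasure ?N (Pair H -` late_red R t) \<partial>return (count_space UNIV) G)"
    by (rule N.emeasure_pair_measure_alt, subst sets_PN) (simp_all add: late_red_sets)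
  also have "\<dots> = emeasure ?N ?B" by (rule nn_integral_return) auto
  also have "\<dots> = (\<integral>\<^sup>+x. emeasure ?Ch (Pair x -` ?B) \<partial>?I)" by (rule Ch.emeasure_pair_measure_alt[OF B])
  also have "\<dots> \<le> (\<integral>\<^sup>+x. emeasure ?Ch (Pair x -` ?Y) \<partial>?I)"
  proof (rule nn_integral_mono)
    fix x assume x: "x \<in> space ?I"
    then have x': "x \<in> space ?X" by (simp add: space_I)
    show "emeasure ?Ch (Pair x -` ?B) \<le> emeasure ?Ch (Pair x -` ?Y)"
    proof (rule emeasure_mono_AE)
      show "Pair x -` ?Y \<in> sets ?Ch" by (rule sets_Pair1[OF Y])
      show "AE c in ?Ch. c \<in> Pair x -` ?B \<longrightarrow> c \<in> Pair x -` ?Y"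
        using valid AE_space
      proof eventually_elim
        case (elim c)
        show ?case
        proof
          assume "c \<in> Pair x -` ?B"
          then obtain \<tau> v where tv: "R \<le> real \<tau>" "v \<in> V" "red G x c \<tau> v" unfolding late_red_def V by auto
          have "T \<le> \<tau>" using R tv(1) by simp
          then have "\<exists>v\<in>V. red G x c T v"
            using all_blue_absorbing[OF endpoint_in_V, of c x T \<tau> v] elim(1) tv(2,3) by blast
          then show "c \<in> Pair x -` ?Y" unfolding sect[OF x'] using elim(2) by simp
        qed
      qed
    qed
  qed
  also have "\<dots> = (\<integral>\<^sup>+x. emeasure ?Ch (Pair (restrict x {1..t}) -` ?Y) \<partial>colours_pmf \<alpha> V)"
  proof -
    have I: "?I = distr (measure_pmf (colours_pmf \<alpha> V)) ?X (\<lambda>f. restrict f {1..t})"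
      unfolding initial_measure_def colours_pmf_def V by (rule PiM_measure_pmf_eq_distr) simp
    have "(\<lambda>x. emeasure ?Ch (Pair x -` ?Y)) \<in> borel_measurable ?X"
      using Ch.measurable_emeasure_Pair[OF Y] by (simp add: measurable_cong_sets[OF sets_I refl])
    moreover have "(\<lambda>f. restrict f {1..t}) \<in> measurable (measure_pmf (colours_pmf \<alpha> V)) ?X"
      by (rule measurable_restrict) simp
    ultimately show ?thesis by (subst (1) I) (rule nn_integral_distr, simp_all)
  qed
  also have "\<dots> = (\<integral>\<^sup>+x. emeasure (samples_pmf k G T V) {f. \<exists>v\<in>V. red G x f T v} \<partial>colours_pmf \<alpha> V)"
  proof (rule nn_integral_cong)
    fix x :: "nat \<Rightarrow> bool"
    let ?x = "restrict x {1..t}"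
    have x: "?x \<in> space ?X" by (simp add: space_PiM)
    have "red G ?x f T v = red G x f T v" if f: "f \<in> set_pmf (samples_pmf k G T V)" and v: "v \<in> V" for f v
    proof (rule red_cong[OF endpoint_in_V])
      fix \<sigma> u assume u: "1 \<le> \<sigma>" "\<sigma> \<le> T" "u \<in> V"
      then have "f (\<sigma>, u) \<in> set_pmf (choice_pmf k G u)"
        using f finite_V by (auto simp: samples_pmf_def set_Pi_pmf PiE_dflt_def)
      then show "f (\<sigma>, u) = f (\<sigma>, u) \<and> f (\<sigma>, u) \<subseteq> edge_ends G u"
        using sample[OF u(3)] by blast
    qed (use v V in auto)
    then have "emeasure (samples_pmf k G T V) {f. \<exists>v\<in>V. red G ?x f T v} = emeasure (samples_pmf k G T V) {f. \<exists>v\<in>V. red G x f T v}"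
      by (intro emeasure_eq_AE) (auto simp: AE_measure_pmf_iff)
    then show "emeasure ?Ch (Pair ?x -` ?Y) = emeasure (samples_pmf k G T V) {f. \<exists>v\<in>V. red G x f T v}"
      unfolding sect[OF x] choices_red_eq[OF V x] .
  qed
  also have "\<dots> = emeasure (pair_pmf (colours_pmf \<alpha> V) (samples_pmf k G T V)) {z. \<exists>v\<in>V. red G (fst z) (snd z) T v}"
  proof -
    have "emeasure (pair_pmf (colours_pmf \<alpha> V) (samples_pmf k G T V)) {z. \<exists>v\<in>V. red G (fst z) (snd z) T v} =
      (\<integral>\<^sup>+z. indicator {z. \<exists>v\<in>V. red G (fst z) (snd z) T v} z \<partial>pair_pmf (colours_pmf \<alpha> V) (samples_pmf k G T V))"
      by simp
    also have "\<dots> = (\<integral>\<^sup>+x. \<integral>\<^sup>+f. indicator {f. \<exists>v\<in>V. red G x f T v} f \<partial>samples_pmf k G T V \<partial>colours_pmf \<alpha> V)"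
      unfolding nn_integral_pair_pmf' by (simp add: indicator_def)
    finally show ?thesis by simp
  qed
  also have "\<dots> = ennreal (measure_pmf.prob (history_pmf k G \<alpha> T V) {\<omega>. \<exists>v\<in>V. red G (\<lambda>v. \<omega> (0, v) \<noteq> {}) \<omega> T v})"
    using prob_history_eq[of T] V by (simp add: measure_pmf.emeasure_eq_measure)
  finally show ?thesis .
qed

end

lemma prob_protocol_ge:
  assumes "\<And>G. G \<in> set_pmf (pref_attach m \<delta> t) \<Longrightarrow> G \<notin> B \<Longrightarrow>
     emeasure (return (count_space UNIV) G \<Otimes>\<^sub>M (initial_measure \<alpha> t \<Otimes>\<^sub>M choices_measure k t G)) (late_red R t) \<le> ennreal b"
    and "0 \<le> b"
  shows "\<P>((G, x, c) in protocol_space k m \<delta> \<alpha> t. \<forall>\<tau>. real \<tau> \<ge> R \<longrightarrow> (\<forall>v\<in>{1..t}. \<not> red G x c \<tau> v))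
    \<ge> 1 - (measure_pmf.prob (pref_attach m \<delta> t) B + b)"
proof -
  interpret P: prob_space "protocol_space k m \<delta> \<alpha> t" by (rule prob_space_protocol_space)
  let ?K = "\<lambda>G. return (count_space UNIV) G \<Otimes>\<^sub>M (initial_measure \<alpha> t \<Otimes>\<^sub>M choices_measure k t G)"
  let ?E = "{\<omega> \<in> space (protocol_space k m \<delta> \<alpha> t). case \<omega> of (G, x, c) \<Rightarrow> \<forall>\<tau>. real \<tau> \<ge> R \<longrightarrow> (\<forall>v\<in>{1..t}. \<not> red G x c \<tau> v)}"
  note sp = sets_eq_imp_space_eq[OF sets_protocol_space]
  have K_le: "emeasure (?K G) (late_red R t) \<le> 1" for G
  proof -
    have "?K G \<in> space (prob_algebra (protocol_algebra t))"
      using measurable_space[OF kernel_measurable[where p = "return_pmf G"], of G] by simp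
    then show ?thesis by (auto simp: space_prob_algebra intro: prob_space.emeasure_le_1)
  qed
  have "emeasure (protocol_space k m \<delta> \<alpha> t) (late_red R t) =
     (\<integral>\<^sup>+G. emeasure (?K G) (late_red R t) \<partial>measure_pmf (pref_attach m \<delta> t))"
    unfolding protocol_space_def
    by (rule emeasure_bind_prob_algebra[OF _ kernel_measurable late_red_sets])
      (simp add: space_prob_algebra prob_space_measure_pmf)
  also have "\<dots> \<le> ennreal (measure_pmf.prob (pref_attach m \<delta> t) B + b)"
    using K_le assms by (intro nn_integral_le_split) auto
  finally have "P.prob (late_red R t) \<le> measure_pmf.prob (pref_attach m \<delta> t) B + b"
    using assms(2) by (simp add: P.emeasure_eq_measure del: ennreal_plus)
  moreover have "P.prob (late_red R t) = 1 - P.prob ?E"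
  proof -
    have "late_red R t = space (protocol_space k m \<delta> \<alpha> t) - ?E"
      unfolding late_red_def sp by auto
    then show ?thesis using P.prob_compl[OF event_measurable[of k m \<delta> \<alpha> t R]] by (simp only:)
  qed
  moreover have "{(G, x, c). (G, x, c) \<in> space (protocol_space k m \<delta> \<alpha> t) \<and>
      (\<forall>\<tau>. real \<tau> \<ge> R \<longrightarrow> (\<forall>v\<in>{1..t}. \<not> red G x c \<tau> v))} = ?E" by auto
  ultimately show ?thesis by (simp only:)
qed

section \<open>Degrees in the preferential attachment graph\<close>

text \<open>A vertex not yet present has weight \<open>1 + \<delta>\<close>, the weight with which
  an arriving vertex attaches to itself. So attachment is proportional to weight on all of
  \<open>{1..t + 1}\<close>, and a step raises exactly the weight of the target by 1, loops
  included.\<close>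

definition weight :: "real \<Rightarrow> multigraph \<Rightarrow> nat \<Rightarrow> real" where
  "weight \<delta> G b = (if b \<in> {1..length G} then real (vertex_degree G b) else 1) + \<delta>"

definition total_weight :: "real \<Rightarrow> nat \<Rightarrow> real" where
  "total_weight \<delta> t = real t * (2 + \<delta>) + (1 + \<delta>)"

context
  fixes \<delta> :: real
  assumes \<delta>: "0 \<le> \<delta>"
begin

lemma total_weight_ge: "2 * real t + 1 \<le> total_weight \<delta> t"
proof -
  have "0 \<le> real t * \<delta>" using \<delta> by simp
  then show ?thesis using \<delta> unfolding total_weight_def distrib_left by linarith
qed

lemma total_weight_pos: "0 < total_weight \<delta> t"
  using total_weight_ge[of t] of_nat_0_le_iff[of t, where 'a = real] by linarith

lemma weight_append:
  assumes "G \<in> set_pmf (pa_one \<delta> t)" "i \<in> {1..t + 1}"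
  shows "weight \<delta> (G @ [(t + 1, i)]) b = weight \<delta> G b + (if b = i then 1 else 0)"
proof -
  note inv = pa_one_invariant[OF _ assms(1)]
  have "vertex_degree G (Suc t) = 0" "length G = t" using inv(1,4) \<delta> by auto
  then show ?thesis using assms(2) \<delta> by (auto simp: weight_def vertex_degree_append le_Suc_eq)
qed

lemma weight_ge_1:
  assumes "G \<in> set_pmf (pa_one \<delta> t)" shows "1 \<le> weight \<delta> G b"
proof -
  note inv = pa_one_invariant[OF _ assms(1)]
  have "length G = t" "b \<in> {1..t} \<Longrightarrow> 1 \<le> vertex_degree G b" using inv(1,2) \<delta> by auto
  then have "b \<in> {1..length G} \<Longrightarrow> 1 \<le> real (vertex_degree G b)" by auto
  then show ?thesis using \<delta> by (auto simp: weight_def)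
qed

lemma sum_weight:
  assumes "G \<in> set_pmf (pa_one \<delta> t)" shows "(\<Sum>i=1..t + 1. weight \<delta> G i) = total_weight \<delta> t"
proof -
  note inv = pa_one_invariant[OF _ assms(1)]
  have len: "length G = t" and sum: "(\<Sum>i=1..t. vertex_degree G i) = 2 * t" using inv(1,3) \<delta> by auto
  have "(\<Sum>i=1..t + 1. weight \<delta> G i) = (\<Sum>i=1..t. real (vertex_degree G i) + \<delta>) + (1 + \<delta>)"
    using len by (simp add: weight_def)
  also have "(\<Sum>i=1..t. real (vertex_degree G i) + \<delta>) = real (\<Sum>i=1..t. vertex_degree G i) + real t * \<delta>"
    by (simp add: sum.distrib)
  finally show ?thesis unfolding sum by (simp add: total_weight_def algebra_simps)
qed

lemma pmf_attach_weight:
  assumes "G \<in> set_pmf (pa_one \<delta> t)"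
  shows "pmf (attach_pmf \<delta> t G) i = (if i \<in> {1..t + 1} then weight \<delta> G i / total_weight \<delta> t else 0)"
proof -
  note inv = pa_one_invariant[OF _ assms(1)]
  show ?thesis
    by (subst pmf_attach_pmf) (use inv \<delta> in \<open>auto simp: weight_def total_weight_def\<close>)
qed

text \<open>Attachment probabilities are weights over \<open>total_weight\<close>, so a weighted sum
  over targets is a conditional expectation up to this factor. \<open>\<Psi>\<close> must be
  nonnegative on every graph, hence the absolute value and the \<open>max 0\<close> in the
  applications.\<close>

lemma pa_one_supermartingale_step:
  assumes "\<And>G. G \<in> set_pmf (pa_one \<delta> t) \<Longrightarrow> (\<Sum>i=1..t + 1. weight \<delta> G i * \<Psi> (G @ [(t + 1, i)])) \<le> r * \<Phi> G"
    and "\<And>G. 0 \<le> \<Psi> G" "0 \<le> r" "\<And>G. G \<in> set_pmf (pa_one \<delta> t) \<Longrightarrow> 0 \<le> \<Phi> G"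
  shows "(\<integral>\<^sup>+G. ennreal (\<Psi> G) \<partial>pa_one \<delta> (Suc t)) \<le> ennreal (r / total_weight \<delta> t) * (\<integral>\<^sup>+G. ennreal (\<Phi> G) \<partial>pa_one \<delta> t)"
proof -
  have "(\<integral>\<^sup>+G. ennreal (\<Psi> G) \<partial>pa_one \<delta> (Suc t)) =
      (\<integral>\<^sup>+G. \<integral>\<^sup>+i. ennreal (\<Psi> (G @ [(t + 1, i)])) \<partial>attach_pmf \<delta> t G \<partial>pa_one \<delta> t)"
    by (simp add: nn_integral_bind_pmf)
  also have "\<dots> \<le> (\<integral>\<^sup>+G. ennreal (r / total_weight \<delta> t) * ennreal (\<Phi> G) \<partial>pa_one \<delta> t)"
  proof (rule nn_integral_mono_AE, unfold AE_measure_pmf_iff, rule ballI)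
    fix G assume G: "G \<in> set_pmf (pa_one \<delta> t)"
    have w: "0 \<le> weight \<delta> G i" for i using weight_ge_1[OF G, of i] by simp
    have "(\<integral>\<^sup>+i. ennreal (\<Psi> (G @ [(t + 1, i)])) \<partial>attach_pmf \<delta> t G) =
        (\<Sum>i=1..t + 1. ennreal (\<Psi> (G @ [(t + 1, i)])) * pmf (attach_pmf \<delta> t G) i)"
      by (rule nn_integral_measure_pmf_support) (auto simp: set_pmf_iff pmf_attach_weight[OF G])
    also have "\<dots> = (\<Sum>i=1..t + 1. ennreal (weight \<delta> G i * \<Psi> (G @ [(t + 1, i)]) / total_weight \<delta> t))"
      using w assms(2) total_weight_pos[of t]
      by (intro sum.cong refl) (simp add: pmf_attach_weight[OF G] ennreal_mult'[symmetric] mult.commute)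
    also have "\<dots> = ennreal ((\<Sum>i=1..t + 1. weight \<delta> G i * \<Psi> (G @ [(t + 1, i)])) / total_weight \<delta> t)"
      unfolding sum_divide_distrib using w assms(2) total_weight_pos[of t]
      by (intro sum_ennreal) auto
    also have "\<dots> \<le> ennreal (r * \<Phi> G / total_weight \<delta> t)"
      using assms(1)[OF G] total_weight_pos[of t] by (intro ennreal_leI divide_right_mono) auto
    also have "\<dots> = ennreal (r / total_weight \<delta> t) * ennreal (\<Phi> G)"
      using assms(3,4) G total_weight_pos[of t] by (simp add: ennreal_mult'[symmetric])
    finally show "(\<integral>\<^sup>+i. ennreal (\<Psi> (G @ [(t + 1, i)])) \<partial>attach_pmf \<delta> t G) \<le> ennreal (r / total_weight \<delta> t) * ennreal (\<Phi> G)" .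
  qed
  also have "\<dots> = ennreal (r / total_weight \<delta> t) * (\<integral>\<^sup>+G. ennreal (\<Phi> G) \<partial>pa_one \<delta> t)"
    by (rule nn_integral_cmult) simp
  finally show ?thesis .
qed

text \<open>A hit, of probability \<open>w / Z\<close>, turns \<open>1 / w\<close> into
  \<open>1 / (w + 1)\<close>. As \<open>w / (w + 1) \<ge> 1 / 2\<close>, a step multiplies the
  expectation by at most \<open>1 - 1 / (2 Z)\<close>, and with
  \<open>Z \<le> (2 + \<delta>) (t + 1)\<close> these factors accumulate to the stated
  power.\<close>

lemma expectation_inverse_weight_le:
  assumes "1 \<le> b" "b \<le> t"
  shows "(\<integral>\<^sup>+G. ennreal (1 / weight \<delta> G b) \<partial>pa_one \<delta> t) \<le> ennreal (((real b + 1) / (real t + 1)) powr (1 / (2 * (2 + \<delta>))))"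
  using assms(2)
proof (induction t rule: dec_induct)
  case base
  have "(\<integral>\<^sup>+G. ennreal (1 / weight \<delta> G b) \<partial>pa_one \<delta> b) \<le> (\<integral>\<^sup>+G. ennreal 1 \<partial>pa_one \<delta> b)"
  proof (intro nn_integral_mono_AE, unfold AE_measure_pmf_iff, intro ballI ennreal_leI)
    fix G assume "G \<in> set_pmf (pa_one \<delta> b)"
    then have "1 \<le> weight \<delta> G b" by (rule weight_ge_1)
    then show "1 / weight \<delta> G b \<le> 1" by simp
  qed
  then show ?case by simp
next
  case (step t)
  let ?I = "\<lambda>t. \<integral>\<^sup>+G. ennreal (1 / weight \<delta> G b) \<partial>pa_one \<delta> t"
  let ?g = "1 / (2 * (2 + \<delta>))" and ?Z = "total_weight \<delta> t"
  have Z: "0 < ?Z" "1 / 2 \<le> ?Z" using total_weight_ge[of t] of_nat_0_le_iff[of t, where 'a = real] by linarith+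
  have "(\<integral>\<^sup>+G. ennreal (\<bar>1 / weight \<delta> G b\<bar>) \<partial>pa_one \<delta> (Suc t)) \<le>
      ennreal ((?Z - 1 / 2) / ?Z) * ?I t"
  proof (rule pa_one_supermartingale_step)
    fix G assume G: "G \<in> set_pmf (pa_one \<delta> t)"
    define w where "w = weight \<delta> G b"
    have w: "1 \<le> w" using weight_ge_1[OF G] by (simp add: w_def)
    then show "0 \<le> 1 / weight \<delta> G b" by (simp add: w_def)
    have b: "b \<in> {1..t + 1}" using step assms(1) by auto
    have "(\<Sum>i=1..t + 1. weight \<delta> G i * \<bar>1 / weight \<delta> (G @ [(t + 1, i)]) b\<bar>) =
      (\<Sum>i\<in>{1..t + 1}. weight \<delta> G i * (1 / (w + (if b = i then 1 else 0))))"
    proof (intro sum.cong refl)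
      fix i assume i: "i \<in> {1..t + 1}"
      show "weight \<delta> G i * \<bar>1 / weight \<delta> (G @ [(t + 1, i)]) b\<bar> = weight \<delta> G i * (1 / (w + (if b = i then 1 else 0)))"
        unfolding weight_append[OF G i] w_def[symmetric] using w by simp
    qed
    also have "\<dots> = w * (1 / (w + 1)) + (\<Sum>i\<in>{1..t + 1} - {b}. weight \<delta> G i * (1 / w))"
      using b by (subst sum.remove[of _ b]) (auto simp: w_def intro!: sum.cong)
    also have "(\<Sum>i\<in>{1..t + 1} - {b}. weight \<delta> G i * (1 / w)) = (?Z - w) * (1 / w)"
      unfolding sum_distrib_right[symmetric] using b sum_weight[OF G]
      by (subst sum_diff1) (auto simp: w_def)
    also have "w * (1 / (w + 1)) + (?Z - w) * (1 / w) = (?Z - w / (w + 1)) * (1 / w)"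
      using w by (simp add: field_simps)
    also have "\<dots> \<le> (?Z - 1 / 2) * (1 / w)"
      using w by (intro mult_right_mono diff_left_mono) (auto simp: field_simps)
    finally show "(\<Sum>i=1..t + 1. weight \<delta> G i * \<bar>1 / weight \<delta> (G @ [(t + 1, i)]) b\<bar>) \<le> (?Z - 1 / 2) * (1 / weight \<delta> G b)"
      by (simp add: w_def)
  qed (use Z in auto)
  also have "(\<integral>\<^sup>+G. ennreal (\<bar>1 / weight \<delta> G b\<bar>) \<partial>pa_one \<delta> (Suc t)) = ?I (Suc t)"
    using weight_ge_1[of _ "Suc t" b] by (intro nn_integral_cong_AE) (force simp: AE_measure_pmf_iff simp del: pa_one.simps)
  also have "ennreal ((?Z - 1 / 2) / ?Z) * ?I t
      \<le> ennreal ((?Z - 1 / 2) / ?Z) * ennreal (((real b + 1) / (real t + 1)) powr ?g)"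
    by (intro mult_left_mono step.IH) simp
  also have "\<dots> \<le> ennreal (((real b + 1) / (real (Suc t) + 1)) powr ?g)"
  proof -
    have "(?Z - 1 / 2) / ?Z = 1 + (- (1 / (2 * ?Z)))" using Z by (simp add: field_simps)
    also have "\<dots> \<le> exp (- (1 / (2 * ?Z)))" by (rule exp_ge_add_one_self)
    also have "\<dots> \<le> exp (- (?g * ln ((real (Suc t) + 1) / (real t + 1))))"
    proof -
      have "ln ((real (Suc t) + 1) / (real t + 1)) = ln (1 + 1 / (real t + 1))" by (simp add: field_simps)
      also have "\<dots> \<le> 1 / (real t + 1)" by (rule ln_add_one_self_le_self) simp
      finally have "?g * ln ((real (Suc t) + 1) / (real t + 1)) \<le> ?g * (1 / (real t + 1))"
        using \<delta> by (intro mult_left_mono) auto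
      also have "\<dots> = 1 / (2 * ((2 + \<delta>) * (real t + 1)))" by simp
      also have "\<dots> \<le> 1 / (2 * ?Z)"
      proof -
        have "?Z \<le> (2 + \<delta>) * (real t + 1)" by (simp add: total_weight_def algebra_simps)
        then show ?thesis using Z by (intro frac_le) auto
      qed
      finally show ?thesis by simp
    qed
    also have "\<dots> = ((real t + 1) / (real (Suc t) + 1)) powr ?g"
    proof -
      have "ln ((real t + 1) / (real (Suc t) + 1)) = - ln ((real (Suc t) + 1) / (real t + 1))" by (simp add: ln_div)
      then show ?thesis by (simp add: powr_def)
    qed
    finally have "(?Z - 1 / 2) / ?Z * ((real b + 1) / (real t + 1)) powr ?g \<le>
       ((real t + 1) / (real (Suc t) + 1)) powr ?g * ((real b + 1) / (real t + 1)) powr ?g"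
      by (intro mult_right_mono) auto
    also have "\<dots> = ((real b + 1) / (real (Suc t) + 1)) powr ?g"
      by (simp add: powr_mult[symmetric])
    finally show ?thesis using Z by (simp add: ennreal_mult'[symmetric] ennreal_leI)
  qed
  finally show ?case .
qed

lemma prob_degree_less_le:
  assumes "1 \<le> b" "b \<le> t" and True: "0 \<le> D"
  shows "measure_pmf.prob (pa_one \<delta> t) {G. real (vertex_degree G b) < D} \<le> (D + \<delta>) * ((real b + 1) / (real t + 1)) powr (1 / (2 * (2 + \<delta>)))"
proof -
  have "emeasure (pa_one \<delta> t) {G. real (vertex_degree G b) < D} =
      (\<integral>\<^sup>+G. indicator {G. real (vertex_degree G b) < D} G \<partial>pa_one \<delta> t)" by simp
  also have "\<dots> \<le> (\<integral>\<^sup>+G. ennreal (D + \<delta>) * ennreal (1 / weight \<delta> G b) \<partial>pa_one \<delta> t)"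
  proof (rule nn_integral_mono_AE, unfold AE_measure_pmf_iff, rule ballI)
    fix G assume G: "G \<in> set_pmf (pa_one \<delta> t)"
    have "length G = t" using pa_one_invariant(1)[OF _ G] \<delta> by simp
    then have w: "weight \<delta> G b = real (vertex_degree G b) + \<delta>" using assms by (simp add: weight_def)
    have w1: "1 \<le> weight \<delta> G b" by (rule weight_ge_1[OF G])
    have "1 \<le> (D + \<delta>) * (1 / weight \<delta> G b)" if "real (vertex_degree G b) < D"
      using that w w1 by (simp add: field_simps)
    then show "indicator {G. real (vertex_degree G b) < D} G \<le> ennreal (D + \<delta>) * ennreal (1 / weight \<delta> G b)"
      using True \<delta> w1 by (auto simp: indicator_def ennreal_mult'[symmetric] simp del: ennreal_plus)
  qed
  also have "\<dots> = ennreal (D + \<delta>) * (\<integral>\<^sup>+G. ennreal (1 / weight \<delta> G b) \<partial>pa_one \<delta> t)"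
    by (rule nn_integral_cmult) simp
  also have "\<dots> \<le> ennreal (D + \<delta>) * ennreal (((real b + 1) / (real t + 1)) powr (1 / (2 * (2 + \<delta>))))"
    by (intro mult_left_mono expectation_inverse_weight_le assms) simp
  finally show ?thesis using True \<delta>
    by (simp add: measure_pmf.emeasure_eq_measure ennreal_mult'[symmetric] del: ennreal_plus)
qed

end

section \<open>Joint probability of given edges\<close>

text \<open>Squared and cleared of denominators, the two sides differ by the constant 1/4. The shift
  by 1/4 under the root is what makes the product below telescope.\<close>

lemma sqrt_bound_step: "(1 + 1 / (2 * real n + 1)) * sqrt (real n + 1 / 4) \<le> sqrt (real n + 5 / 4)"
proof -
  let ?r = "1 + 1 / (2 * real n + 1)"
  have "(2 * real n + 2)^2 * (real n + 1 / 4) \<le> (real n + 5 / 4) * (2 * real n + 1)^2"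
    by (simp add: power2_eq_square algebra_simps)
  moreover have "?r = (2 * real n + 2) / (2 * real n + 1)" by (simp add: field_simps)
  ultimately have "?r^2 * (real n + 1 / 4) \<le> real n + 5 / 4"
    by (simp add: power_divide divide_le_eq add_nonneg_pos)
  then have "sqrt (?r^2 * (real n + 1 / 4)) \<le> sqrt (real n + 5 / 4)" by (rule real_sqrt_le_mono)
  then show ?thesis by (simp add: real_sqrt_mult)
qed

text \<open>Telescopes by \<open>sqrt_bound_step\<close>; the factor 2 comes from
  \<open>(b - 1) + 1 / 4 \<ge> b / 4\<close>.\<close>

lemma prod_growth_le:
  assumes "1 \<le> b" "b \<le> Suc n"
  shows "(\<Prod>s\<in>{b - 1..<n}. 1 + 1 / (2 * real s + 1)) \<le> 2 * sqrt ((real n + 1) / real b)"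
proof -
  obtain a where a: "b = Suc a" using assms by (cases b) auto
  have "a \<le> n" using assms a by simp
  then have "(\<Prod>s\<in>{a..<n}. 1 + 1 / (2 * real s + 1)) * sqrt (real a + 1 / 4) \<le> sqrt (real n + 1 / 4)"
  proof (induction n rule: dec_induct)
    case (step n)
    have "(\<Prod>s\<in>{a..<Suc n}. 1 + 1 / (2 * real s + 1)) * sqrt (real a + 1 / 4) =
       (1 + 1 / (2 * real n + 1)) * ((\<Prod>s\<in>{a..<n}. 1 + 1 / (2 * real s + 1)) * sqrt (real a + 1 / 4))"
      using step by (simp add: prod.atLeastLessThan_Suc)
    also have "\<dots> \<le> (1 + 1 / (2 * real n + 1)) * sqrt (real n + 1 / 4)"
      using step by (intro mult_left_mono) auto
    also have "\<dots> \<le> sqrt (real n + 5 / 4)" by (rule sqrt_bound_step)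
    finally show ?case by (simp add: algebra_simps)
  qed simp
  then have "(\<Prod>s\<in>{a..<n}. 1 + 1 / (2 * real s + 1)) \<le> sqrt (real n + 1 / 4) / sqrt (real a + 1 / 4)"
    by (simp add: pos_le_divide_eq)
  also have "\<dots> = sqrt ((real n + 1 / 4) / (real a + 1 / 4))" by (simp add: real_sqrt_divide)
  also have "\<dots> \<le> sqrt (4 * ((real n + 1) / real b))"
  proof (rule real_sqrt_le_mono)
    have "(real n + 1 / 4) / (real a + 1 / 4) \<le> (real n + 1) / (real b / 4)"
      using a by (intro frac_le) auto
    then show "(real n + 1 / 4) / (real a + 1 / 4) \<le> 4 * ((real n + 1) / real b)" by (simp add: algebra_simps)
  qed
  also have "\<dots> = 2 * sqrt ((real n + 1) / real b)" by (simp only: real_sqrt_mult real_sqrt_four)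
  finally show ?thesis using a by simp
qed

lemma pochhammer_le_power:
  fixes x :: real
  assumes "0 \<le> x" shows "pochhammer x c \<le> (x + real c) ^ c"
proof -
  have "pochhammer x c = (\<Prod>i<c. x + real i)" by (simp add: pochhammer_prod atLeast0LessThan)
  also have "\<dots> \<le> (\<Prod>i<c. x + real c)" using assms by (intro prod_mono) auto
  finally show ?thesis by simp
qed

text \<open>Given the targets of the edges in \<open>A\<close> that are still to be revealed, the product over the target
  vertices of the rising factorials of their weights has exactly computable drift: this is the
  Polya urn structure of the attachment rule.\<close>

definition pending :: "nat set \<Rightarrow> (nat \<Rightarrow> nat) \<Rightarrow> nat \<Rightarrow> nat \<Rightarrow> nat" where
  "pending A g t b = card {n\<in>A. t \<le> n \<and> g n = b}"

definition urn_potential :: "real \<Rightarrow> nat set \<Rightarrow> (nat \<Rightarrow> nat) \<Rightarrow> nat \<Rightarrow> multigraph \<Rightarrow> real" where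
  "urn_potential \<delta> A g t G = (if \<forall>n\<in>A. n < t \<longrightarrow> snd (G ! n) = g n then 1 else 0) *
     (\<Prod>b\<in>g ` A. pochhammer (weight \<delta> G b) (pending A g t b))"

text \<open>Expected factor of the potential at step \<open>t\<close>, before division by the total
  weight. Position \<open>t\<close> carries the edge of vertex \<open>t + 1\<close>, so
  \<open>g n \<le> t + 1\<close> says that the target of the pending edge \<open>n\<close> is
  present or just arriving; each such edge raises the effective weight by 1. At a step of
  \<open>A\<close> the weight of the target passes into the rising factorial and 1 remains.\<close>

definition growth :: "real \<Rightarrow> nat set \<Rightarrow> (nat \<Rightarrow> nat) \<Rightarrow> nat \<Rightarrow> real" where
  "growth \<delta> A g t = (if t \<in> A then 1 else total_weight \<delta> t + real (card {n\<in>A. t < n \<and> g n \<le> t + 1}))"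

context
  fixes \<delta> :: real and A :: "nat set" and g :: "nat \<Rightarrow> nat"
  assumes \<delta>: "0 \<le> \<delta>" and fin: "finite A" and g: "\<And>n. n \<in> A \<Longrightarrow> 1 \<le> g n \<and> g n \<le> n + 1"
begin

text \<open>\<open>w * pochhammer (w + 1) c\<close> equals \<open>pochhammer w (c + 1)\<close>,
  which serves a step of \<open>A\<close>, and also \<open>(w + c) * pochhammer w c\<close>, which
  serves the others; there the sum of all \<open>w + c\<close> is the total weight plus the number
  of pending edges counted in \<open>growth\<close>.\<close>

lemma urn_potential_drift:
  assumes G: "G \<in> set_pmf (pa_one \<delta> t)"
  shows "(\<Sum>i=1..t + 1. weight \<delta> G i * urn_potential \<delta> A g (Suc t) (G @ [(t + 1, i)])) \<le> growth \<delta> A g t * urn_potential \<delta> A g t G"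
proof -
  let ?T = "\<lambda>i. weight \<delta> G i * urn_potential \<delta> A g (Suc t) (G @ [(t + 1, i)])"
  define w where "w = weight \<delta> G"
  have w: "1 \<le> w b" for b unfolding w_def by (rule weight_ge_1[OF \<delta> G])
  have poch: "0 < pochhammer (w b) c" for b c using w[of b] by (intro pochhammer_pos) simp
  have len: "length G = t" using pa_one_invariant(1)[OF _ G] \<delta> by simp
  define ok where "ok = (if \<forall>n\<in>A. n < t \<longrightarrow> snd (G ! n) = g n then 1 else 0 :: real)"
  have ok: "0 \<le> ok" by (simp add: ok_def)
  define P where "P = (\<Prod>b\<in>g ` A. pochhammer (w b) (pending A g t b))"
  have P: "0 \<le> P" unfolding P_def by (intro prod_nonneg) (use poch in \<open>auto intro: less_imp_le\<close>)
  have pot: "urn_potential \<delta> A g t G = ok * P" by (simp add: urn_potential_def ok_def P_def w_def)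
  have pot': "urn_potential \<delta> A g (Suc t) (G @ [(t + 1, i)]) =
      (if t \<in> A \<and> g t \<noteq> i then 0 else ok) *
      (\<Prod>b\<in>g ` A. pochhammer (w b + (if b = i then 1 else 0)) (pending A g (Suc t) b))"
    if i: "i \<in> {1..t + 1}" for i
  proof -
    have "(\<forall>n\<in>A. n < Suc t \<longrightarrow> snd ((G @ [(t + 1, i)]) ! n) = g n) \<longleftrightarrow>
        (\<forall>n\<in>A. n < t \<longrightarrow> snd (G ! n) = g n) \<and> (t \<in> A \<longrightarrow> i = g t)"
      using len by (auto simp: nth_append less_Suc_eq)
    then show ?thesis unfolding urn_potential_def weight_append[OF \<delta> G i] w_def ok_def by auto
  qed
  show ?thesis
  proof (cases "t \<in> A")
    case True
    define b where "b = g t"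
    let ?U = "\<Prod>b'\<in>g ` A. pochhammer (w b' + (if b' = b then 1 else 0)) (pending A g (Suc t) b')"
    have b: "b \<in> {1..t + 1}" "b \<in> g ` A" using g[OF True] True by (auto simp: b_def)
    have pend: "pending A g t b' = pending A g (Suc t) b' + (if b' = b then 1 else 0)" for b'
    proof -
      have "{n\<in>A. t \<le> n \<and> g n = b'} = {n\<in>A. Suc t \<le> n \<and> g n = b'} \<union> (if b' = b then {t} else {})"
        using True by (auto simp: b_def Suc_le_eq le_eq_less_or_eq)
      then show ?thesis unfolding pending_def using fin by (auto simp: card_insert_if)
    qed
    have "(\<Sum>i=1..t + 1. ?T i) =
        (\<Sum>i=1..t + 1. if i = b then ok * (w b * ?U) else 0)"
    proof (intro sum.cong refl)
      fix i assume i: "i \<in> {1..t + 1}"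
      show "?T i =
        (if i = b then ok * (w b * ?U) else 0)"
        unfolding pot'[OF i] using True by (auto simp: w_def b_def)
    qed
    also have "\<dots> = ok * (w b * ?U)"
      using b by (subst sum.delta) auto
    also have "w b * ?U = P"
    proof -
      have "?U =
        pochhammer (w b + 1) (pending A g (Suc t) b) * (\<Prod>b'\<in>g ` A - {b}. pochhammer (w b') (pending A g t b'))"
        using b fin by (subst prod.remove[of _ b]) (auto simp: pend intro!: prod.cong)
      moreover have "P = pochhammer (w b) (pending A g t b) * (\<Prod>b'\<in>g ` A - {b}. pochhammer (w b') (pending A g t b'))"
        unfolding P_def using b fin by (subst prod.remove[of _ b]) auto
      ultimately show ?thesis by (simp add: pend[of b] pochhammer_rec)
    qed
    finally show ?thesis using True by (simp add: pot growth_def)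
  next
    case False
    have pend: "pending A g (Suc t) b = pending A g t b" for b
      unfolding pending_def using False by (intro arg_cong[where f = card]) (auto simp: Suc_le_eq le_eq_less_or_eq)
    have drift: "?T i = (w i + real (pending A g t i)) * (ok * P)"
      if i: "i \<in> {1..t + 1}" for i
    proof (cases "i \<in> g ` A")
      case True
      have "(\<Prod>b\<in>g ` A. pochhammer (w b + (if b = i then 1 else 0)) (pending A g t b)) =
        pochhammer (w i + 1) (pending A g t i) * (\<Prod>b\<in>g ` A - {i}. pochhammer (w b) (pending A g t b))"
        using True fin by (subst prod.remove[of _ i]) (auto intro!: prod.cong)
      moreover have "P = pochhammer (w i) (pending A g t i) * (\<Prod>b\<in>g ` A - {i}. pochhammer (w b) (pending A g t b))"
        unfolding P_def using True fin by (subst prod.remove[of _ i]) auto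
      moreover have "w i * pochhammer (w i + 1) (pending A g t i) = (w i + real (pending A g t i)) * pochhammer (w i) (pending A g t i)"
        using pochhammer_rec[of "w i" "pending A g t i"] pochhammer_Suc[of "w i" "pending A g t i"] by (simp add: mult.commute)
      ultimately show ?thesis unfolding pot'[OF i] pend using False by (simp add: w_def mult_ac)
    next
      case noti: False
      then have "{n\<in>A. t \<le> n \<and> g n = i} = {}" by auto
      then have "pending A g t i = 0" unfolding pending_def by (simp only: card.empty)
      moreover have "(\<Prod>b\<in>g ` A. pochhammer (w b + (if b = i then 1 else 0)) (pending A g t b)) = P"
        unfolding P_def using noti by (intro prod.cong) auto
      ultimately show ?thesis unfolding pot'[OF i] pend using False by (simp add: w_def)
    qed
    have "(\<Sum>i=1..t + 1. ?T i) =
        (\<Sum>i=1..t + 1. w i + real (pending A g t i)) * (ok * P)"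
      unfolding sum_distrib_right by (intro sum.cong refl drift)
    also have "(\<Sum>i=1..t + 1. w i + real (pending A g t i)) = total_weight \<delta> t + real (\<Sum>i=1..t + 1. pending A g t i)"
      using sum_weight[OF \<delta> G] by (simp add: sum.distrib w_def del: sum.cl_ivl_Suc)
    also have "(\<Sum>i=1..t + 1. pending A g t i) = card (\<Union>i\<in>{1..t + 1}. {n\<in>A. t \<le> n \<and> g n = i})"
      unfolding pending_def using fin by (subst card_UN_disjoint) auto
    also have "(\<Union>i\<in>{1..t + 1}. {n\<in>A. t \<le> n \<and> g n = i}) = {n\<in>A. t < n \<and> g n \<le> t + 1}"
      using False g by (auto simp: le_eq_less_or_eq)
    finally show ?thesis using False by (simp add: pot growth_def)
  qed
qed

lemma growth_nonneg: "0 \<le> growth \<delta> A g t"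
  using total_weight_pos[OF \<delta>, of t] by (simp add: growth_def)

lemma urn_potential_nonneg:
  assumes "G \<in> set_pmf (pa_one \<delta> t)" shows "0 \<le> urn_potential \<delta> A g s G"
  unfolding urn_potential_def
proof (intro mult_nonneg_nonneg prod_nonneg ballI)
  fix b show "0 \<le> pochhammer (weight \<delta> G b) (pending A g s b)"
    using weight_ge_1[OF \<delta> assms, of b] by (intro pochhammer_nonneg) simp
qed auto

lemma expectation_urn_potential_le:
  "(\<integral>\<^sup>+G. ennreal (urn_potential \<delta> A g t G) \<partial>pa_one \<delta> t) \<le>
     ennreal (urn_potential \<delta> A g 0 [] * (\<Prod>s<t. growth \<delta> A g s / total_weight \<delta> s))"
proof (induction t)
  case (Suc t)
  let ?r = "growth \<delta> A g t / total_weight \<delta> t"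
  have r: "0 \<le> ?r" using growth_nonneg total_weight_pos[OF \<delta>] by (simp add: less_imp_le)
  have "(\<integral>\<^sup>+G. ennreal (urn_potential \<delta> A g (Suc t) G) \<partial>pa_one \<delta> (Suc t)) =
      (\<integral>\<^sup>+G. ennreal (max 0 (urn_potential \<delta> A g (Suc t) G)) \<partial>pa_one \<delta> (Suc t))"
    using urn_potential_nonneg by (intro nn_integral_cong_AE) (auto simp: AE_measure_pmf_iff max_def simp del: pa_one.simps)
  also have "\<dots> \<le> ennreal ?r * (\<integral>\<^sup>+G. ennreal (urn_potential \<delta> A g t G) \<partial>pa_one \<delta> t)"
  proof (rule pa_one_supermartingale_step[OF \<delta>])
    fix G assume G: "G \<in> set_pmf (pa_one \<delta> t)"
    show "0 \<le> urn_potential \<delta> A g t G" by (rule urn_potential_nonneg[OF G])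
    have "(\<Sum>i=1..t + 1. weight \<delta> G i * max 0 (urn_potential \<delta> A g (Suc t) (G @ [(t + 1, i)]))) =
        (\<Sum>i=1..t + 1. weight \<delta> G i * urn_potential \<delta> A g (Suc t) (G @ [(t + 1, i)]))"
    proof (intro sum.cong refl)
      fix i assume i: "i \<in> {1..t + 1}"
      have "1 \<le> weight \<delta> G i" by (rule weight_ge_1[OF \<delta> G])
      then have "i \<in> set_pmf (attach_pmf \<delta> t G)"
        using i total_weight_pos[OF \<delta>, of t] by (subst set_pmf_iff) (simp add: pmf_attach_weight[OF \<delta> G])
      then have "G @ [(t + 1, i)] \<in> set_pmf (pa_one \<delta> (Suc t))" using G by auto
      then have "0 \<le> urn_potential \<delta> A g (Suc t) (G @ [(t + 1, i)])" by (rule urn_potential_nonneg)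
      then show "weight \<delta> G i * max 0 (urn_potential \<delta> A g (Suc t) (G @ [(t + 1, i)])) =
         weight \<delta> G i * urn_potential \<delta> A g (Suc t) (G @ [(t + 1, i)])" by simp
    qed
    then show "(\<Sum>i=1..t + 1. weight \<delta> G i * max 0 (urn_potential \<delta> A g (Suc t) (G @ [(t + 1, i)]))) \<le> growth \<delta> A g t * urn_potential \<delta> A g t G"
      using urn_potential_drift[OF G] by simp
  qed (use growth_nonneg in auto)
  also have "\<dots> \<le> ennreal ?r * ennreal (urn_potential \<delta> A g 0 [] * (\<Prod>s<t. growth \<delta> A g s / total_weight \<delta> s))"
    by (intro mult_left_mono Suc.IH) simp
  also have "\<dots> = ennreal (urn_potential \<delta> A g 0 [] * (\<Prod>s<Suc t. growth \<delta> A g s / total_weight \<delta> s))"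
    using r by (subst ennreal_mult'[symmetric]) (auto simp: mult_ac)
  finally show ?case .
qed simp

text \<open>Bernoulli's inequality splits \<open>1 + c / Z\<close> into one factor per pending edge,
  with \<open>Z \<ge> 2 s + 1\<close>. Estimating \<open>Z\<close> without \<delta> is what leaves
  the exponent 1/2 for every \<delta> \<ge> 0.\<close>

lemma growth_ratio_le:
  "growth \<delta> A g s / total_weight \<delta> s \<le> (\<Prod>n\<in>A. (if n = s then 1 / (real n + 1) else 1) *
      (if s \<in> {g n - 1..<n} then 1 + 1 / (2 * real s + 1) else 1))"
proof -
  let ?Z = "total_weight \<delta> s" and ?q = "1 + 1 / (2 * real s + 1)"
  have Z: "2 * real s + 1 \<le> ?Z" by (rule total_weight_ge[OF \<delta>])
  let ?C = "{n\<in>A. s < n \<and> g n \<le> s + 1}"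
  have q: "(\<Prod>n\<in>A. if s \<in> {g n - 1..<n} then ?q else 1) = ?q ^ card ?C"
  proof -
    have "{n \<in> A. s \<in> {g n - 1..<n}} = ?C" by auto
    then have "(\<Prod>n\<in>A. if s \<in> {g n - 1..<n} then ?q else 1) = (\<Prod>n\<in>?C. ?q)"
      by (simp only: prod.inter_filter[OF fin, symmetric])
    then show ?thesis by simp
  qed
  have q1: "1 \<le> ?q ^ card ?C" by (intro one_le_power) simp
  show ?thesis
  proof (cases "s \<in> A")
    case True
    have "1 / ?Z \<le> 1 / (real s + 1)" using Z by (intro divide_left_mono mult_pos_pos) linarith+
    also have "\<dots> \<le> 1 / (real s + 1) * ?q ^ card ?C"
      using mult_left_mono[OF q1, of "1 / (real s + 1)"] by simp
    also have "1 / (real s + 1) = (\<Prod>n\<in>A. if n = s then 1 / (real n + 1) else 1)"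
      using True fin by (subst prod.delta) auto
    finally show ?thesis using True unfolding prod.distrib q by (simp add: growth_def)
  next
    case False
    have "growth \<delta> A g s / ?Z = 1 + real (card ?C) * (1 / ?Z)"
      using False total_weight_pos[OF \<delta>, of s] by (simp add: growth_def field_simps)
    also have "\<dots> \<le> 1 + real (card ?C) * (1 / (2 * real s + 1))"
    proof (intro add_left_mono mult_left_mono)
      show "1 / ?Z \<le> 1 / (2 * real s + 1)" by (rule frac_le) (use Z in auto)
    qed simp
    also have "\<dots> \<le> ?q ^ card ?C" by (rule Bernoulli_inequality) (simp add: order_trans[of "-1" 0])
    also have "\<dots> = (\<Prod>n\<in>A. if n = s then 1 / (real n + 1) else 1) * ?q ^ card ?C"
    proof -
      have "(\<Prod>n\<in>A. if n = s then 1 / (real n + 1) else 1) = (\<Prod>n\<in>A. 1)"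
        using False by (intro prod.cong) auto
      then show ?thesis by simp
    qed
    finally show ?thesis unfolding prod.distrib q .
  qed
qed

text \<open>At time \<open>N\<close> nothing is pending and the potential is the indicator of the
  event. Its initial value is at most \<open>(1 + \<delta> + card A) ^ card A\<close>. An edge from
  \<open>n + 1\<close> to \<open>g n\<close> collects \<open>1 / (n + 1)\<close> at its own step and
  at most \<open>2 * sqrt ((n + 1) / g n)\<close> while pending.\<close>

lemma prob_edges_le:
  assumes N: "A \<subseteq> {..<N}"
  shows "measure_pmf.prob (pa_one \<delta> N) {G. \<forall>n\<in>A. snd (G ! n) = g n} \<le>
    (2 * (1 + \<delta> + real (card A))) ^ card A * (\<Prod>n\<in>A. 1 / sqrt ((real n + 1) * real (g n)))"
proof -
  have "{n\<in>A. N \<le> n \<and> g n = b} = {}" for b using N by fastforce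
  then have pend0: "pending A g N b = 0" for b unfolding pending_def by (simp only: card.empty)
  have "emeasure (pa_one \<delta> N) {G. \<forall>n\<in>A. snd (G ! n) = g n} = (\<integral>\<^sup>+G. indicator {G. \<forall>n\<in>A. snd (G ! n) = g n} G \<partial>pa_one \<delta> N)"
    by simp
  also have "\<dots> = (\<integral>\<^sup>+G. ennreal (urn_potential \<delta> A g N G) \<partial>pa_one \<delta> N)"
    using N by (intro nn_integral_cong) (auto simp: urn_potential_def pend0 indicator_def)
  also have "\<dots> \<le> ennreal (urn_potential \<delta> A g 0 [] * (\<Prod>s<N. growth \<delta> A g s / total_weight \<delta> s))"
    by (rule expectation_urn_potential_le)
  also have "\<dots> \<le> ennreal ((1 + \<delta> + real (card A)) ^ card A * (\<Prod>n\<in>A. 2 * (1 / sqrt ((real n + 1) * real (g n)))))"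
  proof (intro ennreal_leI mult_mono)
    show "0 \<le> (\<Prod>s<N. growth \<delta> A g s / total_weight \<delta> s)"
      using growth_nonneg total_weight_pos[OF \<delta>] by (intro prod_nonneg) (simp add: less_imp_le)
    show "0 \<le> (1 + \<delta> + real (card A)) ^ card A" using \<delta> by simp
    have "urn_potential \<delta> A g 0 [] = (\<Prod>b\<in>g ` A. pochhammer (1 + \<delta>) (pending A g 0 b))"
      by (simp add: urn_potential_def weight_def)
    also have "\<dots> \<le> (\<Prod>b\<in>g ` A. (1 + \<delta> + real (card A)) ^ pending A g 0 b)"
    proof (intro prod_mono conjI)
      fix b
      show "0 \<le> pochhammer (1 + \<delta>) (pending A g 0 b)" using \<delta> by (intro pochhammer_nonneg) simp
      have "pending A g 0 b \<le> card A" unfolding pending_def using fin by (intro card_mono) auto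
      then show "pochhammer (1 + \<delta>) (pending A g 0 b) \<le> (1 + \<delta> + real (card A)) ^ pending A g 0 b"
        using \<delta> by (intro order_trans[OF pochhammer_le_power] power_mono) auto
    qed
    also have "\<dots> = (1 + \<delta> + real (card A)) ^ (\<Sum>b\<in>g ` A. pending A g 0 b)" by (simp add: power_sum)
    also have "(\<Sum>b\<in>g ` A. pending A g 0 b) = card A"
      using sum.image_gen[OF fin, of "\<lambda>_. 1 :: nat" g] by (simp add: pending_def)
    finally show "urn_potential \<delta> A g 0 [] \<le> (1 + \<delta> + real (card A)) ^ card A" .
    have "(\<Prod>s<N. growth \<delta> A g s / total_weight \<delta> s) \<le> (\<Prod>s<N. \<Prod>n\<in>A. (if n = s then 1 / (real n + 1) else 1) *
      (if s \<in> {g n - 1..<n} then 1 + 1 / (2 * real s + 1) else 1))"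
      using growth_ratio_le growth_nonneg total_weight_pos[OF \<delta>] by (intro prod_mono) (simp add: less_imp_le)
    also have "\<dots> = (\<Prod>n\<in>A. (\<Prod>s<N. if n = s then 1 / (real n + 1) else 1) *
      (\<Prod>s<N. if s \<in> {g n - 1..<n} then 1 + 1 / (2 * real s + 1) else 1))"
      by (subst prod.swap) (simp add: prod.distrib)
    also have "\<dots> \<le> (\<Prod>n\<in>A. 2 * (1 / sqrt ((real n + 1) * real (g n))))"
    proof (intro prod_mono conjI)
      fix n assume n: "n \<in> A"
      have gn: "1 \<le> g n" "g n \<le> Suc n" using g[OF n] by auto
      show "0 \<le> (\<Prod>s<N. if n = s then 1 / (real n + 1) else 1) * (\<Prod>s<N. if s \<in> {g n - 1..<n} then 1 + 1 / (2 * real s + 1) else 1)"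
        by (intro mult_nonneg_nonneg prod_nonneg) auto
      have "(\<Prod>s<N. if n = s then 1 / (real n + 1) else 1) = 1 / (real n + 1)"
        using N n by (subst prod.delta') auto
      moreover have "(\<Prod>s<N. if s \<in> {g n - 1..<n} then 1 + 1 / (2 * real s + 1) else 1) = (\<Prod>s\<in>{g n - 1..<n}. 1 + 1 / (2 * real s + 1))"
      proof -
        have "{s \<in> {..<N}. s \<in> {g n - 1..<n}} = {g n - 1..<n}" using N n by auto
        then show ?thesis by (simp only: prod.inter_filter[OF finite_lessThan, symmetric])
      qed
      moreover have "1 / (real n + 1) * (2 * sqrt ((real n + 1) / real (g n))) = 2 * (1 / sqrt ((real n + 1) * real (g n)))"
      proof -
        define x y where "x = sqrt (real n + 1)" and "y = sqrt (real (g n))"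
        have xy: "0 < x" "0 < y" "real n + 1 = x * x" using gn by (auto simp: x_def y_def)
        have "sqrt ((real n + 1) / real (g n)) = x / y" "sqrt ((real n + 1) * real (g n)) = x * y"
          by (simp_all add: x_def y_def real_sqrt_divide real_sqrt_mult)
        then show ?thesis using xy by simp
      qed
      ultimately show "(\<Prod>s<N. if n = s then 1 / (real n + 1) else 1) * (\<Prod>s<N. if s \<in> {g n - 1..<n} then 1 + 1 / (2 * real s + 1) else 1)
        \<le> 2 * (1 / sqrt ((real n + 1) * real (g n)))"
        using mult_left_mono[OF prod_growth_le[OF gn], of "1 / (real n + 1)"] by simp
    qed
    finally show "(\<Prod>s<N. growth \<delta> A g s / total_weight \<delta> s) \<le> (\<Prod>n\<in>A. 2 * (1 / sqrt ((real n + 1) * real (g n))))" .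
  qed
  also have "(1 + \<delta> + real (card A)) ^ card A * (\<Prod>n\<in>A. 2 * (1 / sqrt ((real n + 1) * real (g n)))) =
     (2 * (1 + \<delta> + real (card A))) ^ card A * (\<Prod>n\<in>A. 1 / sqrt ((real n + 1) * real (g n)))"
    by (simp only: prod.distrib power_mult_distrib prod_constant mult_ac)
  finally show ?thesis using \<delta> by (simp add: measure_pmf.emeasure_eq_measure prod_nonneg)
qed

end

section \<open>First moment over dense edge sets\<close>

text \<open>Fill in one coordinate at a time. A new vertex \<open>q a\<close> brings the factor
  \<open>u (q a)\<close>; a vertex already in the image brings none, but at most
  \<open>M * card I\<close> choices of \<open>a\<close> lead to one.\<close>

lemma sum_prod_image_le:
  fixes u :: "'w \<Rightarrow> real" and q :: "'v \<Rightarrow> 'w"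
  assumes "finite I" "finite V" "\<And>w. 0 \<le> u w" "\<And>w. card {a\<in>V. q a = w} \<le> M"
  shows "(\<Sum>z\<in>I \<rightarrow>\<^sub>E V. \<Prod>v\<in>(\<lambda>i. q (z i)) ` I. u v) \<le> (real M * real (card I) + (\<Sum>a\<in>V. u (q a))) ^ card I"
proof -
  define U where "U = (\<Sum>a\<in>V. u (q a))"
  have U: "0 \<le> U" using assms(3) by (auto simp: U_def intro: sum_nonneg)
  \<comment> \<open>A fixed bound \<open>n\<close> on the size keeps the base of the power constant
    in the induction.\<close>
  have "(\<Sum>z\<in>I \<rightarrow>\<^sub>E V. \<Prod>v\<in>(\<lambda>i. q (z i)) ` I. u v) \<le> (real M * real n + U) ^ card I" if "card I \<le> n" for n
    using assms(1) that
  proof (induction I)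
    case (insert i I)
    let ?F = "I \<rightarrow>\<^sub>E V"
    let ?R = "\<lambda>z. (\<lambda>i. q (z i)) ` I"
    let ?P = "\<lambda>z. \<Prod>v\<in>?R z. u v"
    have finF: "finite ?F" using insert assms(2) by (intro finite_PiE) auto
    have img: "(\<lambda>j. q ((z(i := a)) j)) ` insert i I = insert (q a) (?R z)" for z a
      using insert.hyps(2) by auto
    have "(\<Sum>z\<in>insert i I \<rightarrow>\<^sub>E V. \<Prod>v\<in>(\<lambda>i. q (z i)) ` insert i I. u v) =
        (\<Sum>(a, z)\<in>V \<times> ?F. \<Prod>v\<in>insert (q a) (?R z). u v)"
      unfolding PiE_insert_eq
      by (subst sum.reindex[OF inj_combinator[OF insert.hyps(2)]])
        (auto simp: img case_prod_unfold simp del: fun_upd_apply image_insert intro!: sum.cong)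
    also have "\<dots> = (\<Sum>z\<in>?F. \<Sum>a\<in>V. \<Prod>v\<in>insert (q a) (?R z). u v)"
      using assms(2) finF by (simp add: sum.cartesian_product[symmetric] sum.swap[of _ V])
    also have "\<dots> \<le> (\<Sum>z\<in>?F. (real M * real n + U) * ?P z)"
    proof (rule sum_mono)
      fix z assume "z \<in> ?F"
      have P: "0 \<le> ?P z" using assms(3) by (intro prod_nonneg) auto
      have "(\<Sum>a\<in>V. \<Prod>v\<in>insert (q a) (?R z). u v) \<le> (\<Sum>a\<in>V. ((if q a \<in> ?R z then 1 else 0) + u (q a)) * ?P z)"
      proof (rule sum_mono)
        fix a
        show "(\<Prod>v\<in>insert (q a) (?R z). u v) \<le> ((if q a \<in> ?R z then 1 else 0) + u (q a)) * ?P z"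
        proof (cases "q a \<in> ?R z")
          case True
          then have "insert (q a) (?R z) = ?R z" by auto
          then show ?thesis using True P assms(3)[of "q a"] by (simp add: distrib_right)
        next
          case False
          then show ?thesis using insert.hyps(1) by simp
        qed
      qed
      also have "\<dots> = ((\<Sum>a\<in>V. if q a \<in> ?R z then 1 else 0) + U) * ?P z"
        unfolding sum_distrib_right[symmetric] sum.distrib U_def ..
      also have "(\<Sum>a\<in>V. if q a \<in> ?R z then 1 else 0) = real (card {a\<in>V. q a \<in> ?R z})"
        using assms(2) by (simp add: sum.If_cases Int_def)
      also have "\<dots> \<le> real M * real n"
      proof -
        have "{a\<in>V. q a \<in> ?R z} = (\<Union>w\<in>?R z. {a\<in>V. q a = w})" by auto
        then have "card {a\<in>V. q a \<in> ?R z} \<le> (\<Sum>w\<in>?R z. card {a\<in>V. q a = w})"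
          using insert.hyps(1) by (simp only: card_UN_le finite_imageI)
        also have "\<dots> \<le> (\<Sum>w\<in>?R z. M)" by (intro sum_mono assms(4))
        also have "\<dots> = M * card (?R z)" by simp
        also have "\<dots> \<le> M * n"
          using insert by (intro mult_left_mono order_trans[OF card_image_le]) auto
        finally show ?thesis by (metis of_nat_le_iff of_nat_mult)
      qed
      finally show "(\<Sum>a\<in>V. \<Prod>v\<in>insert (q a) (?R z). u v) \<le> (real M * real n + U) * ?P z"
        using P by (simp add: mult_right_mono)
    qed
    also have "\<dots> = (real M * real n + U) * (\<Sum>z\<in>?F. ?P z)" by (rule sum_distrib_left[symmetric])
    also have "\<dots> \<le> (real M * real n + U) * (real M * real n + U) ^ card I"
      using insert U by (intro mult_left_mono) auto
    finally show ?case using insert by simp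
  qed simp
  then show ?thesis unfolding U_def by blast
qed

lemma sum_inverse_le_ln: "1 \<le> n \<Longrightarrow> (\<Sum>a=1..n. 1 / real a) \<le> 1 + ln (real n)"
proof (induction n rule: dec_induct)
  case (step n)
  have "ln (real n / real (Suc n)) \<le> real n / real (Suc n) - 1" using step by (intro ln_le_minus_one) auto
  also have "\<dots> = - (1 / real (Suc n))" by (simp add: field_simps)
  also have "ln (real n / real (Suc n)) = ln (real n) - ln (real (Suc n))" using step by (simp add: ln_div)
  finally show ?case using step by simp
qed simp

section \<open>Vertices and edge-ends under contraction\<close>

definition contract_vertex :: "nat \<Rightarrow> nat \<Rightarrow> nat" where
  "contract_vertex m a = (a - 1) div m + 1"

lemma endpoint_contract:
  "fst e < length G \<Longrightarrow> endpoint (contract m G) e = contract_vertex m (endpoint G e)"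
  by (simp add: endpoint_def contract_def contract_vertex_def)

lemma length_contract [simp]: "length (contract m G) = length G"
  by (simp add: contract_def)

lemma contract_vertex_bounds:
  assumes "1 \<le> m" "1 \<le> a"
  shows "1 \<le> contract_vertex m a" "contract_vertex m a \<le> a" "real a / real m \<le> real (contract_vertex m a)"
proof -
  show "1 \<le> contract_vertex m a" by (simp add: contract_vertex_def)
  have "(a - 1) div m \<le> a - 1" by simp
  then have "(a - 1) div m + 1 \<le> a" using assms(2) by linarith
  then show "contract_vertex m a \<le> a" unfolding contract_vertex_def .
  have "a - 1 < m * contract_vertex m a"
    using assms(1) dividend_less_times_div[of m "a - 1"] by (simp add: contract_vertex_def)
  then have "a \<le> m * contract_vertex m a" by linarith
  then have "real a \<le> real m * real (contract_vertex m a)" by (metis of_nat_le_iff of_nat_mult)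
  then show "real a / real m \<le> real (contract_vertex m a)" using assms by (simp add: divide_le_eq mult.commute)
qed

lemma contract_vertex_fibre:
  assumes "1 \<le> m" "1 \<le> v"
  shows "{a. 1 \<le> a \<and> contract_vertex m a = v} = {(v - 1) * m + 1..(v - 1) * m + m}"
proof (intro set_eqI iffI)
  fix a assume a: "a \<in> {a. 1 \<le> a \<and> contract_vertex m a = v}"
  then have "(a - 1) div m = v - 1" by (auto simp: contract_vertex_def)
  then have "(v - 1) * m + (a - 1) mod m = a - 1" using div_mult_mod_eq[of "a - 1" m] by simp
  moreover have "(a - 1) mod m < m" using assms by simp
  ultimately show "a \<in> {(v - 1) * m + 1..(v - 1) * m + m}" using a by auto
next
  fix a assume a: "a \<in> {(v - 1) * m + 1..(v - 1) * m + m}"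
  define r where "r = a - 1 - (v - 1) * m"
  have r: "a - 1 = (v - 1) * m + r" "r < m" using a unfolding r_def by auto
  then have "(a - 1) div m = v - 1" using assms by simp
  then show "a \<in> {a. 1 \<le> a \<and> contract_vertex m a = v}" using a assms by (auto simp: contract_vertex_def)
qed

lemma pa_one_edges:
  assumes "0 \<le> \<delta>" "G \<in> set_pmf (pa_one \<delta> t)" "n < t"
  shows "fst (G ! n) = n + 1 \<and> 1 \<le> snd (G ! n) \<and> snd (G ! n) \<le> n + 1"
  using assms(2,3)
proof (induction t arbitrary: G)
  case (Suc t)
  obtain H i where H: "H \<in> set_pmf (pa_one \<delta> t)" "i \<in> set_pmf (attach_pmf \<delta> t H)" "G = H @ [(t + 1, i)]"
    using Suc.prems(1) by auto
  have "length H = t" using pa_one_invariant(1)[OF _ H(1)] assms(1) by simp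
  moreover have "i \<in> {1..t + 1}"
    using H(2) pmf_attach_weight[OF assms(1) H(1), of i] by (auto simp: set_pmf_iff split: if_splits)
  ultimately show ?case using Suc.IH[OF H(1)] Suc.prems(2) H(3) by (cases "n = t") (auto simp: nth_append)
qed simp

text \<open>Grouped by value, a vertex \<open>w\<close> hit \<open>c \<ge> 2\<close> times
  contributes \<open>w powr (- c / 2) \<le> 1 / w\<close>. The third hit of \<open>v > K\<close>
  leaves a spare \<open>1 / sqrt v\<close>, and this is the whole gain of the first moment.\<close>

lemma prod_inverse_sqrt_le:
  fixes f :: "'i \<Rightarrow> nat"
  assumes fin: "finite I" and pos: "\<And>p. p \<in> I \<Longrightarrow> 1 \<le> f p"
    and two: "\<And>p. p \<in> I \<Longrightarrow> \<exists>p'\<in>I. p' \<noteq> p \<and> f p' = f p"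
    and three: "K < v" "3 \<le> card {p\<in>I. f p = v}" and K: "1 \<le> K"
  shows "(\<Prod>p\<in>I. 1 / sqrt (real (f p))) \<le> 1 / sqrt (real K) * (\<Prod>v\<in>f ` I. 1 / real v)"
proof -
  let ?c = "\<lambda>v. card {p\<in>I. f p = v}"
  have fin_img: "finite (f ` I)" using fin by simp
  have v: "v \<in> f ` I"
  proof -
    have "{p\<in>I. f p = v} \<noteq> {}" using three(2) by (intro notI) simp
    then show ?thesis by blast
  qed
  have le: "(1 / sqrt (real w)) ^ n \<le> 1 / real w" if "2 \<le> n" "w \<in> f ` I" for n w
  proof -
    have w: "1 \<le> real w" using pos that(2) by auto
    have "(1 / sqrt (real w)) ^ n \<le> (1 / sqrt (real w)) ^ 2" using that w by (intro power_decreasing) auto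
    also have "\<dots> = 1 / real w" using w by (simp add: power_divide)
    finally show ?thesis .
  qed
  have c2: "2 \<le> ?c w" if "w \<in> f ` I" for w
  proof -
    obtain p where p: "p \<in> I" "f p = w" using \<open>w \<in> f ` I\<close> by blast
    obtain p' where "p' \<in> I" "p' \<noteq> p" "f p' = w" using two[OF p(1)] p(2) by blast
    with p have "{p, p'} \<subseteq> {p\<in>I. f p = w}" "card {p, p'} = 2" by auto
    then show ?thesis using card_mono[of "{p\<in>I. f p = w}" "{p, p'}"] fin by simp
  qed
  have "(\<Prod>p\<in>I. 1 / sqrt (real (f p))) = (\<Prod>w\<in>f ` I. \<Prod>p\<in>{p\<in>I. f p = w}. 1 / sqrt (real (f p)))"
    by (rule prod.image_gen[OF fin])
  also have "\<dots> = (\<Prod>w\<in>f ` I. (1 / sqrt (real w)) ^ ?c w)"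
    by (intro prod.cong refl) simp
  also have "\<dots> = (1 / sqrt (real v)) ^ ?c v * (\<Prod>w\<in>f ` I - {v}. (1 / sqrt (real w)) ^ ?c w)"
    by (rule prod.remove[OF fin_img v])
  also have "\<dots> \<le> (1 / sqrt (real K) * (1 / real v)) * (\<Prod>w\<in>f ` I - {v}. 1 / real w)"
  proof (intro mult_mono prod_mono conjI prod_nonneg)
    have "(1 / sqrt (real v)) ^ ?c v \<le> (1 / sqrt (real v)) ^ 3"
      using three K by (intro power_decreasing) auto
    also have "\<dots> = 1 / sqrt (real v) * (1 / sqrt (real v)) ^ 2" by (simp add: eval_nat_numeral)
    also have "\<dots> \<le> 1 / sqrt (real K) * (1 / real v)"
      using three K le[of 2 v] v by (intro mult_mono) (auto simp: frac_le)
    finally show "(1 / sqrt (real v)) ^ ?c v \<le> 1 / sqrt (real K) * (1 / real v)" .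
  qed (use le c2 in auto)
  also have "\<dots> = 1 / sqrt (real K) * (\<Prod>v\<in>f ` I. 1 / real v)"
    unfolding prod.remove[OF fin_img v] by simp
  finally show ?thesis .
qed

text \<open>A set of \<open>l\<close> edges is encoded by the vertices \<open>z (i, False)\<close> (source) and \<open>z (i, True)\<close> (target) of the
  uncontracted graph.\<close>

definition crowded :: "nat \<Rightarrow> nat \<Rightarrow> nat \<Rightarrow> nat \<Rightarrow> (nat \<times> bool \<Rightarrow> nat) set" where
  "crowded m N K l = {z \<in> ({..<l} \<times> UNIV) \<rightarrow>\<^sub>E {1..N}. inj_on (\<lambda>i. z (i, False)) {..<l} \<and>
     (\<forall>i<l. z (i, True) \<le> z (i, False)) \<and>
     (\<forall>p\<in>{..<l} \<times> UNIV. \<exists>p'\<in>{..<l} \<times> UNIV. p' \<noteq> p \<and> contract_vertex m (z p') = contract_vertex m (z p)) \<and>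
     (\<exists>v>K. 3 \<le> card {p\<in>{..<l} \<times> UNIV. contract_vertex m (z p) = v})}"

text \<open>Enumerate \<open>H\<close> and read off the ends of its edges. The edge at position
  \<open>n\<close> has source \<open>n + 1\<close>, so \<open>z (i, False) - 1\<close> recovers the
  position, and distinct edges have distinct sources.\<close>

lemma not_sparse_imp_crowded:
  assumes "0 \<le> \<delta>" "G \<in> set_pmf (pa_one \<delta> N)" "\<not> sparse_beyond K L (contract m G)"
  shows "\<exists>l\<le>L. \<exists>z\<in>crowded m N K l. \<forall>i<l. snd (G ! (z (i, False) - 1)) = z (i, True)"
proof -
  have len: "length G = N" using pa_one_invariant(1)[OF _ assms(2)] assms(1) by simp
  obtain H v where H: "H \<subseteq> {..<N}" "card H \<le> L" "\<And>g. fst g \<in> H \<Longrightarrow> partnered (contract m G) H g"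
    and v: "K < v" "\<not> card {g \<in> edge_ends (contract m G) v. fst g \<in> H} \<le> 2"
    using assms(3) unfolding sparse_beyond_def by (auto simp: len)
  define l where "l = card H"
  have fin: "finite H" using H(1) finite_subset by blast
  obtain e where e: "bij_betw e {..<l} H"
    using ex_bij_betw_nat_finite[OF fin] by (auto simp: l_def atLeast0LessThan)
  have eH: "e i \<in> H" "e i < N" if "i < l" for i using e that H(1) by (auto simp: bij_betw_def)
  let ?I = "{..<l} \<times> (UNIV :: bool set)"
  define z where "z = (\<lambda>p\<in>?I. endpoint G (e (fst p), snd p))"
  have zF: "z (i, False) = e i + 1" and zT: "z (i, True) = snd (G ! e i)"
    and zT': "1 \<le> z (i, True)" "z (i, True) \<le> e i + 1" if "i < l" for i
    using pa_one_edges[OF assms(1,2) eH(2)[OF that]] that by (auto simp: z_def endpoint_def)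
  have cz: "contract_vertex m (z p) = endpoint (contract m G) (e (fst p), snd p)" if "p \<in> ?I" for p
    using that eH(2)[of "fst p"] len by (auto simp: z_def endpoint_contract)
  have surj: "\<exists>p\<in>?I. g = (e (fst p), snd p)" if "fst g \<in> H" for g :: edge_end
  proof -
    have "fst g \<in> e ` {..<l}" using e that by (simp add: bij_betw_imp_surj_on)
    then obtain i where "i < l" "fst g = e i" by blast
    then show ?thesis by (intro bexI[of _ "(i, snd g)"]) (auto simp: prod_eq_iff)
  qed
  have "z \<in> crowded m N K l"
    unfolding crowded_def
  proof (intro CollectI conjI ballI)
    show "z \<in> ?I \<rightarrow>\<^sub>E {1..N}"
    proof (rule PiE_I)
      fix p assume "p \<in> ?I"
      then obtain i b where p: "p = (i, b)" "i < l" by auto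
      show "z p \<in> {1..N}" using zF[OF p(2)] zT'[OF p(2)] eH(2)[OF p(2)] p(1) by (cases b) auto
    qed (simp add: z_def)
    show "inj_on (\<lambda>i. z (i, False)) {..<l}"
      using e zF by (auto simp: inj_on_def bij_betw_def)
    show "\<forall>i<l. z (i, True) \<le> z (i, False)" using zF zT' by simp
    fix p assume p: "p \<in> ?I"
    have "partnered (contract m G) H (e (fst p), snd p)" using p eH by (intro H(3)) auto
    then obtain g' where g': "g' \<noteq> (e (fst p), snd p)" "fst g' \<in> H"
      "endpoint (contract m G) g' = endpoint (contract m G) (e (fst p), snd p)" unfolding partnered_def by blast
    obtain p' where p': "p' \<in> ?I" "g' = (e (fst p'), snd p')" using surj[OF g'(2)] by blast
    show "\<exists>p'\<in>?I. p' \<noteq> p \<and> contract_vertex m (z p') = contract_vertex m (z p)"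
      using g' p' p cz by (intro bexI[of _ p']) auto
  next
    have "{g \<in> edge_ends (contract m G) v. fst g \<in> H} \<subseteq> (\<lambda>p. (e (fst p), snd p)) ` {p\<in>?I. contract_vertex m (z p) = v}"
    proof
      fix g assume g: "g \<in> {g \<in> edge_ends (contract m G) v. fst g \<in> H}"
      then obtain p where p: "p \<in> ?I" "g = (e (fst p), snd p)" using surj by blast
      then have "contract_vertex m (z p) = v" using cz[OF p(1)] g by simp
      with p show "g \<in> (\<lambda>p. (e (fst p), snd p)) ` {p\<in>?I. contract_vertex m (z p) = v}" by blast
    qed
    then have "card {g \<in> edge_ends (contract m G) v. fst g \<in> H} \<le> card {p\<in>?I. contract_vertex m (z p) = v}"
      by (rule surj_card_le[rotated]) simp
    then show "\<exists>v>K. 3 \<le> card {p\<in>?I. contract_vertex m (z p) = v}" using v by (intro exI[of _ v]) simp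
  qed
  moreover have "\<forall>i<l. snd (G ! (z (i, False) - 1)) = z (i, True)" using zF zT by simp
  ultimately show ?thesis using H(2) l_def by blast
qed

text \<open>\<open>prob_edges_le\<close> gives one factor \<open>1 / sqrt a\<close> per uncontracted
  end \<open>a\<close>. Contraction does not raise labels, so contracted labels only enlarge the
  bound, and \<open>prod_inverse_sqrt_le\<close> applies to them.\<close>

lemma prob_pattern_le:
  assumes \<delta>: "0 \<le> \<delta>" and m: "1 \<le> m" and K: "1 \<le> K" and z: "z \<in> crowded m N K l"
  shows "measure_pmf.prob (pa_one \<delta> N) {G. \<forall>i<l. snd (G ! (z (i, False) - 1)) = z (i, True)} \<le>
    (2 * (1 + \<delta> + real l)) ^ l * (1 / sqrt (real K) * (\<Prod>v\<in>(\<lambda>p. contract_vertex m (z p)) ` ({..<l} \<times> UNIV). 1 / real v))"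
proof -
  let ?I = "{..<l} \<times> (UNIV :: bool set)"
  let ?c = "\<lambda>p. contract_vertex m (z p)"
  define A where "A = (\<lambda>i. z (i, False) - 1) ` {..<l}"
  have zI: "1 \<le> z p" "z p \<le> N" if "p \<in> ?I" for p
  proof -
    have "z p \<in> {1..N}" using z that unfolding crowded_def by blast
    then show "1 \<le> z p" "z p \<le> N" by auto
  qed
  have inj0: "inj_on (\<lambda>i. z (i, False)) {..<l}" and le: "\<And>i. i < l \<Longrightarrow> z (i, True) \<le> z (i, False)"
    using z unfolding crowded_def by blast+
  have inj: "inj_on (\<lambda>i. z (i, False) - 1) {..<l}"
  proof (rule inj_onI)
    fix i j assume "i \<in> {..<l}" "j \<in> {..<l}" "z (i, False) - 1 = z (j, False) - 1"
    moreover from this have "z (i, False) = z (j, False)" using zI(1)[of "(i, False)"] zI(1)[of "(j, False)"] by simp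
    ultimately show "i = j" using inj0 by (auto dest: inj_onD)
  qed
  define g where "g n = z (the_inv_into {..<l} (\<lambda>i. z (i, False) - 1) n, True)" for n
  have g: "g (z (i, False) - 1) = z (i, True)" if "i < l" for i
    unfolding g_def using the_inv_into_f_f[OF inj, of i] that by simp
  have card: "card A = l" unfolding A_def using card_image[OF inj] by simp
  have event: "{G. \<forall>i<l. snd (G ! (z (i, False) - 1)) = z (i, True)} = {G. \<forall>n\<in>A. snd (G ! n) = g n}"
    unfolding A_def using g by auto
  have bound: "measure_pmf.prob (pa_one \<delta> N) {G. \<forall>n\<in>A. snd (G ! n) = g n} \<le>
    (2 * (1 + \<delta> + real (card A))) ^ card A * (\<Prod>n\<in>A. 1 / sqrt ((real n + 1) * real (g n)))"
  proof (rule prob_edges_le[OF \<delta>])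
    show "finite A" by (simp add: A_def)
    show "1 \<le> g n \<and> g n \<le> n + 1" if n: "n \<in> A" for n
    proof -
      obtain i where i: "i < l" "n = z (i, False) - 1" using n by (auto simp: A_def)
      then show ?thesis using g[OF i(1)] zI(1)[of "(i, True)"] zI(1)[of "(i, False)"] le[OF i(1)] by auto
    qed
    show "A \<subseteq> {..<N}"
    proof
      fix n assume "n \<in> A"
      then obtain i where i: "i < l" "n = z (i, False) - 1" by (auto simp: A_def)
      then show "n \<in> {..<N}" using zI[of "(i, False)"] by auto
    qed
  qed
  have weights: "(\<Prod>n\<in>A. 1 / sqrt ((real n + 1) * real (g n))) = (\<Prod>p\<in>?I. 1 / sqrt (real (z p)))"
  proof -
    have "(\<Prod>n\<in>A. 1 / sqrt ((real n + 1) * real (g n))) = (\<Prod>i<l. 1 / sqrt (real (z (i, False))) * (1 / sqrt (real (z (i, True)))))"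
      unfolding A_def
    proof (subst prod.reindex[OF inj], intro prod.cong refl)
      fix i assume i: "i \<in> {..<l}"
      then have "real (z (i, False) - 1) + 1 = real (z (i, False))" using zI(1)[of "(i, False)"] by (simp add: of_nat_diff)
      then show "((\<lambda>n. 1 / sqrt ((real n + 1) * real (g n))) \<circ> (\<lambda>i. z (i, False) - 1)) i =
         1 / sqrt (real (z (i, False))) * (1 / sqrt (real (z (i, True))))"
        using g[of i] i by (simp add: real_sqrt_mult)
    qed
    also have "\<dots> = (\<Prod>i<l. \<Prod>b\<in>UNIV. 1 / sqrt (real (z (i, b))))"
      by (simp add: UNIV_bool mult.commute)
    also have "\<dots> = (\<Prod>p\<in>?I. 1 / sqrt (real (z p)))" by (simp add: prod.cartesian_product)
    finally show ?thesis .
  qed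
  have "(\<Prod>p\<in>?I. 1 / sqrt (real (z p))) \<le> 1 / sqrt (real K) * (\<Prod>v\<in>?c ` ?I. 1 / real v)"
  proof -
    have "(\<Prod>p\<in>?I. 1 / sqrt (real (z p))) \<le> (\<Prod>p\<in>?I. 1 / sqrt (real (?c p)))"
    proof (intro prod_mono conjI)
      fix p assume p: "p \<in> ?I"
      show "1 / sqrt (real (z p)) \<le> 1 / sqrt (real (?c p))"
        using contract_vertex_bounds[OF m zI(1)[OF p]] by (intro frac_le) auto
    qed simp
    also have "\<dots> \<le> 1 / sqrt (real K) * (\<Prod>v\<in>?c ` ?I. 1 / real v)"
    proof -
      obtain v where v: "K < v" "3 \<le> card {p\<in>?I. ?c p = v}"
        using z unfolding crowded_def by blast
      show ?thesis
      proof (rule prod_inverse_sqrt_le[OF _ _ _ v K])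
        show "1 \<le> ?c p" if "p \<in> ?I" for p using contract_vertex_bounds(1)[OF m zI(1)[OF that]] .
        show "\<exists>p'\<in>?I. p' \<noteq> p \<and> ?c p' = ?c p" if "p \<in> ?I" for p using z that unfolding crowded_def by blast
      qed simp
    qed
    finally show ?thesis .
  qed
  then have "(2 * (1 + \<delta> + real l)) ^ l * (\<Prod>p\<in>?I. 1 / sqrt (real (z p))) \<le>
      (2 * (1 + \<delta> + real l)) ^ l * (1 / sqrt (real K) * (\<Prod>v\<in>?c ` ?I. 1 / real v))"
    using \<delta> by (intro mult_left_mono) auto
  then show ?thesis using bound unfolding event weights card by (rule order_trans[rotated])
qed

text \<open>Union over all patterns with at most \<open>L\<close> edges, then a sum over all
  placements of their \<open>2 l\<close> ends. Fibres of the contraction have at most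
  \<open>m\<close> vertices and \<open>1 / contract_vertex m a \<le> m / a\<close>, so each end
  costs at most \<open>m * (2 l + 1 + ln N)\<close>.\<close>

lemma prob_not_sparse_le:
  assumes \<delta>: "0 \<le> \<delta>" and m: "1 \<le> m" and K: "1 \<le> K" and N: "1 \<le> N"
  shows "measure_pmf.prob (pa_one \<delta> N) {G. \<not> sparse_beyond K L (contract m G)} \<le>
    real (Suc L) * ((2 * (1 + \<delta> + real L)) ^ L * (1 / sqrt (real K) *
      (real m * (2 * real L + 1 + ln (real N))) ^ (2 * L)))"
proof -
  let ?M = "pa_one \<delta> N"
  let ?I = "\<lambda>l. {..<l} \<times> (UNIV :: bool set)"
  let ?W = "\<lambda>l z. \<Prod>v\<in>(\<lambda>p. contract_vertex m (z p)) ` ?I l. 1 / real v"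
  let ?E = "\<lambda>l z. {G. \<forall>i<l. snd (G ! (z (i, False) - 1)) = z (i, True)}"
  let ?b = "real m * (2 * real L + 1 + ln (real N))"
  have lnN: "0 \<le> ln (real N)" using N by simp
  have b1: "1 \<le> ?b" using m lnN mult_mono[of 1 "real m" 1 "2 * real L + 1 + ln (real N)"] by simp
  have fin: "finite (crowded m N K l)" for l
    by (rule finite_subset[of _ "?I l \<rightarrow>\<^sub>E {1..N}"]) (auto simp: crowded_def intro!: finite_PiE)
  have per_l: "(\<Sum>z\<in>crowded m N K l. measure_pmf.prob ?M (?E l z)) \<le>
    (2 * (1 + \<delta> + real L)) ^ L * (1 / sqrt (real K) * ?b ^ (2 * L))" if l: "l \<le> L" for l
  proof -
    have "(\<Sum>z\<in>crowded m N K l. measure_pmf.prob ?M (?E l z)) \<le>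
        (\<Sum>z\<in>crowded m N K l. (2 * (1 + \<delta> + real l)) ^ l * (1 / sqrt (real K) * ?W l z))"
      by (intro sum_mono prob_pattern_le[OF \<delta> m K])
    also have "\<dots> = (2 * (1 + \<delta> + real l)) ^ l * (1 / sqrt (real K) * (\<Sum>z\<in>crowded m N K l. ?W l z))"
      by (simp only: sum_distrib_left)
    also have "\<dots> \<le> (2 * (1 + \<delta> + real L)) ^ L * (1 / sqrt (real K) * ?b ^ (2 * L))"
    proof (intro mult_mono)
      have "(2 * (1 + \<delta> + real l)) ^ l \<le> (2 * (1 + \<delta> + real L)) ^ l" using \<delta> l by (intro power_mono) auto
      also have "\<dots> \<le> (2 * (1 + \<delta> + real L)) ^ L" using \<delta> l by (intro power_increasing) auto
      finally show "(2 * (1 + \<delta> + real l)) ^ l \<le> (2 * (1 + \<delta> + real L)) ^ L" .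
      have "(\<Sum>z\<in>crowded m N K l. ?W l z) \<le>
         (\<Sum>z\<in>?I l \<rightarrow>\<^sub>E {1..N}. ?W l z)"
        by (intro sum_mono2) (auto simp: crowded_def intro!: finite_PiE prod_nonneg)
      also have "\<dots> \<le> (real m * real (card (?I l)) + (\<Sum>a=1..N. 1 / real (contract_vertex m a))) ^ card (?I l)"
      proof (rule sum_prod_image_le)
        fix w
        show "card {a\<in>{1..N}. contract_vertex m a = w} \<le> m"
        proof (cases "1 \<le> w")
          case True
          have "finite {a. 1 \<le> a \<and> contract_vertex m a = w}" unfolding contract_vertex_fibre[OF m True] by simp
          then have "card {a\<in>{1..N}. contract_vertex m a = w} \<le> card {a. 1 \<le> a \<and> contract_vertex m a = w}"
            by (rule card_mono) auto
          then show ?thesis unfolding contract_vertex_fibre[OF m True] by simp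
        next
          case False
          then have "{a\<in>{1..N}. contract_vertex m a = w} = {}" by (auto simp: contract_vertex_def)
          then show ?thesis by (simp only: card.empty)
        qed
      qed auto
      also have "\<dots> \<le> ?b ^ (2 * l)"
      proof -
        have "(\<Sum>a=1..N. 1 / real (contract_vertex m a)) \<le> (\<Sum>a=1..N. real m * (1 / real a))"
        proof (rule sum_mono)
          fix a assume a: "a \<in> {1..N}"
          have "1 / real (contract_vertex m a) \<le> 1 / (real a / real m)"
            using contract_vertex_bounds(3)[OF m, of a] a m by (intro frac_le) auto
          then show "1 / real (contract_vertex m a) \<le> real m * (1 / real a)" by simp
        qed
        also have "\<dots> \<le> real m * (1 + ln (real N))"
          unfolding sum_distrib_left[symmetric] by (intro mult_left_mono sum_inverse_le_ln N) simp
        finally have "real m * real (card (?I l)) + (\<Sum>a=1..N. 1 / real (contract_vertex m a)) \<le>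
            real m * (2 * real l) + real m * (1 + ln (real N))" by (simp add: card_cartesian_product)
        also have "\<dots> \<le> ?b" using l m by (simp add: distrib_left[symmetric] mult_left_mono)
        finally show ?thesis
          by (auto simp: card_cartesian_product mult.commute intro!: power_mono add_nonneg_nonneg sum_nonneg)
      qed
      also have "\<dots> \<le> ?b ^ (2 * L)" using b1 l by (intro power_increasing) auto
      finally show "(\<Sum>z\<in>crowded m N K l. ?W l z) \<le> ?b ^ (2 * L)" .
      show "0 \<le> (\<Sum>z\<in>crowded m N K l. ?W l z)"
        by (intro sum_nonneg prod_nonneg) auto
      then show "0 \<le> 1 / sqrt (real K) * (\<Sum>z\<in>crowded m N K l. ?W l z)"
        by (intro mult_nonneg_nonneg) auto
    qed (use \<delta> in auto)
    finally show ?thesis .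
  qed
  have "measure_pmf.prob ?M {G. \<not> sparse_beyond K L (contract m G)} \<le>
      measure_pmf.prob ?M (\<Union>l\<in>{..L}. \<Union>z\<in>crowded m N K l. ?E l z)"
  proof (rule measure_pmf.finite_measure_mono_AE, unfold AE_measure_pmf_iff, intro ballI impI)
    fix G assume "G \<in> set_pmf ?M" "G \<in> {G. \<not> sparse_beyond K L (contract m G)}"
    then obtain l z where "l \<le> L" "z \<in> crowded m N K l" "G \<in> ?E l z"
      using not_sparse_imp_crowded[OF \<delta>, of G N K L m] by blast
    then show "G \<in> (\<Union>l\<in>{..L}. \<Union>z\<in>crowded m N K l. ?E l z)" by blast
  qed simp
  also have "\<dots> \<le> (\<Sum>l\<in>{..L}. measure_pmf.prob ?M (\<Union>z\<in>crowded m N K l. ?E l z))"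
    by (intro measure_pmf.finite_measure_subadditive_finite) auto
  also have "\<dots> \<le> (\<Sum>l\<in>{..L}. (2 * (1 + \<delta> + real L)) ^ L * (1 / sqrt (real K) * ?b ^ (2 * L)))"
  proof (rule sum_mono)
    fix l assume "l \<in> {..L}"
    have "measure_pmf.prob ?M (\<Union>z\<in>crowded m N K l. ?E l z) \<le> (\<Sum>z\<in>crowded m N K l. measure_pmf.prob ?M (?E l z))"
      using fin by (intro measure_pmf.finite_measure_subadditive_finite) auto
    also have "\<dots> \<le> (2 * (1 + \<delta> + real L)) ^ L * (1 / sqrt (real K) * ?b ^ (2 * L))"
      using \<open>l \<in> {..L}\<close> by (intro per_l) simp
    finally show "measure_pmf.prob ?M (\<Union>z\<in>crowded m N K l. ?E l z) \<le> (2 * (1 + \<delta> + real L)) ^ L * (1 / sqrt (real K) * ?b ^ (2 * L))" .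
  qed
  finally show ?thesis by simp
qed

section \<open>Conclusion\<close>

text \<open>Here \<open>x\<close> stands for \<open>ln (ln t)\<close>. The logarithms of the two
  powers are \<open>O(x ln x)\<close> and \<open>O(x^2)\<close>, while \<open>1 / sqrt K\<close>
  contributes \<open>- x^3 / 2\<close>; this is why \<open>K\<close> has to outgrow
  \<open>exp (O(x^2))\<close>.\<close>

lemma asymp_sparse:
  fixes C \<delta> m :: real
  assumes "0 < C" "0 \<le> \<delta>" "1 \<le> m"
  shows "((\<lambda>x. (C * x + 1) * ((2 * (1 + \<delta> + C * x)) powr (C * x) * (1 / sqrt (exp (x ^ 3)) *
    (m * (2 * (C * x) + 1 + ln m + exp x)) powr (2 * (C * x))))) \<longlongrightarrow> 0) at_top"
  using assms by real_asymp

text \<open>The logarithm is \<open>O(x^3) - \<gamma> * exp x\<close>: here \<open>K\<close> must be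
  subpolynomial in \<open>t = exp (exp x)\<close>.\<close>

lemma asymp_degree:
  fixes \<gamma> \<delta> m :: real
  assumes "0 < \<gamma>" "0 \<le> \<delta>" "1 \<le> m"
  shows "((\<lambda>x. (2 * exp (x ^ 3)) * (((2 * exp (x ^ 3)) ^ 3 + \<delta>) * ((m * (2 * exp (x ^ 3)) + 1) / exp (exp x)) powr \<gamma>)) \<longlongrightarrow> 0) at_top"
  using assms by real_asymp

text \<open>Here \<epsilon> enters: \<open>(ln t) powr (1 + \<epsilon>)\<close> outgrows the
  \<open>ln t\<close> from the union over \<open>t\<close> vertices, whatever the constant
  \<open>c\<close>.\<close>

lemma asymp_mean_field:
  fixes c \<epsilon> k :: real
  assumes "0 < c" "0 < \<epsilon>"
  shows "((\<lambda>x. exp (exp x) * (2 * k * exp (- (c * exp x powr (1 + \<epsilon>))))) \<longlongrightarrow> 0) at_top"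
  using assms by real_asymp

lemma asymp_core: "((\<lambda>x. c / exp (x ^ 3)) \<longlongrightarrow> (0::real)) at_top"
  by real_asymp

lemma ln_ln_at_top: "filterlim (\<lambda>t. ln (ln (real t))) at_top sequentially"
  by real_asymp

text \<open>If both ends of an edge are at most \<open>K\<close>, so is its source, and sources up
  to \<open>K\<close> own only positions below \<open>m * K\<close>. Each position has two
  ends.\<close>

lemma card_low_edge_ends_le:
  assumes "0 \<le> \<delta>" "1 \<le> m" "G \<in> set_pmf (pa_one \<delta> N)" "v \<le> K"
  shows "card {e \<in> edge_ends (contract m G) v. opposite (contract m G) e \<le> K} \<le> 2 * (m * K)"
proof -
  let ?E = "{e \<in> edge_ends (contract m G) v. opposite (contract m G) e \<le> K}"
  have len: "length G = N" using pa_one_invariant(1)[OF _ assms(3)] assms(1) by simp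
  have "?E \<subseteq> {..<m * K} \<times> UNIV"
  proof
    fix e assume e: "e \<in> ?E"
    then have n: "fst e < N" using len by simp
    let ?s = "(fst e, False)"
    have "endpoint (contract m G) ?s \<le> K"
      using e assms(4) by (cases e; cases "snd e") (auto simp: opposite_def)
    then have "contract_vertex m (endpoint G ?s) \<le> K" using n len by (simp add: endpoint_contract)
    moreover have "endpoint G ?s = fst e + 1" using pa_one_edges[OF assms(1,3) n] by (simp add: endpoint_def)
    ultimately have "fst e div m < K" by (simp add: contract_vertex_def)
    then have "fst e < m * K" using assms(2) by (simp add: div_less_iff_less_mult mult.commute)
    then show "e \<in> {..<m * K} \<times> UNIV" by (cases e) simp
  qed
  then have "card ?E \<le> card ({..<m * K} \<times> (UNIV :: bool set))"
    by (intro card_mono) auto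
  then show ?thesis by (simp add: card_cartesian_product)
qed

lemma vertex_degree_contract_ge:
  assumes "1 \<le> m" "1 \<le> v"
  shows "vertex_degree G ((v - 1) * m + 1) \<le> vertex_degree (contract m G) v"
  unfolding vertex_degree_def
proof (rule card_mono[OF finite_edge_ends], rule subsetI)
  fix e assume e: "e \<in> edge_ends G ((v - 1) * m + 1)"
  then show "e \<in> edge_ends (contract m G) v"
    using assms by (simp add: endpoint_contract contract_vertex_def)
qed

lemma pa_one_degree_ge:
  assumes "0 \<le> \<delta>" "1 \<le> m" "G \<in> set_pmf (pa_one \<delta> (m * t))" "v \<in> {1..t}"
  shows "m \<le> vertex_degree (contract m G) v"
proof -
  have len: "length G = m * t" using pa_one_invariant(1)[OF _ assms(3)] assms(1) by simp
  let ?E = "(\<lambda>n. (n, False)) ` {(v - 1) * m..<(v - 1) * m + m}"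
  have "?E \<subseteq> edge_ends (contract m G) v"
  proof
    fix e assume "e \<in> ?E"
    then obtain n where n: "e = (n, False)" "(v - 1) * m \<le> n" "n < (v - 1) * m + m" by auto
    have "(v - 1) * m + m = v * m" using assms(4) by (cases v) auto
    also have "\<dots> \<le> m * t" using assms(4) by (simp add: mult.commute)
    finally have nt: "n < m * t" using n(3) by simp
    have "endpoint G e = n + 1" using pa_one_edges[OF assms(1,3) nt] n(1) by (simp add: endpoint_def)
    moreover have "n div m = v - 1"
    proof (rule div_nat_eqI)
      show "m * (v - 1) \<le> n" "n < m * Suc (v - 1)" using n by (simp_all add: mult.commute)
    qed
    ultimately show "e \<in> edge_ends (contract m G) v"
      using n(1) nt len assms(4) by (simp add: endpoint_contract contract_vertex_def)
  qed
  then have "card ?E \<le> vertex_degree (contract m G) v"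
    unfolding vertex_degree_def by (rule card_mono[OF finite_edge_ends])
  moreover have "card ?E = m" by (subst card_image) (auto simp: inj_on_def)
  ultimately show ?thesis by simp
qed

text \<open>The oddness of \<open>d\<close> matters here: as an odd number at most
  \<open>m \<le> vertex_degree G v\<close> it is an admissible sample size, so samples have at least
  \<open>min k d = d\<close> elements.\<close>

lemma pref_attach_sampled_graph:
  assumes "0 \<le> \<delta>" "1 \<le> m" "odd k" "d = 2 * h + 1" "d \<le> m" "d \<le> k" "G \<in> set_pmf (pref_attach m \<delta> t)"
    and "0 \<le> \<alpha>" "\<alpha> \<le> 1" "\<And>\<tau>. 0 \<le> mean_field h \<alpha> \<tau> \<and> mean_field h \<alpha> \<tau> \<le> 1 / 2"
  shows "sampled_graph G {1..t} k h \<alpha>"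
proof -
  obtain G0 where G0: "G0 \<in> set_pmf (pa_one (\<delta> / real m) (m * t))" "G = contract m G0"
    using assms(7) by (auto simp: pref_attach_def)
  have \<delta>: "0 \<le> \<delta> / real m" using assms(1) by simp
  have len: "length G0 = m * t" using pa_one_invariant(1)[OF _ G0(1)] \<delta> by simp
  show ?thesis
  proof
    fix e :: edge_end assume "fst e < length G"
    then have n: "fst e < m * t" using len G0(2) by simp
    have "endpoint G0 e \<le> m * t" "1 \<le> endpoint G0 e"
      using pa_one_edges[OF \<delta> G0(1) n] n by (auto simp: endpoint_def)
    then have "(endpoint G0 e - 1) div m < t" using assms(2) by (simp add: div_less_iff_less_mult mult.commute)
    then show "endpoint G e \<in> {1..t}" using n len by (simp add: G0(2) endpoint_contract contract_vertex_def)
  next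
    fix v S assume v: "v \<in> {1..t}" and S: "S \<in> set_pmf (choice_pmf k G v)"
    have deg: "m \<le> vertex_degree G v" unfolding G0(2) by (rule pa_one_degree_ge[OF \<delta> assms(2) G0(1) v])
    then have "1 \<le> vertex_degree G v" using assms(2) by simp
    note sc = set_choice_pmf[OF this assms(3)]
    let ?J = "{j. odd j \<and> j \<le> vertex_degree G v}"
    have "finite ?J" by (rule finite_subset[of _ "{..vertex_degree G v}"]) auto
    moreover have "d \<in> ?J" using deg assms(4,5) by simp
    ultimately have "d \<le> Max ?J" by (rule Max_ge)
    then have "d \<le> sample_size k G v" "sample_size k G v \<le> k" using assms(6) by (auto simp: sample_size_def)
    then show "S \<subseteq> edge_ends G v \<and> odd (card S) \<and> 2 * h + 1 \<le> card S \<and> card S \<le> k"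
      using S sc assms(4) by auto
  qed (use assms in auto)
qed

definition good_graph :: "nat \<Rightarrow> nat \<Rightarrow> nat \<Rightarrow> nat \<Rightarrow> multigraph \<Rightarrow> bool" where
  "good_graph K L D t G \<longleftrightarrow> sparse_beyond K L G \<and> (\<forall>v\<in>{1..t}. v \<le> K \<longrightarrow> D \<le> vertex_degree G v)"

lemma prob_not_good_graph_le:
  assumes "0 \<le> \<delta>" "1 \<le> m" "1 \<le> K" "1 \<le> t"
  shows "measure_pmf.prob (pref_attach m \<delta> t) {G. \<not> good_graph K L D t G} \<le>
    real (Suc L) * ((2 * (1 + \<delta> / real m + real L)) ^ L * (1 / sqrt (real K) *
      (real m * (2 * real L + 1 + ln (real (m * t)))) ^ (2 * L))) +
    real K * ((real D + \<delta> / real m) * ((real m * real K + 1) / (real m * real t + 1)) powr (1 / (2 * (2 + \<delta> / real m))))"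
proof -
  let ?\<delta> = "\<delta> / real m"
  let ?M = "pa_one ?\<delta> (m * t)" and ?\<gamma> = "1 / (2 * (2 + \<delta> / real m))"
  have \<delta>: "0 \<le> ?\<delta>" using assms(1) by simp
  let ?X = "(real D + ?\<delta>) * ((real m * real K + 1) / (real m * real t + 1)) powr ?\<gamma>"
  let ?V = "{v\<in>{1..t}. v \<le> K}"
  let ?F = "\<lambda>v. {G. real (vertex_degree G ((v - 1) * m + 1)) < real D}"
  have mt: "1 \<le> m * t" using assms by (simp add: Suc_le_eq)
  have "measure_pmf.prob (pref_attach m \<delta> t) {G. \<not> good_graph K L D t G} = measure_pmf.prob ?M {G. \<not> good_graph K L D t (contract m G)}"
    by (simp add: pref_attach_def vimage_def)
  also have "\<dots> \<le> measure_pmf.prob ?M ({G. \<not> sparse_beyond K L (contract m G)} \<union> (\<Union>v\<in>?V. ?F v))"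
  proof (rule measure_pmf.finite_measure_mono)
    show "{G. \<not> good_graph K L D t (contract m G)} \<subseteq> {G. \<not> sparse_beyond K L (contract m G)} \<union> (\<Union>v\<in>?V. ?F v)"
    proof
      fix G assume G: "G \<in> {G. \<not> good_graph K L D t (contract m G)}"
      show "G \<in> {G. \<not> sparse_beyond K L (contract m G)} \<union> (\<Union>v\<in>?V. ?F v)"
      proof (cases "sparse_beyond K L (contract m G)")
        case True
        then obtain v where v: "v \<in> {1..t}" "v \<le> K" "\<not> D \<le> vertex_degree (contract m G) v"
          using G by (auto simp: good_graph_def)
        then have "vertex_degree G ((v - 1) * m + 1) < D"
          using vertex_degree_contract_ge[OF assms(2), of v G] by auto
        then show ?thesis using v by auto
      qed simp
    qed
  qed simp
  also have "\<dots> \<le> measure_pmf.prob ?M {G. \<not> sparse_beyond K L (contract m G)} + measure_pmf.prob ?M (\<Union>v\<in>?V. ?F v)"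
    by (rule measure_Un_le) auto
  also have "measure_pmf.prob ?M (\<Union>v\<in>?V. ?F v) \<le> real K * ?X"
  proof -
    have "measure_pmf.prob ?M (\<Union>v\<in>?V. ?F v) \<le> (\<Sum>v\<in>?V. measure_pmf.prob ?M (?F v))"
      by (intro measure_pmf.finite_measure_subadditive_finite) auto
    also have "\<dots> \<le> (\<Sum>v\<in>?V. ?X)"
    proof (rule sum_mono)
      fix v assume v: "v \<in> ?V"
      let ?b = "(v - 1) * m + 1"
      have b_le: "?b \<le> v * m" using v assms(2) by (cases v) auto
      have bt: "v * m \<le> m * t" "v * m \<le> m * K" using v by (auto simp: mult.commute)
      have "measure_pmf.prob ?M (?F v) \<le> (real D + ?\<delta>) * ((real ?b + 1) / (real (m * t) + 1)) powr ?\<gamma>"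
        by (rule prob_degree_less_le[OF \<delta> _ order_trans[OF b_le bt(1)]]) auto
      also have "\<dots> \<le> ?X"
      proof (intro mult_left_mono powr_mono2)
        have "real ?b \<le> real (m * K)" by (rule of_nat_mono[OF order_trans[OF b_le bt(2)]])
        then show "(real ?b + 1) / (real (m * t) + 1) \<le> (real m * real K + 1) / (real m * real t + 1)"
          by (simp add: divide_right_mono)
      qed (use \<delta> in auto)
      finally show "measure_pmf.prob ?M (?F v) \<le> ?X" .
    qed
    also have "\<dots> \<le> real K * ?X"
    proof -
      have "card ?V \<le> card {1..K}" by (intro card_mono) auto
      then have "real (card ?V) \<le> real K" by simp
      then show ?thesis unfolding sum_constant using \<delta> by (intro mult_right_mono) auto
    qed
    finally show ?thesis .
  qed
  finally show ?thesis using prob_not_sparse_le[OF \<delta> assms(2,3) mt, of L] by linarith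
qed

lemma prob_blue_ge:
  assumes "0 \<le> \<delta>" "1 \<le> m" "odd k" "d = 2 * h + 1" "d \<le> m" "d \<le> k" "2 \<le> h"
    and "0 \<le> \<alpha>" "\<alpha> \<le> 1" "\<And>\<tau>. 0 \<le> mean_field h \<alpha> \<tau> \<and> mean_field h \<alpha> \<tau> \<le> 1 / 2"
    and "9 * Suc \<tau> \<le> L" "0 < D" "real (Suc (Suc \<tau>)) \<le> R"
  shows "\<P>((G, x, c) in protocol_space k m \<delta> \<alpha> t. \<forall>\<tau>. real \<tau> \<ge> R \<longrightarrow> (\<forall>v\<in>{1..t}. \<not> red G x c \<tau> v)) \<ge>
    1 - (measure_pmf.prob (pref_attach m \<delta> t) {G. \<not> good_graph K L D t G} +
      (real t * (real k * mean_field h \<alpha> \<tau> + real k * mean_field h \<alpha> (Suc \<tau>)) +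
        real K * (real (2 * (m * K)) * real k / real D)))"
proof (rule prob_protocol_ge)
  fix G assume G: "G \<in> set_pmf (pref_attach m \<delta> t)" and "G \<notin> {G. \<not> good_graph K L D t G}"
  then have good: "good_graph K L D t G" by simp
  interpret sampled_graph G "{1..t}" k h \<alpha>
    by (rule pref_attach_sampled_graph[OF assms(1-6) G assms(8-10)])
  obtain G0 where G0: "G0 \<in> set_pmf (pa_one (\<delta> / real m) (m * t))" "G = contract m G0"
    using G by (auto simp: pref_attach_def)
  have core: "D \<le> vertex_degree G v \<and> card {e \<in> edge_ends G v. opposite G e \<le> K} \<le> 2 * (m * K)"
    if "v \<in> {1..t}" "v \<le> K" for v
    using good that card_low_edge_ends_le[OF _ assms(2) G0(1) that(2)] assms(1) G0(2) by (auto simp: good_graph_def simp del: mem_edge_ends)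
  have "sparse_beyond K L G" using good by (simp add: good_graph_def)
  then have "measure_pmf.prob (history_pmf k G \<alpha> (Suc (Suc \<tau>)) {1..t})
      {\<omega>. \<exists>v\<in>{1..t}. red G (\<lambda>v. \<omega> (0, v) \<noteq> {}) \<omega> (Suc (Suc \<tau>)) v}
    \<le> real (card {1..t}) * (real k * mean_field h \<alpha> \<tau> + real k * mean_field h \<alpha> (Suc \<tau>)) + real K * (real (2 * (m * K)) * real k / real D)"
    using assms(7,11,12) core by (intro prob_some_red_le) auto
  then show "emeasure (return (count_space UNIV) G \<Otimes>\<^sub>M (initial_measure \<alpha> t \<Otimes>\<^sub>M choices_measure k t G)) (late_red R t)
     \<le> ennreal (real t * (real k * mean_field h \<alpha> \<tau> + real k * mean_field h \<alpha> (Suc \<tau>)) + real K * (real (2 * (m * K)) * real k / real D))"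
    by (intro order_trans[OF emeasure_kernel_late_red_le[OF refl assms(13)]] ennreal_leI) simp
qed (use assms(10) in auto)

lemma power_le_powr:
  fixes b B X :: real
  assumes "1 \<le> b" "b \<le> B" "real n \<le> X"
  shows "b ^ n \<le> B powr X"
proof -
  have "b ^ n \<le> B ^ n" using assms by (intro power_mono) auto
  also have "\<dots> = B powr real n" using assms by (simp add: powr_realpow)
  also have "\<dots> \<le> B powr X" using assms by (intro powr_mono) auto
  finally show ?thesis .
qed

theorem theorem1:
  fixes m k d :: nat and \<delta> \<alpha> \<epsilon> :: real
  assumes "m \<ge> 5" and "\<delta> \<ge> 0" and "k \<ge> 5" and "odd k"
    and "d = (if odd m then min m k else min (m - 1) k)"
    and "0 \<le> \<alpha>" and "\<alpha> < alpha_star d" and "\<epsilon> > 0"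
  shows "(\<lambda>t. \<P>((G, x, c) in protocol_space k m \<delta> \<alpha> t.
            \<forall>\<tau>. real \<tau> \<ge> (1 + \<epsilon>) / log (real d) ((real d - 1) / 2) * log (real d) (log (real d) (real t))
                 \<longrightarrow> (\<forall>v\<in>{1..t}. \<not> red G x c \<tau> v)))
         \<longlonglongrightarrow> 1"
proof -
  define h where "h = (d - 1) div 2"
  have d: "odd d" "d \<ge> 5" "d \<le> m" "d \<le> k"
  proof -
    have even: "even m \<Longrightarrow> 6 \<le> m" using assms(1) by presburger
    have "d = min (if odd m then m else m - 1) k" using assms(5) by simp
    moreover have "odd (if odd m then m else m - 1)" "5 \<le> (if odd m then m else m - 1)" "(if odd m then m else m - 1) \<le> m"
      using assms(1) even by (cases "odd m"; fastforce)+
    ultimately show "odd d" "d \<ge> 5" "d \<le> m" "d \<le> k" using assms(3,4) unfolding min_def by presburger+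
  qed
  have dh: "d = 2 * h + 1" "2 \<le> h" using d(1,2) by (auto simp: h_def elim!: oddE)
  note mf = d(1,2) h_def assms(6,7)
  note bounds = mean_field_bounds[OF mf] and half = mean_field_le_half[OF mf]
  obtain \<tau>0 where \<tau>0: "\<And>j. mean_field h \<alpha> (\<tau>0 + j) \<le> exp (- real (h ^ j))"
    using mean_field_doubly_exponential[OF mf] by blast
  have \<alpha>1: "\<alpha> \<le> 1" using assms(7) alpha_star_props(1)[OF d(1,2)] by simp
  have m: "1 \<le> m" "1 \<le> real m" using assms(1) by auto
  define \<delta>' where "\<delta>' = \<delta> / real m"
  have \<delta>': "0 \<le> \<delta>'" using assms(2) by (simp add: \<delta>'_def)
  define \<gamma> where "\<gamma> = 1 / (2 * (2 + \<delta>'))"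
  have \<gamma>: "0 < \<gamma>" using \<delta>' by (simp add: \<gamma>_def)
  define lnd where "lnd = ln (real d)"
  have lnd: "1 \<le> lnd"
  proof -
    have "exp 1 \<le> real d" using exp_le d(2) by linarith
    then show ?thesis unfolding lnd_def using d(2) by (subst ln_ge_iff) auto
  qed
  have lnh: "0 < ln (real h)" using dh by simp
  \<comment> \<open>Chosen so that \<open>L t \<le> 9 * R t \<le> C * x t\<close>.\<close>
  define C where "C = 9 * ((1 + \<epsilon>) / ln (real h))"
  have C: "0 < C" using lnh assms(8) by (simp add: C_def)
  \<comment> \<open>By \<open>R_eq\<close>, \<open>h powr R t\<close> equals
    \<open>(ln t / lnd) powr (1 + \<epsilon>)\<close>. Three steps are lost to rounding and to the
    last two rounds, and \<open>\<tau>0\<close> to the start of the decay, so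
    \<open>h ^ (\<tau> t - \<tau>0)\<close> is at least
    \<open>c * (ln t) powr (1 + \<epsilon>)\<close>.\<close>
  define c where "c = real h powr (- 3 - real \<tau>0) / lnd powr (1 + \<epsilon>)"
  have c: "0 < c" using dh lnd by (simp add: c_def)
  define R where "R t = (1 + \<epsilon>) / log (real d) ((real d - 1) / 2) * log (real d) (log (real d) (real t))" for t :: nat
  define x where "x t = ln (ln (real t))" for t :: nat
  define K where "K t = nat \<lceil>exp (x t ^ 3)\<rceil>" for t
  \<comment> \<open>The vertices are shown blue at time \<open>\<tau> t + 2\<close>, which must not
    exceed \<open>R t\<close>.\<close>
  define \<tau> where "\<tau> t = nat \<lfloor>R t\<rfloor> - 2" for t
  define L where "L t = 9 * Suc (\<tau> t)" for t
  \<comment> \<open>The error terms in order: a dense edge set, a low degree up to \<open>K\<close>,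
    a red vertex beyond \<open>K\<close> at one of the two times, and a vertex up to
    \<open>K\<close> sampling another.\<close>
  define E where "E x = (C * x + 1) * ((2 * (1 + \<delta>' + C * x)) powr (C * x) * (1 / sqrt (exp (x ^ 3)) *
      (real m * (2 * (C * x) + 1 + ln (real m) + exp x)) powr (2 * (C * x)))) +
    (2 * exp (x ^ 3)) * (((2 * exp (x ^ 3)) ^ 3 + \<delta>') * ((real m * (2 * exp (x ^ 3)) + 1) / exp (exp x)) powr \<gamma>) +
    (exp (exp x) * (2 * real k * exp (- (c * exp x powr (1 + \<epsilon>)))) + (2 * real m * real k) / exp (x ^ 3))" for x :: real
  let ?P = "\<lambda>t. \<P>((G, x, c) in protocol_space k m \<delta> \<alpha> t. \<forall>\<tau>. real \<tau> \<ge> R t \<longrightarrow> (\<forall>v\<in>{1..t}. \<not> red G x c \<tau> v))"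
  have x_lim: "filterlim x at_top sequentially" unfolding x_def by (rule ln_ln_at_top)
  have E_lim: "((\<lambda>t. E (x t)) \<longlongrightarrow> 0) sequentially"
  proof -
    have "(E \<longlongrightarrow> 0 + 0 + (0 + 0)) at_top"
      unfolding E_def
      by (intro tendsto_add asymp_sparse[OF C \<delta>' m(2)] asymp_degree[OF \<gamma> \<delta>' m(2)] asymp_mean_field[OF c assms(8)] asymp_core)
    then show ?thesis using filterlim_compose[OF _ x_lim] by simp
  qed
  have ln_pos: "0 < ln (real t)" if "1 \<le> x t" for t
  proof -
    have "ln (real t) \<noteq> 0" using that by (intro notI) (simp add: x_def)
    moreover from this have "t \<noteq> 0" by (intro notI) simp
    then have "0 \<le> ln (real t)" by simp
    ultimately show ?thesis by linarith
  qed
  \<comment> \<open>The base \<open>d\<close> cancels from the quotient of logarithms and survives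
    only as the shift \<open>ln lnd\<close>.\<close>
  have R_eq: "R t = (1 + \<epsilon>) / ln (real h) * (x t - ln lnd)" if "1 \<le> x t" for t
  proof -
    have lt: "0 < ln (real t)" by (rule ln_pos[OF that])
    have "(real d - 1) / 2 = real h" using dh(1) by simp
    then have "R t = (1 + \<epsilon>) / (ln (real h) / lnd) * (ln (ln (real t) / lnd) / lnd)"
      by (simp add: R_def log_def lnd_def)
    also have "\<dots> = (1 + \<epsilon>) / ln (real h) * ln (ln (real t) / lnd)" using lnd by simp
    also have "ln (ln (real t) / lnd) = x t - ln lnd" using lt lnd by (simp add: ln_div x_def)
    finally show ?thesis .
  qed
  have R_lim: "eventually (\<lambda>t. 3 + real \<tau>0 \<le> R t) sequentially"
  proof -
    have "eventually (\<lambda>t. (3 + real \<tau>0) * ln (real h) / (1 + \<epsilon>) + ln lnd \<le> x t) sequentially"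
      using x_lim by (simp add: filterlim_at_top)
    moreover have "eventually (\<lambda>t. 1 \<le> x t) sequentially" using x_lim by (simp add: filterlim_at_top)
    ultimately show ?thesis
    proof eventually_elim
      case (elim t)
      have "(3 + real \<tau>0) = (1 + \<epsilon>) / ln (real h) * ((3 + real \<tau>0) * ln (real h) / (1 + \<epsilon>))"
        using lnh assms(8) by simp
      also have "\<dots> \<le> (1 + \<epsilon>) / ln (real h) * (x t - ln lnd)"
        using elim(1) lnh assms(8) by (intro mult_left_mono) auto
      finally show ?case using R_eq[OF elim(2)] by simp
    qed
  qed
  have "eventually (\<lambda>t. 1 - E (x t) \<le> ?P t) sequentially"
  proof -
    have "eventually (\<lambda>t. 1 \<le> x t) sequentially" using x_lim by (simp add: filterlim_at_top)
    with R_lim show ?thesis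
    proof eventually_elim
      case (elim t)
      let ?x = "x t" and ?K = "K t" and ?L = "L t" and ?\<tau> = "\<tau> t"
      have lt: "0 < ln (real t)" by (rule ln_pos[OF elim(2)])
      then have t: "1 \<le> t" by (cases "t = 0") auto
      have expx: "exp ?x = ln (real t)" using lt by (simp add: x_def)
      then have expexpx: "exp (exp ?x) = real t" using t by simp
      have K: "exp (?x ^ 3) \<le> real ?K" "real ?K \<le> 2 * exp (?x ^ 3)" "1 \<le> ?K"
      proof -
        have "1 \<le> exp (?x ^ 3)" using elim(2) by simp
        moreover have "real ?K = of_int \<lceil>exp (?x ^ 3)\<rceil>" unfolding K_def by (simp add: order_trans[of 0 "exp (?x ^ 3)"])
        ultimately show "exp (?x ^ 3) \<le> real ?K" "real ?K \<le> 2 * exp (?x ^ 3)" by linarith+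
        then show "1 \<le> ?K" using \<open>1 \<le> exp (?x ^ 3)\<close> by linarith
      qed
      have \<tau>: "real (Suc (Suc ?\<tau>)) \<le> R t" "R t - 3 \<le> real ?\<tau>" "\<tau>0 \<le> ?\<tau>"
        using elim(1) unfolding \<tau>_def by linarith+
      have L: "real ?L \<le> C * ?x"
      proof -
        have "real ?L \<le> 9 * R t" using \<tau>(1) by (simp add: L_def)
        also have "\<dots> \<le> 9 * ((1 + \<epsilon>) / ln (real h) * ?x)"
          unfolding R_eq[OF elim(2)] using lnd lnh assms(8) by (intro mult_left_mono) auto
        finally show ?thesis by (simp only: C_def mult.assoc)
      qed
      let ?b = "real m * (2 * real ?L + 1 + ln (real (m * t)))"
      let ?B = "real m * (2 * (C * ?x) + 1 + ln (real m) + exp ?x)"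
      \<comment> \<open>The degree threshold \<open>K ^ 3\<close> is set against \<open>K\<close>
        low vertices with at most \<open>2 m K\<close> edge-ends each among themselves; what remains
        is \<open>2 m k / K\<close>, which tends to 0.\<close>
      let ?bad = "measure_pmf.prob (pref_attach m \<delta> t) {G. \<not> good_graph ?K ?L (?K ^ 3) t G}"
      have "1 - (?bad + (real t * (real k * mean_field h \<alpha> ?\<tau> + real k * mean_field h \<alpha> (Suc ?\<tau>)) +
          real ?K * (real (2 * (m * ?K)) * real k / real (?K ^ 3)))) \<le> ?P t"
        using \<tau>(1) K(3) bounds half
        by (intro prob_blue_ge[OF assms(2) m(1) assms(4) dh(1) d(3,4) dh(2) assms(6) \<alpha>1]) (auto simp: L_def)
      moreover have "?bad \<le> real (Suc ?L) * ((2 * (1 + \<delta>' + real ?L)) ^ ?L * (1 / sqrt (real ?K) *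
          ?b ^ (2 * ?L))) +
        real ?K * ((real (?K ^ 3) + \<delta>') * ((real m * real ?K + 1) / (real m * real t + 1)) powr \<gamma>)"
        using prob_not_good_graph_le[OF assms(2) m(1) K(3) t] unfolding \<delta>'_def \<gamma>_def .
      moreover have "real (Suc ?L) * ((2 * (1 + \<delta>' + real ?L)) ^ ?L * (1 / sqrt (real ?K) *
          ?b ^ (2 * ?L))) \<le>
        (C * ?x + 1) * ((2 * (1 + \<delta>' + C * ?x)) powr (C * ?x) * (1 / sqrt (exp (?x ^ 3)) *
          ?B powr (2 * (C * ?x))))"
      proof (intro mult_mono)
        show "real (Suc ?L) \<le> C * ?x + 1" using L by simp
        show "(2 * (1 + \<delta>' + real ?L)) ^ ?L \<le> (2 * (1 + \<delta>' + C * ?x)) powr (C * ?x)"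
          using L \<delta>' by (intro power_le_powr) auto
        show "1 / sqrt (real ?K) \<le> 1 / sqrt (exp (?x ^ 3))" using K by (intro frac_le) auto
        have lnmt: "ln (real (m * t)) = ln (real m) + exp ?x" using m t expx by (simp add: ln_mult)
        have lnm: "0 \<le> ln (real m)" using m by simp
        show "?b ^ (2 * ?L) \<le> ?B powr (2 * (C * ?x))"
        proof (rule power_le_powr)
          have "1 * 1 \<le> ?b"
            unfolding lnmt using m lnm by (intro mult_mono) auto
          then show "1 \<le> ?b" by simp
          show "?b \<le> ?B"
            unfolding lnmt using L by (intro mult_left_mono) auto
        qed (use L in auto)
        show "0 \<le> ?b ^ (2 * ?L)"
          unfolding lnmt using lnm by (intro zero_le_power mult_nonneg_nonneg) auto
        then show "0 \<le> (2 * (1 + \<delta>' + real ?L)) ^ ?L * (1 / sqrt (real ?K) * ?b ^ (2 * ?L))"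
          using \<delta>' by (intro mult_nonneg_nonneg) auto
        then show "0 \<le> 1 / sqrt (real ?K) * ?b ^ (2 * ?L)"
          using \<open>0 \<le> ?b ^ (2 * ?L)\<close> by (intro mult_nonneg_nonneg) auto
        show "0 \<le> C * ?x + 1" using C elim(2) by (intro add_nonneg_nonneg mult_nonneg_nonneg) auto
      qed auto
      moreover have "real ?K * ((real (?K ^ 3) + \<delta>') * ((real m * real ?K + 1) / (real m * real t + 1)) powr \<gamma>) \<le>
        (2 * exp (?x ^ 3)) * (((2 * exp (?x ^ 3)) ^ 3 + \<delta>') * ((real m * (2 * exp (?x ^ 3)) + 1) / exp (exp ?x)) powr \<gamma>)"
      proof (intro mult_mono K(2) add_mono powr_mono2 frac_le order_refl)
        show "real (?K ^ 3) \<le> (2 * exp (?x ^ 3)) ^ 3" unfolding of_nat_power using K(2) by (intro power_mono) auto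
        show "exp (exp ?x) \<le> real m * real t + 1" unfolding expexpx using mult_right_mono[OF m(2), of "real t"] by simp
      qed (use \<delta>' \<gamma> in \<open>auto intro!: mult_nonneg_nonneg add_nonneg_nonneg\<close>)
      moreover have "real t * (real k * mean_field h \<alpha> ?\<tau> + real k * mean_field h \<alpha> (Suc ?\<tau>)) \<le>
          exp (exp ?x) * (2 * real k * exp (- (c * exp ?x powr (1 + \<epsilon>))))"
      proof -
        have "mean_field h \<alpha> (Suc ?\<tau>) \<le> mean_field h \<alpha> ?\<tau>"
          using decseq_mean_field[OF mf] by (simp add: decseq_def)
        then have "real k * mean_field h \<alpha> ?\<tau> + real k * mean_field h \<alpha> (Suc ?\<tau>) \<le> 2 * real k * mean_field h \<alpha> ?\<tau>"
          using mult_left_mono[of "mean_field h \<alpha> (Suc ?\<tau>)" "mean_field h \<alpha> ?\<tau>" "real k"] by simp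
        moreover have "mean_field h \<alpha> ?\<tau> \<le> exp (- (c * exp ?x powr (1 + \<epsilon>)))"
        proof -
          have "c * exp ?x powr (1 + \<epsilon>) = real h powr (- 3 - real \<tau>0) * exp ((1 + \<epsilon>) * (?x - ln lnd))"
            using lnd by (simp add: c_def powr_def exp_diff right_diff_distrib)
          also have "(1 + \<epsilon>) * (?x - ln lnd) = R t * ln (real h)"
            using lnh by (simp add: R_eq[OF elim(2)])
          also have "exp (R t * ln (real h)) = real h powr R t" using dh by (simp add: powr_def)
          also have "real h powr (- 3 - real \<tau>0) * real h powr R t = real h powr (R t - 3 - real \<tau>0)"
            by (simp add: powr_add[symmetric] algebra_simps)
          also have "\<dots> \<le> real h powr real (?\<tau> - \<tau>0)"
            using \<tau> dh by (intro powr_mono) auto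
          also have "\<dots> = real (h ^ (?\<tau> - \<tau>0))" using dh by (simp add: powr_realpow)
          finally have "exp (- real (h ^ (?\<tau> - \<tau>0))) \<le> exp (- (c * exp ?x powr (1 + \<epsilon>)))" by (simp only: exp_le_cancel_iff neg_le_iff_le)
          moreover have "\<tau>0 + (?\<tau> - \<tau>0) = ?\<tau>" using \<tau>(3) by simp
          ultimately show ?thesis using order_trans[OF \<tau>0[of "?\<tau> - \<tau>0"]] by (simp only:)
        qed
        ultimately have "real k * mean_field h \<alpha> ?\<tau> + real k * mean_field h \<alpha> (Suc ?\<tau>) \<le> 2 * real k * exp (- (c * exp ?x powr (1 + \<epsilon>)))"
          using mult_left_mono[of "mean_field h \<alpha> ?\<tau>" "exp (- (c * exp ?x powr (1 + \<epsilon>)))" "2 * real k"] by simp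
        then show ?thesis unfolding expexpx by (intro mult_left_mono) auto
      qed
      moreover have "real ?K * (real (2 * (m * ?K)) * real k / real (?K ^ 3)) \<le> (2 * real m * real k) / exp (?x ^ 3)"
      proof -
        have "real ?K * (real (2 * (m * ?K)) * real k / real (?K ^ 3)) = (2 * real m * real k) / real ?K"
          using K(3) by (simp add: eval_nat_numeral)
        also have "\<dots> \<le> (2 * real m * real k) / exp (?x ^ 3)" using K(1) by (intro frac_le) auto
        finally show ?thesis .
      qed
      ultimately show ?case unfolding E_def by linarith
    qed
  qed
  moreover have "eventually (\<lambda>t. ?P t \<le> 1) sequentially"
    using prob_space.prob_le_1[OF prob_space_protocol_space] by simp
  moreover have "((\<lambda>t. 1 - E (x t)) \<longlongrightarrow> 1) sequentially"
    using tendsto_diff[OF tendsto_const[of 1] E_lim] by simp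
  ultimately have "?P \<longlonglongrightarrow> 1" using tendsto_const by (rule tendsto_sandwich)
  then show ?thesis unfolding R_def .
qed

end
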